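(* Let $N$ be a positive integer, let $\Gamma$ be a discrete group and $\Lambda$ a subgroup of $\Gamma$. Assume that $\Lambda$ is normal in $\Gamma$. Then there is an exact sequence of Hopf $*$-algebras $$\mathbb{C}\longrightarrow \mathcal{O}(\widehat{\Lambda})\longrightarrow \mathcal{O}(H_{N}^{+}(\Gamma, \Lambda))\longrightarrow \mathcal{O}(H_{N}^{+}(\Gamma/\Lambda))\longrightarrow \mathbb{C}.$$
   Context: A CQG-algebra is a Hopf $*$-algebra spanned by the coefficients of its finite-dimensional unitary corepresentations. For a discrete group $\Lambda$, $\mathcal{O}(\widehat{\Lambda})=\mathbb{C}[\Lambda]$ with $\Delta(g)=g\otimes g$, $g^*=g^{-1}$. Exactness: let $\mathcal{O}(\mathbb{H})\subset\mathcal{O}(\mathbb{G})$ be a Hopf $*$-subalgebra of a CQG-algebra, and let $I$ be the kernel of the counit of $\mathcal{O}(\mathbb{H})$. If $I\mathcal{O}(\mathbb{G})=\mathcal{O}(\mathbb{G})I$, this is a Hopf $*$-ideal and the sequence $\mathbb{C}\to\mathcal{O}(\mathbb{H})\to\mathcal{O}(\mathbb{G})\to\mathcal{O}(\mathbb{G})/\mathcal{O}(\mathbb{G})I\to\mathbb{C}$ is said to be exact. For a discrete group $\Gamma$, $\mathcal{O}(H_{N}^{+}(\Gamma))$ is the universal unital $*$-algebra generated by elements $a_{ij}(g)$, $1\leqslant i,j\leqslant N$, $g\in\Gamma$, with $a_{ij}(g)^*=a_{ij}(g^{-1})$ and relations $$a_{ij}(g)a_{ik}(h)=\delta_{jk}a_{ij}(gh),\quad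 a_{ji}(g)a_{ki}(h)=\delta_{jk}a_{ji}(gh),\quad \sum_{k=1}^{N}a_{ik}(e)=1=\sum_{k=1}^{N}a_{kj}(e),$$ a CQG-algebra with $\Delta(a_{ij}(g))=\sum_{k}a_{ik}(g)\otimes a_{kj}(g)$. For a subgroup $\Lambda<\Gamma$, $\mathcal{O}(H_{N}^{+}(\Gamma,\Lambda))$ is the quotient of $\mathcal{O}(H_{N}^{+}(\Gamma))$ by the Hopf $*$-ideal generated by the relations $\sum_{k}a_{ik}(g)=\sum_{k}a_{jk}(g)$ for all $1\leqslant i,j\leqslant N$ and $g\in\Lambda$. The copy of $\mathcal{O}(\widehat{\Lambda})$ in $\mathcal{O}(H_{N}^{+}(\Gamma,\Lambda))$ is the one given by one-dimensional representations, $\lambda\mapsto\sum_{k=1}^{N}a_{ik}(\lambda)$ (independent of $i$), and the surjection onto $\mathcal{O}(H_{N}^{+}(\Gamma/\Lambda))$ is $a_{ij}(g)\mapsto a_{ij}([g])$, with $[g]$ the class of $g$ in $\Gamma/\Lambda$. *)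

theory Defs
  imports Complex_Main "HOL-Algebra.Module" "HOL-Algebra.QuotRing" "HOL-Library.Poly_Mapping"
begin

section \<open>Unital complex *-algebras on carrier sets\<close>

record 'a star_alg = "(complex, 'a) module" +
  star :: "'a \<Rightarrow> 'a"

definition complex_alg :: "complex star_alg" where
  "complex_alg = \<lparr>carrier = UNIV, monoid.mult = (*), monoid.one = 1, ring.zero = 0, ring.add = (+), smult = (*), star = cnj\<rparr>"

definition star_algebra :: "('a, 'x) star_alg_scheme \<Rightarrow> bool" where
  "star_algebra A \<longleftrightarrow>
     ring A \<and> module complex_alg A \<and>
     (\<forall>c. \<forall>x\<in>carrier A. \<forall>y\<in>carrier A.
        (c \<odot>\<^bsub>A\<^esub> x) \<otimes>\<^bsub>A\<^esub> y = c \<odot>\<^bsub>A\<^esub> (x \<otimes>\<^bsub>A\<^esub> y) \<and>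
        x \<otimes>\<^bsub>A\<^esub> (c \<odot>\<^bsub>A\<^esub> y) = c \<odot>\<^bsub>A\<^esub> (x \<otimes>\<^bsub>A\<^esub> y)) \<and>
     (\<forall>x\<in>carrier A. star A x \<in> carrier A \<and> star A (star A x) = x) \<and>
     (\<forall>c. \<forall>x\<in>carrier A. star A (c \<odot>\<^bsub>A\<^esub> x) = cnj c \<odot>\<^bsub>A\<^esub> star A x) \<and>
     (\<forall>x\<in>carrier A. \<forall>y\<in>carrier A.
        star A (x \<oplus>\<^bsub>A\<^esub> y) = star A x \<oplus>\<^bsub>A\<^esub> star A y \<and>
        star A (x \<otimes>\<^bsub>A\<^esub> y) = star A y \<otimes>\<^bsub>A\<^esub> star A x)"

definition star_hom :: "('a, 'x) star_alg_scheme \<Rightarrow> ('b, 'y) star_alg_scheme \<Rightarrow> ('a \<Rightarrow> 'b) \<Rightarrow> bool" where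
  "star_hom A B f \<longleftrightarrow>
     f \<in> ring_hom A B \<and>
     (\<forall>c. \<forall>x\<in>carrier A. f (c \<odot>\<^bsub>A\<^esub> x) = c \<odot>\<^bsub>B\<^esub> f x) \<and>
     (\<forall>x\<in>carrier A. f (star A x) = star B (f x))"

definition opposite :: "('a, 'x) star_alg_scheme \<Rightarrow> ('a, 'x) star_alg_scheme" where
  "opposite A = A\<lparr>monoid.mult := \<lambda>x y. y \<otimes>\<^bsub>A\<^esub> x\<rparr>"

definition lin_span :: "('a, 'x) star_alg_scheme \<Rightarrow> 'a set \<Rightarrow> 'a set" where
  "lin_span A S = \<Inter>{V. submodule V complex_alg A \<and> S \<subseteq> V}"

definition star_ideal :: "'a set \<Rightarrow> ('a, 'x) star_alg_scheme \<Rightarrow> bool" where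
  "star_ideal I A \<longleftrightarrow> ideal I A \<and> (\<forall>x\<in>I. star A x \<in> I)"

definition star_ideal_gen :: "('a, 'x) star_alg_scheme \<Rightarrow> 'a set \<Rightarrow> 'a set" where
  "star_ideal_gen A S = \<Inter>{I. star_ideal I A \<and> S \<subseteq> I}"

definition star_quot :: "('a, 'x) star_alg_scheme \<Rightarrow> 'a set \<Rightarrow> 'a set star_alg" where
  "star_quot A I =
     \<lparr>carrier = carrier (A Quot I), monoid.mult = monoid.mult (A Quot I), monoid.one = monoid.one (A Quot I),
      ring.zero = ring.zero (A Quot I), ring.add = ring.add (A Quot I),
      smult = \<lambda>c X. \<Union>x\<in>X. I +>\<^bsub>A\<^esub> (c \<odot>\<^bsub>A\<^esub> x),
      star = \<lambda>X. \<Union>x\<in>X. I +>\<^bsub>A\<^esub> star A x\<rparr>"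

section \<open>Monoid algebras\<close>

text \<open>The *-algebra \<open>\<complex>[M]\<close> of a monoid \<open>M\<close> with an anti-multiplicative involution \<open>s\<close>. Besides group
  algebras, both free *-algebras and tensor products are obtained from it.\<close>

definition monoid_alg :: "('m, 'x) monoid_scheme \<Rightarrow> ('m \<Rightarrow> 'm) \<Rightarrow> ('m \<Rightarrow>\<^sub>0 complex) star_alg" where
  "monoid_alg M s =
     \<lparr>carrier = {p. Poly_Mapping.keys p \<subseteq> carrier M},
      monoid.mult = \<lambda>p q. \<Sum>x\<in>Poly_Mapping.keys p. \<Sum>y\<in>Poly_Mapping.keys q. Poly_Mapping.single (x \<otimes>\<^bsub>M\<^esub> y) (Poly_Mapping.lookup p x * Poly_Mapping.lookup q y),
      monoid.one = Poly_Mapping.single \<one>\<^bsub>M\<^esub> 1,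
      ring.zero = 0,
      ring.add = (+),
      smult = \<lambda>c p. \<Sum>x\<in>Poly_Mapping.keys p. Poly_Mapping.single x (c * Poly_Mapping.lookup p x),
      star = \<lambda>p. \<Sum>x\<in>Poly_Mapping.keys p. Poly_Mapping.single (s x) (cnj (Poly_Mapping.lookup p x))\<rparr>"

definition lin_ext :: "('b, 'x) star_alg_scheme \<Rightarrow> ('m \<Rightarrow> 'b) \<Rightarrow> ('m \<Rightarrow>\<^sub>0 complex) \<Rightarrow> 'b" where
  "lin_ext B f p = (\<Oplus>\<^bsub>B\<^esub>x\<in>Poly_Mapping.keys p. Poly_Mapping.lookup p x \<odot>\<^bsub>B\<^esub> f x)"

section \<open>Tensor products\<close>

text \<open>The algebraic tensor product is the free vector space on \<open>carrier A \<times> carrier B\<close> modulo the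
  span of the bilinearity relations. That span is a *-ideal of the monoid algebra of \<open>A \<times> B\<close>
  (relations times basis vectors are relations), so the product and star
  \<open>(a \<otimes> b)(c \<otimes> d) = ac \<otimes> bd\<close>, \<open>(a \<otimes> b)\<^sup>* = a\<^sup>* \<otimes> b\<^sup>*\<close> come from the monoid algebra.\<close>

definition bilinear_relations ::
    "('a, 'x) star_alg_scheme \<Rightarrow> ('b, 'y) star_alg_scheme \<Rightarrow> ('a \<times> 'b \<Rightarrow>\<^sub>0 complex) set" where
  "bilinear_relations A B =
     {Poly_Mapping.single (a \<oplus>\<^bsub>A\<^esub> a', b) 1 - Poly_Mapping.single (a, b) 1 - Poly_Mapping.single (a', b) 1
        | a a' b. a \<in> carrier A \<and> a' \<in> carrier A \<and> b \<in> carrier B} \<union>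
     {Poly_Mapping.single (a, b \<oplus>\<^bsub>B\<^esub> b') 1 - Poly_Mapping.single (a, b) 1 - Poly_Mapping.single (a, b') 1
        | a b b'. a \<in> carrier A \<and> b \<in> carrier B \<and> b' \<in> carrier B} \<union>
     {Poly_Mapping.single (c \<odot>\<^bsub>A\<^esub> a, b) 1 - Poly_Mapping.single (a, b) c
        | a b c. a \<in> carrier A \<and> b \<in> carrier B} \<union>
     {Poly_Mapping.single (a, c \<odot>\<^bsub>B\<^esub> b) 1 - Poly_Mapping.single (a, b) c
        | a b c. a \<in> carrier A \<and> b \<in> carrier B}"

definition pair_alg ::
    "('a, 'x) star_alg_scheme \<Rightarrow> ('b, 'y) star_alg_scheme \<Rightarrow> ('a \<times> 'b \<Rightarrow>\<^sub>0 complex) star_alg" where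
  "pair_alg A B = monoid_alg (A \<times>\<times> B) (map_prod (star A) (star B))"

definition bilinear_span ::
    "('a, 'x) star_alg_scheme \<Rightarrow> ('b, 'y) star_alg_scheme \<Rightarrow> ('a \<times> 'b \<Rightarrow>\<^sub>0 complex) set" where
  "bilinear_span A B = lin_span (pair_alg A B) (bilinear_relations A B)"

definition tensor ::
    "('a, 'x) star_alg_scheme \<Rightarrow> ('b, 'y) star_alg_scheme \<Rightarrow> ('a \<times> 'b \<Rightarrow>\<^sub>0 complex) set star_alg" where
  "tensor A B = star_quot (pair_alg A B) (bilinear_span A B)"

definition pure_tensor ::
    "('a, 'x) star_alg_scheme \<Rightarrow> ('b, 'y) star_alg_scheme \<Rightarrow> 'a \<Rightarrow> 'b \<Rightarrow> ('a \<times> 'b \<Rightarrow>\<^sub>0 complex) set" where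
  "pure_tensor A B a b = bilinear_span A B +>\<^bsub>pair_alg A B\<^esub> Poly_Mapping.single (a, b) 1"

text \<open>The linear map \<open>A \<otimes> B \<rightarrow> V\<close> induced by a bilinear map \<open>\<beta>\<close>; as for the induced maps in
  \<open>FactRing_iso\<close>, \<open>the_elem\<close> picks the common value on the representatives of a coset.\<close>

definition tensor_lift :: "('v, 'x) star_alg_scheme \<Rightarrow> ('a \<Rightarrow> 'b \<Rightarrow> 'v) \<Rightarrow> ('a \<times> 'b \<Rightarrow>\<^sub>0 complex) set \<Rightarrow> 'v" where
  "tensor_lift V \<beta> X = the_elem (lin_ext V (case_prod \<beta>) ` X)"

definition tensor_map ::
    "('c, 'x) star_alg_scheme \<Rightarrow> ('d, 'y) star_alg_scheme \<Rightarrow> ('a \<Rightarrow> 'c) \<Rightarrow> ('b \<Rightarrow> 'd) \<Rightarrow>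
     ('a \<times> 'b \<Rightarrow>\<^sub>0 complex) set \<Rightarrow> ('c \<times> 'd \<Rightarrow>\<^sub>0 complex) set" where
  "tensor_map C D f g = tensor_lift (tensor C D) (\<lambda>a b. pure_tensor C D (f a) (g b))"

definition tensor_assoc ::
    "('a, 'x) star_alg_scheme \<Rightarrow> ('b, 'y) star_alg_scheme \<Rightarrow> ('c, 'z) star_alg_scheme \<Rightarrow>
     (('a \<times> 'b \<Rightarrow>\<^sub>0 complex) set \<times> 'c \<Rightarrow>\<^sub>0 complex) set \<Rightarrow> ('a \<times> ('b \<times> 'c \<Rightarrow>\<^sub>0 complex) set \<Rightarrow>\<^sub>0 complex) set" where
  "tensor_assoc A B C =
     tensor_lift (tensor A (tensor B C))
       (\<lambda>t c. tensor_lift (tensor A (tensor B C))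
          (\<lambda>a b. pure_tensor A (tensor B C) a (pure_tensor B C b c)) t)"

section \<open>Hopf *-algebras\<close>

record 'a hopf_star_alg = "'a star_alg" +
  comult :: "'a \<Rightarrow> ('a \<times> 'a \<Rightarrow>\<^sub>0 complex) set"
  counit :: "'a \<Rightarrow> complex"
  antipode :: "'a \<Rightarrow> 'a"

definition hopf_star_algebra :: "('a, 'x) hopf_star_alg_scheme \<Rightarrow> bool" where
  "hopf_star_algebra A \<longleftrightarrow>
     star_algebra A \<and>
     star_hom A (tensor A A) (comult A) \<and>
     (\<forall>x\<in>carrier A.
        tensor_assoc A A A (tensor_map (tensor A A) A (comult A) id (comult A x)) =
        tensor_map A (tensor A A) id (comult A) (comult A x)) \<and>
     star_hom A complex_alg (counit A) \<and>
     (\<forall>x\<in>carrier A.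
        tensor_lift A (\<lambda>a b. counit A a \<odot>\<^bsub>A\<^esub> b) (comult A x) = x \<and>
        tensor_lift A (\<lambda>a b. counit A b \<odot>\<^bsub>A\<^esub> a) (comult A x) = x) \<and>
     antipode A \<in> carrier A \<rightarrow> carrier A \<and>
     (\<forall>x\<in>carrier A. \<forall>y\<in>carrier A. antipode A (x \<oplus>\<^bsub>A\<^esub> y) = antipode A x \<oplus>\<^bsub>A\<^esub> antipode A y) \<and>
     (\<forall>c. \<forall>x\<in>carrier A. antipode A (c \<odot>\<^bsub>A\<^esub> x) = c \<odot>\<^bsub>A\<^esub> antipode A x) \<and>
     (\<forall>x\<in>carrier A.
        tensor_lift A (\<lambda>a b. antipode A a \<otimes>\<^bsub>A\<^esub> b) (comult A x) = counit A x \<odot>\<^bsub>A\<^esub> \<one>\<^bsub>A\<^esub> \<and>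
        tensor_lift A (\<lambda>a b. a \<otimes>\<^bsub>A\<^esub> antipode A b) (comult A x) = counit A x \<odot>\<^bsub>A\<^esub> \<one>\<^bsub>A\<^esub>)"

definition hopf_star_hom ::
    "('a, 'x) hopf_star_alg_scheme \<Rightarrow> ('b, 'y) hopf_star_alg_scheme \<Rightarrow> ('a \<Rightarrow> 'b) \<Rightarrow> bool" where
  "hopf_star_hom A B f \<longleftrightarrow>
     star_hom A B f \<and>
     (\<forall>x\<in>carrier A.
        comult B (f x) = tensor_map B B f f (comult A x) \<and>
        counit B (f x) = counit A x \<and>
        antipode B (f x) = f (antipode A x))"

definition hopf_star_iso ::
    "('a, 'x) hopf_star_alg_scheme \<Rightarrow> ('b, 'y) hopf_star_alg_scheme \<Rightarrow> ('a \<Rightarrow> 'b) \<Rightarrow> bool" where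
  "hopf_star_iso A B f \<longleftrightarrow> hopf_star_hom A B f \<and> bij_betw f (carrier A) (carrier B)"

text \<open>The coideal condition is \<open>\<Delta>(J) \<subseteq> J \<otimes> A + A \<otimes> J\<close>.\<close>

definition hopf_star_ideal :: "'a set \<Rightarrow> ('a, 'x) hopf_star_alg_scheme \<Rightarrow> bool" where
  "hopf_star_ideal J A \<longleftrightarrow>
     star_ideal J A \<and>
     (\<forall>x\<in>J.
        comult A x \<in> lin_span (tensor A A)
          ({pure_tensor A A a b | a b. a \<in> J \<and> b \<in> carrier A} \<union>
           {pure_tensor A A a b | a b. a \<in> carrier A \<and> b \<in> J}) \<and>
        counit A x = 0 \<and>
        antipode A x \<in> J)"

text \<open>In general an intersection of Hopf *-ideals need not be one, but whenever there is a smallest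
  Hopf *-ideal containing \<open>S\<close>, the following is it.\<close>

definition hopf_star_ideal_gen :: "('a, 'x) hopf_star_alg_scheme \<Rightarrow> 'a set \<Rightarrow> 'a set" where
  "hopf_star_ideal_gen A S = \<Inter>{J. hopf_star_ideal J A \<and> S \<subseteq> J}"

definition hopf_quot :: "('a, 'x) hopf_star_alg_scheme \<Rightarrow> 'a set \<Rightarrow> 'a set hopf_star_alg" where
  "hopf_quot A J =
     star_alg.extend (star_quot A J)
       (hopf_star_alg.fields
          (\<lambda>X. the_elem ((\<lambda>x. tensor_map (star_quot A J) (star_quot A J)
                                 (\<lambda>a. J +>\<^bsub>A\<^esub> a) (\<lambda>a. J +>\<^bsub>A\<^esub> a) (comult A x)) ` X))
          (\<lambda>X. the_elem (counit A ` X))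
          (\<lambda>X. \<Union>x\<in>X. J +>\<^bsub>A\<^esub> antipode A x))"

section \<open>CQG-algebras and exact sequences\<close>

definition unitary_corep :: "('a, 'x) hopf_star_alg_scheme \<Rightarrow> nat \<Rightarrow> (nat \<Rightarrow> nat \<Rightarrow> 'a) \<Rightarrow> bool" where
  "unitary_corep A n u \<longleftrightarrow>
     (\<forall>i<n. \<forall>j<n.
        u i j \<in> carrier A \<and>
        comult A (u i j) = (\<Oplus>\<^bsub>tensor A A\<^esub>k\<in>{..<n}. pure_tensor A A (u i k) (u k j)) \<and>
        counit A (u i j) = (if i = j then 1 else 0) \<and>
        (\<Oplus>\<^bsub>A\<^esub>k\<in>{..<n}. u i k \<otimes>\<^bsub>A\<^esub> star A (u j k)) = (if i = j then \<one>\<^bsub>A\<^esub> else \<zero>\<^bsub>A\<^esub>) \<and>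
        (\<Oplus>\<^bsub>A\<^esub>k\<in>{..<n}. star A (u k i) \<otimes>\<^bsub>A\<^esub> u k j) = (if i = j then \<one>\<^bsub>A\<^esub> else \<zero>\<^bsub>A\<^esub>))"

definition cqg_algebra :: "('a, 'x) hopf_star_alg_scheme \<Rightarrow> bool" where
  "cqg_algebra A \<longleftrightarrow>
     hopf_star_algebra A \<and>
     carrier A = lin_span A {u i j | u n i j. unitary_corep A n u \<and> i < n \<and> j < n}"

text \<open>Exactness of \<open>\<complex> \<rightarrow> B \<rightarrow> A \<rightarrow> Q \<rightarrow> \<complex>\<close> with maps \<open>\<iota> : B \<rightarrow> A\<close> and \<open>\<pi> : A \<rightarrow> Q\<close>: through \<open>\<iota>\<close>, \<open>B\<close> is
  a Hopf *-subalgebra of the CQG-algebra \<open>A\<close>; if \<open>I\<close> is its augmentation ideal, then \<open>IA = AI\<close>; and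
  \<open>\<pi>\<close> is, up to an isomorphism of Hopf *-algebras, the quotient map \<open>A \<rightarrow> A/AI\<close>.\<close>

definition exact_sequence ::
    "('b, 'x) hopf_star_alg_scheme \<Rightarrow> ('b \<Rightarrow> 'a) \<Rightarrow> ('a, 'y) hopf_star_alg_scheme \<Rightarrow> ('a \<Rightarrow> 'q) \<Rightarrow>
     ('q, 'z) hopf_star_alg_scheme \<Rightarrow> bool" where
  "exact_sequence B \<iota> A \<pi> Q \<longleftrightarrow>
     hopf_star_algebra B \<and> cqg_algebra A \<and> hopf_star_algebra Q \<and>
     hopf_star_hom B A \<iota> \<and> inj_on \<iota> (carrier B) \<and> hopf_star_hom A Q \<pi> \<and>
     (let I = \<iota> ` {b \<in> carrier B. counit B b = 0};
          IA = lin_span A {x \<otimes>\<^bsub>A\<^esub> a | x a. x \<in> I \<and> a \<in> carrier A};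
          AI = lin_span A {a \<otimes>\<^bsub>A\<^esub> x | a x. a \<in> carrier A \<and> x \<in> I}
      in IA = AI \<and> hopf_star_ideal AI A \<and>
         (\<exists>\<theta>. hopf_star_iso (hopf_quot A AI) Q \<theta> \<and> (\<forall>a\<in>carrier A. \<pi> a = \<theta> (AI +>\<^bsub>A\<^esub> a))))"

section \<open>Group algebras\<close>

definition group_elt :: "'g \<Rightarrow> ('g \<Rightarrow>\<^sub>0 complex)" where
  "group_elt g = Poly_Mapping.single g 1"

definition dual_group :: "('g, 'x) monoid_scheme \<Rightarrow> ('g \<Rightarrow>\<^sub>0 complex) hopf_star_alg" where
  "dual_group G =
     (let A = monoid_alg G (m_inv G)
      in star_alg.extend A
           (hopf_star_alg.fields
              (lin_ext (tensor A A) (\<lambda>g. pure_tensor A A (group_elt g) (group_elt g)))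
              (lin_ext complex_alg (\<lambda>g. 1))
              (lin_ext A (\<lambda>g. group_elt (inv\<^bsub>G\<^esub> g)))))"

section \<open>*-algebras given by generators and relations\<close>

text \<open>The letter \<open>(x, False)\<close> stands for the generator \<open>x\<close> and \<open>(x, True)\<close> for \<open>x\<^sup>*\<close>.\<close>

definition word_monoid :: "'x set \<Rightarrow> ('x \<times> bool) list monoid" where
  "word_monoid X = \<lparr>carrier = lists (X \<times> UNIV), monoid.mult = (@), monoid.one = []\<rparr>"

definition word_star :: "('x \<times> bool) list \<Rightarrow> ('x \<times> bool) list" where
  "word_star w = rev (map (apsnd Not) w)"

definition free_star_alg :: "'x set \<Rightarrow> (('x \<times> bool) list \<Rightarrow>\<^sub>0 complex) star_alg" where
  "free_star_alg X = monoid_alg (word_monoid X) word_star"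

definition free_gen :: "'x \<Rightarrow> (('x \<times> bool) list \<Rightarrow>\<^sub>0 complex)" where
  "free_gen x = Poly_Mapping.single [(x, False)] 1"

text \<open>The *-homomorphism out of the free *-algebra sending each generator \<open>x\<close> to \<open>f x\<close>.\<close>

definition free_ext :: "('b, 'y) star_alg_scheme \<Rightarrow> ('x \<Rightarrow> 'b) \<Rightarrow> (('x \<times> bool) list \<Rightarrow>\<^sub>0 complex) \<Rightarrow> 'b" where
  "free_ext B f =
     lin_ext B (\<lambda>w. foldr (\<lambda>(x, s) b. (if s then star B (f x) else f x) \<otimes>\<^bsub>B\<^esub> b) w \<one>\<^bsub>B\<^esub>)"

text \<open>The universal *-algebra generated by \<open>X\<close> subject to the relations \<open>r = 0\<close> for \<open>r \<in> R\<close>.\<close>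

definition relation_ideal ::
    "'x set \<Rightarrow> (('x \<times> bool) list \<Rightarrow>\<^sub>0 complex) set \<Rightarrow> (('x \<times> bool) list \<Rightarrow>\<^sub>0 complex) set" where
  "relation_ideal X R = star_ideal_gen (free_star_alg X) R"

definition presented_alg ::
    "'x set \<Rightarrow> (('x \<times> bool) list \<Rightarrow>\<^sub>0 complex) set \<Rightarrow> (('x \<times> bool) list \<Rightarrow>\<^sub>0 complex) set star_alg" where
  "presented_alg X R = star_quot (free_star_alg X) (relation_ideal X R)"

definition presented_gen ::
    "'x set \<Rightarrow> (('x \<times> bool) list \<Rightarrow>\<^sub>0 complex) set \<Rightarrow> 'x \<Rightarrow> (('x \<times> bool) list \<Rightarrow>\<^sub>0 complex) set" where
  "presented_gen X R x = relation_ideal X R +>\<^bsub>free_star_alg X\<^esub> free_gen x"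

definition presented_ext ::
    "('b, 'y) star_alg_scheme \<Rightarrow> ('x \<Rightarrow> 'b) \<Rightarrow> (('x \<times> bool) list \<Rightarrow>\<^sub>0 complex) set \<Rightarrow> 'b" where
  "presented_ext B f X = the_elem (free_ext B f ` X)"

section \<open>Quantum reflection groups\<close>

type_synonym 'g hyp_letter = "(nat \<times> nat \<times> 'g) \<times> bool"
type_synonym 'g hyp_elt = "('g hyp_letter list \<Rightarrow>\<^sub>0 complex) set"

definition hyp_index :: "nat \<Rightarrow> ('g, 'x) monoid_scheme \<Rightarrow> (nat \<times> nat \<times> 'g) set" where
  "hyp_index N G = {1..N} \<times> {1..N} \<times> carrier G"

definition hyp_relations :: "nat \<Rightarrow> ('g, 'x) monoid_scheme \<Rightarrow> ('g hyp_letter list \<Rightarrow>\<^sub>0 complex) set" where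
  "hyp_relations N G =
     (let F = free_star_alg (hyp_index N G); a = (\<lambda>i j g. free_gen (i, j, g))
      in {star F (a i j g) \<ominus>\<^bsub>F\<^esub> a i j (inv\<^bsub>G\<^esub> g)
            | i j g. i \<in> {1..N} \<and> j \<in> {1..N} \<and> g \<in> carrier G} \<union>
         {a i j g \<otimes>\<^bsub>F\<^esub> a i k h \<ominus>\<^bsub>F\<^esub> (if j = k then a i j (g \<otimes>\<^bsub>G\<^esub> h) else \<zero>\<^bsub>F\<^esub>)
            | i j k g h. i \<in> {1..N} \<and> j \<in> {1..N} \<and> k \<in> {1..N} \<and> g \<in> carrier G \<and> h \<in> carrier G} \<union>
         {a j i g \<otimes>\<^bsub>F\<^esub> a k i h \<ominus>\<^bsub>F\<^esub> (if j = k then a j i (g \<otimes>\<^bsub>G\<^esub> h) else \<zero>\<^bsub>F\<^esub>)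
            | i j k g h. i \<in> {1..N} \<and> j \<in> {1..N} \<and> k \<in> {1..N} \<and> g \<in> carrier G \<and> h \<in> carrier G} \<union>
         {(\<Oplus>\<^bsub>F\<^esub>k\<in>{1..N}. a i k \<one>\<^bsub>G\<^esub>) \<ominus>\<^bsub>F\<^esub> \<one>\<^bsub>F\<^esub> | i. i \<in> {1..N}} \<union>
         {(\<Oplus>\<^bsub>F\<^esub>k\<in>{1..N}. a k j \<one>\<^bsub>G\<^esub>) \<ominus>\<^bsub>F\<^esub> \<one>\<^bsub>F\<^esub> | j. j \<in> {1..N}})"

definition hyp_alg :: "nat \<Rightarrow> ('g, 'x) monoid_scheme \<Rightarrow> 'g hyp_elt star_alg" where
  "hyp_alg N G = presented_alg (hyp_index N G) (hyp_relations N G)"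

definition hyp_gen :: "nat \<Rightarrow> ('g, 'x) monoid_scheme \<Rightarrow> nat \<Rightarrow> nat \<Rightarrow> 'g \<Rightarrow> 'g hyp_elt" where
  "hyp_gen N G i j g = presented_gen (hyp_index N G) (hyp_relations N G) (i, j, g)"

text \<open>The Hopf *-algebra \<open>\<O>(H\<^sub>N\<^sup>+(G))\<close>. The formula for \<open>\<Delta>\<close> forces \<open>\<epsilon>(a\<^sub>i\<^sub>j(g)) = \<delta>\<^sub>i\<^sub>j\<close> and
  \<open>S(a\<^sub>i\<^sub>j(g)) = a\<^sub>j\<^sub>i(g)\<^sup>* = a\<^sub>j\<^sub>i(g\<^sup>-\<^sup>1)\<close>; the antipode is here *-preserving and anti-multiplicative.\<close>

definition hyp :: "nat \<Rightarrow> ('g, 'x) monoid_scheme \<Rightarrow> 'g hyp_elt hopf_star_alg" where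
  "hyp N G =
     (let A = hyp_alg N G; a = hyp_gen N G
      in star_alg.extend A
           (hopf_star_alg.fields
              (presented_ext (tensor A A)
                 (\<lambda>(i, j, g). \<Oplus>\<^bsub>tensor A A\<^esub>k\<in>{1..N}. pure_tensor A A (a i k g) (a k j g)))
              (presented_ext complex_alg (\<lambda>(i, j, g). if i = j then 1 else 0))
              (presented_ext (opposite A) (\<lambda>(i, j, g). a j i (inv\<^bsub>G\<^esub> g)))))"

definition rel_hyp_ideal :: "nat \<Rightarrow> ('g, 'x) monoid_scheme \<Rightarrow> 'g set \<Rightarrow> 'g hyp_elt set" where
  "rel_hyp_ideal N G L =
     hopf_star_ideal_gen (hyp N G)
       {(\<Oplus>\<^bsub>hyp N G\<^esub>k\<in>{1..N}. hyp_gen N G i k g) \<ominus>\<^bsub>hyp N G\<^esub> (\<Oplus>\<^bsub>hyp N G\<^esub>k\<in>{1..N}. hyp_gen N G j k g)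
          | i j g. i \<in> {1..N} \<and> j \<in> {1..N} \<and> g \<in> L}"

definition rel_hyp :: "nat \<Rightarrow> ('g, 'x) monoid_scheme \<Rightarrow> 'g set \<Rightarrow> 'g hyp_elt set hopf_star_alg" where
  "rel_hyp N G L = hopf_quot (hyp N G) (rel_hyp_ideal N G L)"

definition rel_hyp_gen ::
    "nat \<Rightarrow> ('g, 'x) monoid_scheme \<Rightarrow> 'g set \<Rightarrow> nat \<Rightarrow> nat \<Rightarrow> 'g \<Rightarrow> 'g hyp_elt set" where
  "rel_hyp_gen N G L i j g = rel_hyp_ideal N G L +>\<^bsub>hyp N G\<^esub> hyp_gen N G i j g"

end

theory Submission
  imports Defs
begin

text \<open>
  A unital \<open>*\<close>-homomorphism out of \<open>\<O>(H\<^sub>N\<^sup>+(\<Gamma>))\<close> is a family \<open>a\<^sub>i\<^sub>j(g)\<close> satisfying the defining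
  relations, and every structure map comes from such a family. Since the \<open>a\<^sub>i\<^sub>j(g)\<close> are
  coefficients of unitary corepresentations and generate the algebra, the Hopf axioms follow from
  the multiplicativity of the structure maps, and the CQG property follows because coefficients of
  unitary corepresentations are closed under products.

  For \<open>\<lambda> \<in> \<Lambda>\<close> let \<open>r(\<lambda>) = \<Sum>\<^sub>k a\<^sub>i\<^sub>k(\<lambda>)\<close> in \<open>\<O>(H\<^sub>N\<^sup>+(\<Gamma>,\<Lambda>))\<close>. These elements are group-like, and the map
  \<open>\<lambda> \<mapsto> r(\<lambda>)\<close> is injective on \<open>\<complex>[\<Lambda>]\<close> because \<open>a\<^sub>i\<^sub>j(g) \<mapsto> \<delta>\<^sub>i\<^sub>j g\<close> sends \<open>r(\<lambda>)\<close> to \<open>\<lambda> \<in> \<complex>[\<Gamma>]\<close>. From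
  \<open>r(\<lambda>) a\<^sub>i\<^sub>j(g) = a\<^sub>i\<^sub>j(\<lambda>g)\<close> and \<open>a\<^sub>i\<^sub>j(g) r(\<lambda>) = a\<^sub>i\<^sub>j(g\<lambda>)\<close>, normality of \<open>\<Lambda>\<close> makes the left and right ideals
  generated by the \<open>r(\<lambda>) - 1\<close> coincide, and modulo this ideal \<open>a\<^sub>i\<^sub>j(g)\<close> depends only on the coset of
  \<open>g\<close>. This yields a homomorphism from \<open>\<O>(H\<^sub>N\<^sup>+(\<Gamma>/\<Lambda>))\<close> to the quotient, inverse to the one induced
  by \<open>a\<^sub>i\<^sub>j(g) \<mapsto> a\<^sub>i\<^sub>j([g])\<close>.
\<close>

section \<open>*-algebras, spans and ideals\<close>

text \<open>Quotients, tensor products and structure maps are given by formulas on representatives,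
  so an induced map has a meaning only after the ideal in question is shown to be killed. The kernel
  of a *-homomorphism is a *-ideal and that of a linear map a subspace, so this is checked on
  generators. A second obstacle is that \<open>rel_hyp_ideal\<close> is an intersection of Hopf
  *-ideals, which need not be one. It is identified with the plain *-ideal generated by the row sum
  relations. That ideal is a Hopf *-ideal because \<Delta> of a row sum is congruent to a pure
  tensor of row sums, and because column sums agree as soon as row sums do. Among the Hopf axioms,
  coassociativity and the counit laws compare two *-homomorphisms. The antipode laws do not, since S
  reverses products; they pass to products because the value at one factor is a scalar and can be
  moved out.\<close>

locale staralg = ring A for A :: "('a, 'x) star_alg_scheme" (structure) +
  assumes smult_closed [simp, intro]: "x \<in> carrier A \<Longrightarrow> c \<odot> x \<in> carrier A"
    and smult_l_distr: "x \<in> carrier A \<Longrightarrow> (c + d) \<odot> x = c \<odot> x \<oplus> d \<odot> x"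
    and smult_r_distr: "x \<in> carrier A \<Longrightarrow> y \<in> carrier A \<Longrightarrow> c \<odot> (x \<oplus> y) = c \<odot> x \<oplus> c \<odot> y"
    and smult_smult: "x \<in> carrier A \<Longrightarrow> c \<odot> (d \<odot> x) = (c * d) \<odot> x"
    and smult_one [simp]: "x \<in> carrier A \<Longrightarrow> 1 \<odot> x = x"
    and smult_mult_l: "x \<in> carrier A \<Longrightarrow> y \<in> carrier A \<Longrightarrow> (c \<odot> x) \<otimes> y = c \<odot> (x \<otimes> y)"
    and smult_mult_r: "x \<in> carrier A \<Longrightarrow> y \<in> carrier A \<Longrightarrow> x \<otimes> (c \<odot> y) = c \<odot> (x \<otimes> y)"
    and star_closed [simp, intro]: "x \<in> carrier A \<Longrightarrow> star A x \<in> carrier A"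
    and star_star [simp]: "x \<in> carrier A \<Longrightarrow> star A (star A x) = x"
    and star_smult: "x \<in> carrier A \<Longrightarrow> star A (c \<odot> x) = cnj c \<odot> star A x"
    and star_add: "x \<in> carrier A \<Longrightarrow> y \<in> carrier A \<Longrightarrow> star A (x \<oplus> y) = star A x \<oplus> star A y"
    and star_mult: "x \<in> carrier A \<Longrightarrow> y \<in> carrier A \<Longrightarrow> star A (x \<otimes> y) = star A y \<otimes> star A x"
begin

lemma smult_zero_l [simp]: "x \<in> carrier A \<Longrightarrow> 0 \<odot> x = \<zero>"
  using smult_l_distr[of x 0 0] by (metis add.r_cancel_one' add.left_neutral smult_closed)

lemma smult_zero_r [simp]: "c \<odot> \<zero> = \<zero>"
  using smult_r_distr[of \<zero> \<zero> c] by (metis add.r_cancel_one' l_zero smult_closed zero_closed)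

lemma star_zero [simp]: "star A \<zero> = \<zero>"
  using star_add[of \<zero> \<zero>] by (metis add.r_cancel_one' l_zero star_closed zero_closed)

lemma star_one [simp]: "star A \<one> = \<one>"
  using star_mult[of \<one> "star A \<one>"] by (metis l_one one_closed star_closed star_star)

text \<open>Turns subtraction into addition and scalar multiplication, the only operations that
  linear maps and subspaces are required to respect below.\<close>

lemma neg_eq_smult: "x \<in> carrier A \<Longrightarrow> \<ominus> x = (-1) \<odot> x"
proof -
  assume x: "x \<in> carrier A"
  have "(-1) \<odot> x \<oplus> x = ((-1) + 1) \<odot> x" using x by (subst smult_l_distr) auto
  then have "(-1) \<odot> x \<oplus> x = \<zero>" using x by simp
  then show ?thesis using x by (simp add: minus_equality)
qed

lemma minus_eq_smult: "x \<in> carrier A \<Longrightarrow> y \<in> carrier A \<Longrightarrow> x \<ominus> y = x \<oplus> (-1) \<odot> y"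
  by (simp add: a_minus_def neg_eq_smult)

lemma star_minus: "x \<in> carrier A \<Longrightarrow> y \<in> carrier A \<Longrightarrow> star A (x \<ominus> y) = star A x \<ominus> star A y"
  by (simp add: minus_eq_smult star_add star_smult)

lemma star_finsum:
  "finite I \<Longrightarrow> f \<in> I \<rightarrow> carrier A \<Longrightarrow> star A (\<Oplus>i\<in>I. f i) = (\<Oplus>i\<in>I. star A (f i))"
  by (induct set: finite) (auto simp: Pi_def star_add)

end

lemma complex_alg_simps [simp]:
  "carrier complex_alg = UNIV" "monoid.mult complex_alg = (*)" "monoid.one complex_alg = 1"
  "ring.zero complex_alg = 0" "ring.add complex_alg = (+)" "module.smult complex_alg = (*)"
  "star complex_alg = cnj"
  by (simp_all add: complex_alg_def)

lemma cring_complex_alg: "cring complex_alg"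
proof (rule cringI)
  have "\<exists>y. y + x = 0" for x :: complex
    by (rule exI[of _ "-x"]) simp
  then show "abelian_group complex_alg" by (intro abelian_groupI) (auto simp: add.assoc add.commute)
  show "comm_monoid complex_alg" by (intro comm_monoidI) (auto simp: mult.assoc mult.commute)
qed (auto simp: algebra_simps)

lemma star_algebra_iff: "star_algebra A \<longleftrightarrow> staralg A"
proof
  assume A: "star_algebra A"
  then interpret ring A by (simp add: star_algebra_def)
  interpret module complex_alg A using A by (simp add: star_algebra_def)
  show "staralg A"
    using A smult_closed smult_l_distr smult_r_distr smult_assoc1 smult_one
    by unfold_locales (auto simp: star_algebra_def)
next
  assume "staralg A"
  then interpret staralg A .
  have "module complex_alg A"
    by (intro moduleI cring_complex_alg abelian_group_axioms)
      (auto simp: smult_l_distr smult_r_distr smult_smult)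
  then show "star_algebra A"
    unfolding star_algebra_def
    by (auto simp: smult_mult_l smult_mult_r star_smult star_add star_mult ring_axioms)
qed

lemma staralg_complex: "staralg complex_alg"
proof -
  interpret cring complex_alg by (rule cring_complex_alg)
  show ?thesis by unfold_locales (auto simp: algebra_simps)
qed

text \<open>Closure under negatives is multiplication by the scalar -1, so four conditions describe
  a subspace.\<close>

lemma submodule_iff:
  assumes "staralg A"
  shows "submodule H complex_alg A \<longleftrightarrow> H \<subseteq> carrier A \<and> \<zero>\<^bsub>A\<^esub> \<in> H \<and>
    (\<forall>x\<in>H. \<forall>y\<in>H. x \<oplus>\<^bsub>A\<^esub> y \<in> H) \<and> (\<forall>c. \<forall>x\<in>H. c \<odot>\<^bsub>A\<^esub> x \<in> H)" (is "_ \<longleftrightarrow> ?R")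
proof -
  interpret staralg A by fact
  interpret M: module complex_alg A using assms by (simp add: star_algebra_iff[symmetric] star_algebra_def)
  show ?thesis
  proof
    assume S: "submodule H complex_alg A"
    then interpret submodule H complex_alg A .
    show ?R using M.submoduleE[OF S] one_closed by auto
  next
    assume R: ?R
    then show "submodule H complex_alg A"
      by (intro M.submoduleI) (auto simp: neg_eq_smult subset_iff)
  qed
qed

lemma lin_span_subset:
  assumes "staralg A" "S \<subseteq> carrier A"
  shows "lin_span A S \<subseteq> carrier A"
  using assms by (auto simp: lin_span_def submodule_iff staralg.smult_closed ring.ring_simprules staralg.axioms(1))

lemma lin_span_submodule:
  assumes "staralg A" "S \<subseteq> carrier A"
  shows "submodule (lin_span A S) complex_alg A"
proof -
  interpret staralg A by fact
  show ?thesis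
    using lin_span_subset[OF assms] by (subst submodule_iff[OF assms(1)]) (auto simp: lin_span_def submodule_iff[OF assms(1)])
qed

lemma lin_span_base: "x \<in> S \<Longrightarrow> x \<in> lin_span A S"
  by (auto simp: lin_span_def)

lemma lin_span_minimal: "submodule V complex_alg A \<Longrightarrow> S \<subseteq> V \<Longrightarrow> lin_span A S \<subseteq> V"
  by (auto simp: lin_span_def)

lemma lin_span_closed:
  assumes "staralg A" "S \<subseteq> carrier A"
  shows "\<zero>\<^bsub>A\<^esub> \<in> lin_span A S"
    "x \<in> lin_span A S \<Longrightarrow> y \<in> lin_span A S \<Longrightarrow> x \<oplus>\<^bsub>A\<^esub> y \<in> lin_span A S"
    "x \<in> lin_span A S \<Longrightarrow> c \<odot>\<^bsub>A\<^esub> x \<in> lin_span A S"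
  using lin_span_submodule[OF assms] by (auto simp: submodule_iff[OF assms(1)])

text \<open>The elements of the carrier with property \<open>P\<close> form one of the subspaces
  whose intersection is the span.\<close>

lemma lin_span_induct [consumes 3, case_names base zero add smult]:
  assumes A: "staralg A" and S: "S \<subseteq> carrier A" and x: "x \<in> lin_span A S"
    and base: "\<And>x. x \<in> S \<Longrightarrow> P x" and zero: "P \<zero>\<^bsub>A\<^esub>"
    and add: "\<And>x y. x \<in> carrier A \<Longrightarrow> y \<in> carrier A \<Longrightarrow> P x \<Longrightarrow> P y \<Longrightarrow> P (x \<oplus>\<^bsub>A\<^esub> y)"
    and smult: "\<And>c x. x \<in> carrier A \<Longrightarrow> P x \<Longrightarrow> P (c \<odot>\<^bsub>A\<^esub> x)"
  shows "P x"
proof -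
  interpret staralg A by fact
  have "submodule {x \<in> carrier A. P x} complex_alg A"
    by (subst submodule_iff[OF A]) (auto intro: zero add smult)
  from lin_span_minimal[OF this, of S] x S base show ?thesis by auto
qed

lemma star_idealI:
  assumes "staralg A" "submodule I complex_alg A"
    "\<And>x a. x \<in> I \<Longrightarrow> a \<in> carrier A \<Longrightarrow> a \<otimes>\<^bsub>A\<^esub> x \<in> I"
    "\<And>x a. x \<in> I \<Longrightarrow> a \<in> carrier A \<Longrightarrow> x \<otimes>\<^bsub>A\<^esub> a \<in> I"
    "\<And>x. x \<in> I \<Longrightarrow> star A x \<in> I"
  shows "star_ideal I A"
proof -
  interpret staralg A by fact
  have "subgroup I (add_monoid A)" using assms(2) by (simp add: submodule_def)
  then show ?thesis using assms by (auto simp: star_ideal_def intro!: idealI ring_axioms)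
qed

text \<open>Scalars are absorbed because the algebra is unital: c x = (c 1) x.\<close>

lemma star_ideal_submodule:
  assumes "staralg A" "star_ideal I A"
  shows "submodule I complex_alg A"
proof -
  interpret staralg A by fact
  interpret ideal I A using assms(2) by (simp add: star_ideal_def)
  have "c \<odot>\<^bsub>A\<^esub> x \<in> I" if "x \<in> I" for c x
  proof -
    have "c \<odot>\<^bsub>A\<^esub> x = (c \<odot>\<^bsub>A\<^esub> \<one>\<^bsub>A\<^esub>) \<otimes>\<^bsub>A\<^esub> x" using that Icarr by (subst smult_mult_l) auto
    then show ?thesis using that I_l_closed by simp
  qed
  then show ?thesis by (subst submodule_iff[OF assms(1)]) (auto simp: a_subset[THEN subsetD])
qed

lemma star_ideal_closed:
  assumes A: "staralg A" and I: "star_ideal I A"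
  shows "I \<subseteq> carrier A" "\<zero>\<^bsub>A\<^esub> \<in> I" "x \<in> I \<Longrightarrow> y \<in> I \<Longrightarrow> x \<oplus>\<^bsub>A\<^esub> y \<in> I"
    "x \<in> I \<Longrightarrow> y \<in> I \<Longrightarrow> x \<ominus>\<^bsub>A\<^esub> y \<in> I"
    "x \<in> I \<Longrightarrow> c \<odot>\<^bsub>A\<^esub> x \<in> I" "x \<in> I \<Longrightarrow> a \<in> carrier A \<Longrightarrow> x \<otimes>\<^bsub>A\<^esub> a \<in> I"
    "x \<in> I \<Longrightarrow> a \<in> carrier A \<Longrightarrow> a \<otimes>\<^bsub>A\<^esub> x \<in> I" "x \<in> I \<Longrightarrow> star A x \<in> I"
  using star_ideal_submodule[OF A I] I
  by (auto simp: submodule_iff[OF A] star_ideal_def ideal.I_r_closed ideal.I_l_closed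
      staralg.minus_eq_smult[OF A] subset_iff)

lemma star_ideal_carrier: "staralg A \<Longrightarrow> star_ideal (carrier A) A"
proof -
  assume A: "staralg A"
  interpret staralg A by fact
  show ?thesis by (rule star_idealI[OF A]) (auto simp: submodule_iff[OF A])
qed

text \<open>The whole carrier is a member of the intersected family, which keeps the intersection
  inside the carrier.\<close>

lemma star_ideal_gen_ideal:
  assumes A: "staralg A" and S: "S \<subseteq> carrier A"
  shows "star_ideal (star_ideal_gen A S) A"
proof -
  interpret staralg A by fact
  have car: "carrier A \<in> {I. star_ideal I A \<and> S \<subseteq> I}"
    using S star_ideal_carrier[OF A] by auto
  show ?thesis
    using car star_ideal_closed[OF A] unfolding star_ideal_gen_def
    by (intro star_idealI[OF A] iffD2[OF submodule_iff[OF A]])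
       (auto)
qed

lemma star_ideal_gen_base: "x \<in> S \<Longrightarrow> x \<in> star_ideal_gen A S"
  by (auto simp: star_ideal_gen_def)

lemma star_ideal_gen_minimal: "star_ideal I A \<Longrightarrow> S \<subseteq> I \<Longrightarrow> star_ideal_gen A S \<subseteq> I"
  by (auto simp: star_ideal_gen_def)

text \<open>Left and right products are bilinear and the star is conjugate linear, so absorption
  extends from a spanning set \<open>B\<close> of the algebra and a spanning set \<open>S\<close> of
  the ideal. Applied to the bilinearity relations and to J \<otimes> H + H \<otimes> J.\<close>

lemma star_ideal_lin_span:
  assumes A: "staralg A" and S: "S \<subseteq> carrier A" and B: "B \<subseteq> carrier A" "carrier A \<subseteq> lin_span A B"
    and l: "\<And>s b. s \<in> S \<Longrightarrow> b \<in> B \<Longrightarrow> b \<otimes>\<^bsub>A\<^esub> s \<in> lin_span A S"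
    and r: "\<And>s b. s \<in> S \<Longrightarrow> b \<in> B \<Longrightarrow> s \<otimes>\<^bsub>A\<^esub> b \<in> lin_span A S"
    and st: "\<And>s. s \<in> S \<Longrightarrow> star A s \<in> lin_span A S"
  shows "star_ideal (lin_span A S) A"
proof -
  interpret staralg A by fact
  note [simp] = lin_span_closed[OF A S]
  have S': "s \<in> carrier A" if "s \<in> S" for s using S that by auto
  have l1: "b \<otimes>\<^bsub>A\<^esub> s \<in> lin_span A S \<and> s \<otimes>\<^bsub>A\<^esub> b \<in> lin_span A S" if "s \<in> S" "b \<in> lin_span A B" for s b
    using A B(1) that(2)
    by (induct rule: lin_span_induct)
      (use that S' l r in \<open>auto simp: l_distr r_distr smult_mult_l smult_mult_r\<close>)
  have l2: "b \<otimes>\<^bsub>A\<^esub> s \<in> lin_span A S \<and> s \<otimes>\<^bsub>A\<^esub> b \<in> lin_span A S" if "s \<in> lin_span A S" "b \<in> carrier A" for s b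
    using A S that(1)
    by (induct rule: lin_span_induct)
      (use that l1 B(2) in \<open>auto simp: l_distr r_distr smult_mult_l smult_mult_r\<close>)
  have "star A s \<in> lin_span A S" if "s \<in> lin_span A S" for s
    using A S that
    by (induct rule: lin_span_induct) (auto simp: star_add star_smult st)
  with l2 show ?thesis
    by (intro star_idealI[OF A] lin_span_submodule[OF A S]) auto
qed

section \<open>Homomorphisms, generators and quotients\<close>

text \<open>Weaker than \<open>star_hom\<close> on purpose: the slots of a pure tensor and the
  contractions with the antipode are linear without being multiplicative.\<close>

definition lin_hom :: "('a, 'x) star_alg_scheme \<Rightarrow> ('b, 'y) star_alg_scheme \<Rightarrow> ('a \<Rightarrow> 'b) \<Rightarrow> bool" where
  "lin_hom A B f \<longleftrightarrow> (\<forall>x\<in>carrier A. f x \<in> carrier B) \<and>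
     (\<forall>x\<in>carrier A. \<forall>y\<in>carrier A. f (x \<oplus>\<^bsub>A\<^esub> y) = f x \<oplus>\<^bsub>B\<^esub> f y) \<and>
     (\<forall>c. \<forall>x\<in>carrier A. f (c \<odot>\<^bsub>A\<^esub> x) = c \<odot>\<^bsub>B\<^esub> f x)"

lemma lin_homI:
  assumes "\<And>x. x \<in> carrier A \<Longrightarrow> f x \<in> carrier B"
    "\<And>x y. x \<in> carrier A \<Longrightarrow> y \<in> carrier A \<Longrightarrow> f (x \<oplus>\<^bsub>A\<^esub> y) = f x \<oplus>\<^bsub>B\<^esub> f y"
    "\<And>c x. x \<in> carrier A \<Longrightarrow> f (c \<odot>\<^bsub>A\<^esub> x) = c \<odot>\<^bsub>B\<^esub> f x"
  shows "lin_hom A B f"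
  using assms by (auto simp: lin_hom_def)

lemma lin_homD:
  assumes "lin_hom A B f"
  shows "x \<in> carrier A \<Longrightarrow> f x \<in> carrier B"
    "x \<in> carrier A \<Longrightarrow> y \<in> carrier A \<Longrightarrow> f (x \<oplus>\<^bsub>A\<^esub> y) = f x \<oplus>\<^bsub>B\<^esub> f y"
    "x \<in> carrier A \<Longrightarrow> f (c \<odot>\<^bsub>A\<^esub> x) = c \<odot>\<^bsub>B\<^esub> f x"
  using assms by (auto simp: lin_hom_def)

lemma lin_hom_zero:
  assumes "staralg A" "staralg B" "lin_hom A B f"
  shows "f \<zero>\<^bsub>A\<^esub> = \<zero>\<^bsub>B\<^esub>"
proof -
  interpret A: staralg A by fact
  interpret B: staralg B by fact
  have "f \<zero>\<^bsub>A\<^esub> = f (0 \<odot>\<^bsub>A\<^esub> \<zero>\<^bsub>A\<^esub>)" by simp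
  also have "\<dots> = 0 \<odot>\<^bsub>B\<^esub> f \<zero>\<^bsub>A\<^esub>" by (rule lin_homD(3)[OF assms(3)]) simp
  also have "\<dots> = \<zero>\<^bsub>B\<^esub>" using lin_homD(1)[OF assms(3)] by simp
  finally show ?thesis .
qed

lemma lin_hom_finsum:
  assumes "staralg A" "staralg B" "lin_hom A B f" "finite I" "g \<in> I \<rightarrow> carrier A"
  shows "f (\<Oplus>\<^bsub>A\<^esub>i\<in>I. g i) = (\<Oplus>\<^bsub>B\<^esub>i\<in>I. f (g i))"
proof -
  interpret A: staralg A by fact
  interpret B: staralg B by fact
  show ?thesis using assms(4,5)
    by (induct set: finite)
      (auto simp: lin_hom_zero[OF assms(1-3)] lin_homD[OF assms(3)] Pi_def)
qed

lemma lin_hom_minus: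
  assumes "staralg A" "staralg B" "lin_hom A B f" "x \<in> carrier A" "y \<in> carrier A"
  shows "f (x \<ominus>\<^bsub>A\<^esub> y) = f x \<ominus>\<^bsub>B\<^esub> f y"
proof -
  interpret A: staralg A by fact
  interpret B: staralg B by fact
  show ?thesis using assms(4,5) by (simp add: A.minus_eq_smult B.minus_eq_smult lin_homD[OF assms(3)])
qed

lemma lin_hom_comp: "lin_hom A B f \<Longrightarrow> lin_hom B C g \<Longrightarrow> lin_hom A C (\<lambda>x. g (f x))"
  by (auto simp: lin_hom_def)

lemma submodule_kernel:
  assumes "staralg A" "staralg B" "lin_hom A B f"
  shows "submodule {x \<in> carrier A. f x = \<zero>\<^bsub>B\<^esub>} complex_alg A"
proof -
  interpret A: staralg A by fact
  interpret B: staralg B by fact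
  show ?thesis
    by (subst submodule_iff[OF assms(1)]) (auto simp: lin_hom_zero[OF assms] lin_homD[OF assms(3)])
qed

lemma star_homI:
  assumes "\<And>x. x \<in> carrier A \<Longrightarrow> f x \<in> carrier B"
    "\<And>x y. x \<in> carrier A \<Longrightarrow> y \<in> carrier A \<Longrightarrow> f (x \<oplus>\<^bsub>A\<^esub> y) = f x \<oplus>\<^bsub>B\<^esub> f y"
    "\<And>x y. x \<in> carrier A \<Longrightarrow> y \<in> carrier A \<Longrightarrow> f (x \<otimes>\<^bsub>A\<^esub> y) = f x \<otimes>\<^bsub>B\<^esub> f y"
    "f \<one>\<^bsub>A\<^esub> = \<one>\<^bsub>B\<^esub>"
    "\<And>c x. x \<in> carrier A \<Longrightarrow> f (c \<odot>\<^bsub>A\<^esub> x) = c \<odot>\<^bsub>B\<^esub> f x"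
    "\<And>x. x \<in> carrier A \<Longrightarrow> f (star A x) = star B (f x)"
  shows "star_hom A B f"
  using assms by (auto simp: star_hom_def ring_hom_def)

lemma star_homD:
  assumes "star_hom A B f"
  shows "x \<in> carrier A \<Longrightarrow> f x \<in> carrier B"
    "x \<in> carrier A \<Longrightarrow> y \<in> carrier A \<Longrightarrow> f (x \<oplus>\<^bsub>A\<^esub> y) = f x \<oplus>\<^bsub>B\<^esub> f y"
    "x \<in> carrier A \<Longrightarrow> y \<in> carrier A \<Longrightarrow> f (x \<otimes>\<^bsub>A\<^esub> y) = f x \<otimes>\<^bsub>B\<^esub> f y"
    "f \<one>\<^bsub>A\<^esub> = \<one>\<^bsub>B\<^esub>"
    "x \<in> carrier A \<Longrightarrow> f (c \<odot>\<^bsub>A\<^esub> x) = c \<odot>\<^bsub>B\<^esub> f x"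
    "x \<in> carrier A \<Longrightarrow> f (star A x) = star B (f x)"
  using assms by (auto simp: star_hom_def ring_hom_def)

lemma star_hom_lin: "star_hom A B f \<Longrightarrow> lin_hom A B f"
  by (rule lin_homI) (auto simp: star_hom_def ring_hom_def)

lemma star_hom_comp:
  assumes "star_hom A B f" "star_hom B C g"
  shows "star_hom A C (\<lambda>x. g (f x))"
  by (rule star_homI) (simp_all add: star_homD[OF assms(1)] star_homD[OF assms(2)])

lemma star_hom_id: "staralg A \<Longrightarrow> star_hom A A (\<lambda>x. x)"
  by (rule star_homI) auto

text \<open>Combined with the minimality of a generated *-ideal, this reduces the vanishing of a
  homomorphism on the ideal to its vanishing on the generators.\<close>

lemma star_ideal_kernel:
  assumes "staralg A" "staralg B" "star_hom A B f"
  shows "star_ideal {x \<in> carrier A. f x = \<zero>\<^bsub>B\<^esub>} A"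
proof -
  interpret A: staralg A by fact
  interpret B: staralg B by fact
  show ?thesis
    by (rule star_idealI[OF assms(1) submodule_kernel[OF assms(1,2) star_hom_lin[OF assms(3)]]])
      (auto simp: star_homD[OF assms(3)])
qed

text \<open>Closure under the star is left out: the generating sets in use are stable under it or
  have their adjoints added, and inductions then have no star case. Zero arises as 0 times the
  unit.\<close>

inductive_set gen_alg :: "('a, 'x) star_alg_scheme \<Rightarrow> 'a set \<Rightarrow> 'a set"
  for A :: "('a, 'x) star_alg_scheme" and G :: "'a set" where
  gen: "x \<in> G \<Longrightarrow> x \<in> gen_alg A G"
| one: "\<one>\<^bsub>A\<^esub> \<in> gen_alg A G"
| add: "x \<in> gen_alg A G \<Longrightarrow> y \<in> gen_alg A G \<Longrightarrow> x \<oplus>\<^bsub>A\<^esub> y \<in> gen_alg A G"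
| mult: "x \<in> gen_alg A G \<Longrightarrow> y \<in> gen_alg A G \<Longrightarrow> x \<otimes>\<^bsub>A\<^esub> y \<in> gen_alg A G"
| smult: "x \<in> gen_alg A G \<Longrightarrow> c \<odot>\<^bsub>A\<^esub> x \<in> gen_alg A G"

definition generates :: "('a, 'x) star_alg_scheme \<Rightarrow> 'a set \<Rightarrow> bool" where
  "generates A G \<longleftrightarrow> G \<subseteq> carrier A \<and> carrier A \<subseteq> gen_alg A G"

lemma gen_alg_subset:
  assumes "staralg A" "G \<subseteq> carrier A"
  shows "gen_alg A G \<subseteq> carrier A"
proof -
  interpret staralg A by fact
  have "x \<in> carrier A" if "x \<in> gen_alg A G" for x
    using that by induct (use assms in auto)
  then show ?thesis by auto
qed

lemma generates_induct [consumes 3, case_names gen one add mult smult]: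
  assumes A: "staralg A" and G: "generates A G" and x: "x \<in> carrier A"
    and gen: "\<And>x. x \<in> G \<Longrightarrow> P x" and one: "P \<one>\<^bsub>A\<^esub>"
    and add: "\<And>x y. x \<in> carrier A \<Longrightarrow> y \<in> carrier A \<Longrightarrow> P x \<Longrightarrow> P y \<Longrightarrow> P (x \<oplus>\<^bsub>A\<^esub> y)"
    and mult: "\<And>x y. x \<in> carrier A \<Longrightarrow> y \<in> carrier A \<Longrightarrow> P x \<Longrightarrow> P y \<Longrightarrow> P (x \<otimes>\<^bsub>A\<^esub> y)"
    and smult: "\<And>c x. x \<in> carrier A \<Longrightarrow> P x \<Longrightarrow> P (c \<odot>\<^bsub>A\<^esub> x)"
  shows "P x"
proof -
  have G': "G \<subseteq> carrier A" using G by (simp add: generates_def)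
  have "x \<in> gen_alg A G" using G x by (auto simp: generates_def)
  then show ?thesis
    by induct (meson gen one add mult smult gen_alg_subset[OF A G', THEN subsetD])+
qed

text \<open>The set where two unital homomorphisms agree is a subalgebra. Coassociativity, the
  counit laws and the compatibility of maps with the Hopf structure are all tested in this
  way.\<close>

lemma star_hom_eq_on_generators:
  assumes "staralg A" "generates A G" "star_hom A B f" "star_hom A B g"
    "\<And>x. x \<in> G \<Longrightarrow> f x = g x" "x \<in> carrier A"
  shows "f x = g x"
  using assms(1,2,6)
  by (induct rule: generates_induct)
    (simp_all add: assms(5) star_homD(2-5)[OF assms(3)] star_homD(2-5)[OF assms(4)])

lemma generates_image:
  assumes "staralg A" "staralg B" "generates A G" "star_hom A B f" "f ` carrier A = carrier B"
  shows "generates B (f ` G)"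
proof -
  have "f x \<in> gen_alg B (f ` G)" if "x \<in> carrier A" for x
    using assms(1,3) that
    by (induct rule: generates_induct) (auto simp: star_homD[OF assms(4)] intro: gen_alg.intros)
  moreover have "f ` G \<subseteq> carrier B" using assms by (auto simp: generates_def)
  ultimately show ?thesis using assms(5) by (force simp: generates_def)
qed

lemma surj_on_generators:
  assumes "staralg A" "staralg B" "star_hom A B f" "generates B G" "G \<subseteq> f ` carrier A"
  shows "f ` carrier A = carrier B"
proof -
  interpret A: staralg A by fact
  have "y \<in> f ` carrier A" if "y \<in> carrier B" for y
    using assms(2,4) that
  proof (induct rule: generates_induct)
    case one then show ?case using star_homD(4)[OF assms(3)] by (metis A.one_closed imageI)
  next
    case (add x y) then show ?case using star_homD(2)[OF assms(3)] by (metis (no_types, lifting) A.add.m_closed image_iff)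
  next
    case (mult x y) then show ?case using star_homD(3)[OF assms(3)] by (metis (no_types, lifting) A.m_closed image_iff)
  next
    case (smult c x) then show ?case using star_homD(5)[OF assms(3)] by (metis (no_types, lifting) A.smult_closed image_iff)
  qed (use assms(5) in auto)
  then show ?thesis using star_homD(1)[OF assms(3)] by auto
qed

lemma opposite_simps [simp]:
  "carrier (opposite A) = carrier A" "monoid.mult (opposite A) = (\<lambda>x y. y \<otimes>\<^bsub>A\<^esub> x)"
  "monoid.one (opposite A) = \<one>\<^bsub>A\<^esub>" "ring.zero (opposite A) = \<zero>\<^bsub>A\<^esub>"
  "ring.add (opposite A) = ring.add A" "module.smult (opposite A) = module.smult A"
  "star (opposite A) = star A"
  by (simp_all add: opposite_def)

lemma finsum_opposite [simp]: "finsum (opposite A) = finsum A"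
  by (intro ext) (simp add: finsum_def finprod_def opposite_def)

lemma a_inv_opposite [simp]: "a_inv (opposite A) = a_inv A"
  by (intro ext) (simp add: a_inv_def m_inv_def opposite_def)

lemma a_minus_opposite [simp]: "a_minus (opposite A) = a_minus A"
  by (intro ext) (simp add: a_minus_def)

lemma staralg_opposite:
  assumes "staralg A" shows "staralg (opposite A)"
proof -
  interpret staralg A by fact
  have "\<exists>y\<in>carrier A. y \<oplus>\<^bsub>A\<^esub> x = \<zero>\<^bsub>A\<^esub>" if "x \<in> carrier A" for x
    using that l_neg by blast
  then have "abelian_group (opposite A)" by (intro abelian_groupI) (auto simp: a_ac)
  moreover have "monoid (opposite A)" by (intro monoidI) (auto simp: m_assoc)
  ultimately have "ring (opposite A)" by (intro ringI) (auto simp: l_distr r_distr)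
  then interpret o: ring "opposite A" .
  show ?thesis
    by unfold_locales
      (auto simp: smult_l_distr smult_r_distr smult_smult smult_mult_l smult_mult_r star_smult star_add star_mult)
qed

section \<open>Quotients by *-ideals and their universal property\<close>

locale star_quotient = staralg A for A :: "('a, 'x) star_alg_scheme" (structure) +
  fixes I assumes star_ideal: "star_ideal I A"
begin

sublocale ideal I A using star_ideal by (simp add: star_ideal_def)

abbreviation "q \<equiv> (\<lambda>a. I +> a)"

lemma quot_carrier: "carrier (star_quot A I) = q ` carrier A"
  by (auto simp: star_quot_def FactRing_def A_RCOSETS_def')

lemma quot_closed: "a \<in> carrier A \<Longrightarrow> q a \<in> carrier (star_quot A I)"
  by (simp add: quot_carrier)

lemma quot_eq_iff: "a \<in> carrier A \<Longrightarrow> b \<in> carrier A \<Longrightarrow> q a = q b \<longleftrightarrow> a \<ominus> b \<in> I"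
  using quotient_eq_iff_same_a_r_cos[of I a b] ideal_axioms by blast

lemma mem_coset: "a \<in> carrier A \<Longrightarrow> x \<in> q a \<longleftrightarrow> x \<in> carrier A \<and> q x = q a"
  by (metis a_elemrcos_carrier a_rcos_self a_repr_independence' quot_eq_iff)

lemma quot_zero: "\<zero>\<^bsub>star_quot A I\<^esub> = q \<zero>"
  using a_rcos_const[of \<zero>] by (simp add: star_quot_def FactRing_def)

lemma quot_eq_zero: "a \<in> carrier A \<Longrightarrow> q a = \<zero>\<^bsub>star_quot A I\<^esub> \<longleftrightarrow> a \<in> I"
  unfolding quot_zero by (subst quot_eq_iff) (auto simp: minus_eq)

text \<open>Scalar multiplication, star and antipode of a quotient are unions over the
  representatives of a coset, while induced maps use \<open>the_elem\<close>. Both collapse to a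
  single value once the function is constant on the coset.\<close>

lemma UN_coset:
  assumes "a \<in> carrier A" "\<And>x. x \<in> carrier A \<Longrightarrow> q x = q a \<Longrightarrow> f x = c"
  shows "(\<Union>x\<in>q a. f x) = c"
  using assms a_rcos_self[OF assms(1)] by (auto simp: mem_coset)

lemma the_elem_coset:
  assumes "a \<in> carrier A" "\<And>x. x \<in> carrier A \<Longrightarrow> q x = q a \<Longrightarrow> f x = c"
  shows "the_elem (f ` q a) = c"
proof -
  have "f ` q a = {c}" using assms a_rcos_self[OF assms(1)] by (auto simp: mem_coset image_iff intro!: bexI[of _ a])
  then show ?thesis by simp
qed

lemma quot_mult: "a \<in> carrier A \<Longrightarrow> b \<in> carrier A \<Longrightarrow> q a \<otimes>\<^bsub>star_quot A I\<^esub> q b = q (a \<otimes> b)"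
  by (simp add: star_quot_def FactRing_def rcoset_mult_add)

lemma quot_add: "a \<in> carrier A \<Longrightarrow> b \<in> carrier A \<Longrightarrow> q a \<oplus>\<^bsub>star_quot A I\<^esub> q b = q (a \<oplus> b)"
  by (simp add: star_quot_def FactRing_def a_rcos_sum)

lemma quot_one: "\<one>\<^bsub>star_quot A I\<^esub> = q \<one>"
  by (simp add: star_quot_def FactRing_def)

lemma quot_smult: "a \<in> carrier A \<Longrightarrow> c \<odot>\<^bsub>star_quot A I\<^esub> q a = q (c \<odot> a)"
proof -
  assume a: "a \<in> carrier A"
  have "q (c \<odot> x) = q (c \<odot> a)" if "x \<in> carrier A" "q x = q a" for x
  proof -
    have "x \<ominus> a \<in> I" using that a by (simp add: quot_eq_iff)
    then have "c \<odot> (x \<ominus> a) \<in> I" by (rule star_ideal_closed(5)[OF staralg_axioms star_ideal])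
    moreover have "c \<odot> (x \<ominus> a) = c \<odot> x \<ominus> c \<odot> a"
      using that a by (simp add: minus_eq_smult smult_r_distr smult_smult mult.commute)
    ultimately show ?thesis using that a by (simp add: quot_eq_iff)
  qed
  then have "(\<Union>x\<in>q a. q (c \<odot> x)) = q (c \<odot> a)" by (rule UN_coset[OF a])
  then show ?thesis by (simp add: star_quot_def)
qed

lemma quot_star: "a \<in> carrier A \<Longrightarrow> star (star_quot A I) (q a) = q (star A a)"
proof -
  assume a: "a \<in> carrier A"
  have "q (star A x) = q (star A a)" if "x \<in> carrier A" "q x = q a" for x
  proof -
    have "x \<ominus> a \<in> I" using that a by (simp add: quot_eq_iff)
    then have "star A (x \<ominus> a) \<in> I" by (rule star_ideal_closed(8)[OF staralg_axioms star_ideal])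
    then show ?thesis using that a by (simp add: quot_eq_iff star_minus)
  qed
  then have "(\<Union>x\<in>q a. q (star A x)) = q (star A a)" by (rule UN_coset[OF a])
  then show ?thesis by (simp add: star_quot_def)
qed

lemma staralg_quot: "staralg (star_quot A I)"
proof -
  have "\<exists>y\<in>carrier A. q y \<oplus>\<^bsub>star_quot A I\<^esub> q x = q \<zero>" if "x \<in> carrier A" for x
    using that by (intro bexI[of _ "\<ominus> x"]) (simp_all add: quot_add l_neg)
  then have "abelian_group (star_quot A I)"
    by (intro abelian_groupI) (auto simp: quot_carrier quot_add quot_zero a_ac)
  moreover have "monoid (star_quot A I)"
    by (intro monoidI) (auto simp: quot_carrier quot_mult quot_one m_assoc)
  ultimately have "ring (star_quot A I)"
    by (rule ringI) (auto simp: quot_carrier quot_mult quot_add l_distr r_distr)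
  then interpret Q: ring "star_quot A I" .
  show ?thesis
    by unfold_locales
      (auto simp: quot_carrier quot_mult quot_add quot_smult quot_star smult_l_distr smult_r_distr
        smult_smult smult_mult_l smult_mult_r star_smult star_add star_mult)
qed

lemma star_hom_quot: "star_hom A (star_quot A I) q"
  by (rule star_homI) (auto simp: quot_closed quot_mult quot_add quot_one quot_smult quot_star)

text \<open>Two representatives differ by an element of \<open>I\<close>, where the linear map
  \<open>f\<close> vanishes.\<close>

lemma quot_lift:
  assumes "staralg B" "lin_hom A B f" "\<And>x. x \<in> I \<Longrightarrow> f x = \<zero>\<^bsub>B\<^esub>" "a \<in> carrier A"
  shows "the_elem (f ` q a) = f a"
proof (rule the_elem_coset[OF assms(4)])
  fix x assume x: "x \<in> carrier A" "q x = q a"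
  interpret B: staralg B by fact
  have "f x \<ominus>\<^bsub>B\<^esub> f a = \<zero>\<^bsub>B\<^esub>"
    using x assms(3,4) by (simp add: quot_eq_iff lin_hom_minus[OF staralg_axioms assms(1,2), symmetric])
  then show "f x = f a" using x assms(4) lin_homD(1)[OF assms(2)] by (simp add: B.minus_eq B.add.inv_solve_right')
qed

lemma quot_lift_lin:
  assumes "staralg B" "lin_hom A B f" "\<And>x. x \<in> I \<Longrightarrow> f x = \<zero>\<^bsub>B\<^esub>"
  shows "lin_hom (star_quot A I) B (\<lambda>X. the_elem (f ` X))"
  by (rule lin_homI)
    (auto simp: quot_carrier quot_add quot_smult quot_lift[OF assms] lin_homD[OF assms(2)])

lemma quot_lift_hom:
  assumes "staralg B" "star_hom A B f" "\<And>x. x \<in> I \<Longrightarrow> f x = \<zero>\<^bsub>B\<^esub>"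
  shows "star_hom (star_quot A I) B (\<lambda>X. the_elem (f ` X))"
  by (rule star_homI)
    (auto simp: quot_carrier quot_add quot_smult quot_mult quot_one quot_star star_homD[OF assms(2)]
      quot_lift[OF assms(1) star_hom_lin[OF assms(2)] assms(3)])

end

section \<open>Monoid algebras\<close>

text \<open>Multiplicativity is extended from the spanning set one variable at a time; for the star
  both sides are conjugate linear.\<close>

lemma star_homI_span:
  assumes A: "staralg A" and B: "staralg B" and f: "lin_hom A B f" and S: "S \<subseteq> carrier A"
    and span: "carrier A \<subseteq> lin_span A S"
    and mult: "\<And>x y. x \<in> S \<Longrightarrow> y \<in> S \<Longrightarrow> f (x \<otimes>\<^bsub>A\<^esub> y) = f x \<otimes>\<^bsub>B\<^esub> f y"
    and one: "f \<one>\<^bsub>A\<^esub> = \<one>\<^bsub>B\<^esub>"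
    and star: "\<And>x. x \<in> S \<Longrightarrow> f (star A x) = star B (f x)"
  shows "star_hom A B f"
proof -
  interpret A: staralg A by fact
  interpret B: staralg B by fact
  note lin = lin_homD[OF f] lin_hom_zero[OF A B f]
  have S': "x \<in> carrier A" if "x \<in> S" for x using S that by auto
  have m1: "f (x \<otimes>\<^bsub>A\<^esub> y) = f x \<otimes>\<^bsub>B\<^esub> f y" if "x \<in> S" "y \<in> lin_span A S" for x y
    using A S that(2)
    by (induct rule: lin_span_induct)
      (simp_all add: that(1) mult lin S' A.r_distr B.r_distr A.smult_mult_r B.smult_mult_r)
  have m2: "f (x \<otimes>\<^bsub>A\<^esub> y) = f x \<otimes>\<^bsub>B\<^esub> f y" if "y \<in> carrier A" "x \<in> lin_span A S" for x y
    using A S that(2)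
    by (induct rule: lin_span_induct)
      (simp_all add: that(1) m1 span[THEN subsetD] lin A.l_distr B.l_distr A.smult_mult_l B.smult_mult_l)
  have s: "f (star A x) = star B (f x)" if "x \<in> lin_span A S" for x
    using A S that
    by (induct rule: lin_span_induct)
      (simp_all add: star lin A.star_add B.star_add A.star_smult B.star_smult)
  show ?thesis
    by (rule star_homI) (simp_all add: lin one m2 s span[THEN subsetD])
qed

text \<open>Induction over a finite set containing the support: subtracting the term at
  \<open>x\<close> removes \<open>x\<close> from the support, whatever its coefficient, zero
  included.\<close>

lemma poly_mapping_induct_keys [consumes 1, case_names zero add]:
  fixes p :: "'m \<Rightarrow>\<^sub>0 'b::ab_group_add"
  assumes "Poly_Mapping.keys p \<subseteq> M" "P 0"
    "\<And>x c p. x \<in> M \<Longrightarrow> Poly_Mapping.keys p \<subseteq> M \<Longrightarrow> P p \<Longrightarrow> P (Poly_Mapping.single x c + p)"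
  shows "P p"
proof -
  have "P p" if "finite K" "K \<subseteq> M" "Poly_Mapping.keys p \<subseteq> K" for K p
    using that
  proof (induct arbitrary: p set: finite)
    case empty then show ?case using assms(2) by simp
  next
    case (insert x K)
    let ?r = "p - Poly_Mapping.single x (Poly_Mapping.lookup p x)"
    have "Poly_Mapping.keys ?r \<subseteq> K"
      using insert.prems(2) by (auto simp: in_keys_iff lookup_minus lookup_single when_def split: if_splits)
    then have "P (Poly_Mapping.single x (Poly_Mapping.lookup p x) + ?r)"
      using insert by (intro assms(3)) auto
    then show ?case by simp
  qed
  from this[of "Poly_Mapping.keys p"] show ?thesis using assms(1) by simp
qed

lemma sum_keys_superset:
  fixes \<phi> :: "'m \<Rightarrow> 'b::zero \<Rightarrow> 'c::comm_monoid_add"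
  assumes "finite S" "Poly_Mapping.keys p \<subseteq> S" "\<And>x. \<phi> x 0 = 0"
  shows "(\<Sum>x\<in>Poly_Mapping.keys p. \<phi> x (Poly_Mapping.lookup p x)) = (\<Sum>x\<in>S. \<phi> x (Poly_Mapping.lookup p x))"
  using assms by (intro sum.mono_neutral_left) (auto simp: in_keys_iff)

text \<open>The support of p + q can be smaller than the union of the two supports because of
  cancellation. All three sums are therefore taken over that union, where coefficients 0 contribute
  nothing.\<close>

lemma sum_keys_add:
  fixes \<phi> :: "'m \<Rightarrow> 'b::monoid_add \<Rightarrow> 'c::comm_monoid_add"
  assumes "\<And>x. \<phi> x 0 = 0" "\<And>x c d. \<phi> x (c + d) = \<phi> x c + \<phi> x d"
  shows "(\<Sum>x\<in>Poly_Mapping.keys (p + q). \<phi> x (Poly_Mapping.lookup (p + q) x)) =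
    (\<Sum>x\<in>Poly_Mapping.keys p. \<phi> x (Poly_Mapping.lookup p x)) +
    (\<Sum>x\<in>Poly_Mapping.keys q. \<phi> x (Poly_Mapping.lookup q x))"
proof -
  note e = sum_keys_superset[of "Poly_Mapping.keys p \<union> Poly_Mapping.keys q" _ \<phi>, OF _ _ assms(1)]
  show ?thesis
    using Poly_Mapping.keys_add[of p q] e[of "p + q"] e[of p] e[of q]
    by (simp add: lookup_add assms(2) sum.distrib)
qed

text \<open>Three instances are used: a group with inversion, words with \<open>word_star\<close>,
  and the multiplicative monoid of a product of two *-algebras with the componentwise star.\<close>

locale star_monoid = monoid M for M :: "('m, 'x) monoid_scheme" (structure) +
  fixes s :: "'m \<Rightarrow> 'm"
  assumes s_closed [simp]: "x \<in> carrier M \<Longrightarrow> s x \<in> carrier M"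
    and s_s [simp]: "x \<in> carrier M \<Longrightarrow> s (s x) = x"
    and s_mult: "x \<in> carrier M \<Longrightarrow> y \<in> carrier M \<Longrightarrow> s (x \<otimes> y) = s y \<otimes> s x"
begin

abbreviation "MA \<equiv> monoid_alg M s"

lemma MA_carrier: "carrier MA = {p. Poly_Mapping.keys p \<subseteq> carrier M}"
  and MA_one: "monoid.one MA = Poly_Mapping.single \<one> 1"
  and MA_zero: "ring.zero MA = 0"
  and MA_add: "ring.add MA = (+)"
  by (simp_all add: monoid_alg_def)

lemma MA_mult_add_l: "(p + q) \<otimes>\<^bsub>MA\<^esub> r = p \<otimes>\<^bsub>MA\<^esub> r + q \<otimes>\<^bsub>MA\<^esub> r"
  unfolding monoid_alg_def
  by simp (rule sum_keys_add, simp_all add: distrib_right single_add sum.distrib)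

lemma MA_mult_add_r: "r \<otimes>\<^bsub>MA\<^esub> (p + q) = r \<otimes>\<^bsub>MA\<^esub> p + r \<otimes>\<^bsub>MA\<^esub> q"
proof -
  have "(\<Sum>y\<in>Poly_Mapping.keys (p + q). Poly_Mapping.single (x \<otimes> y) (c * Poly_Mapping.lookup (p + q) y)) =
    (\<Sum>y\<in>Poly_Mapping.keys p. Poly_Mapping.single (x \<otimes> y) (c * Poly_Mapping.lookup p y)) +
    (\<Sum>y\<in>Poly_Mapping.keys q. Poly_Mapping.single (x \<otimes> y) (c * Poly_Mapping.lookup q y))" for x and c :: complex
    by (rule sum_keys_add) (simp_all add: distrib_left single_add)
  then show ?thesis by (simp add: monoid_alg_def sum.distrib)
qed

lemma MA_mult_single:
  "Poly_Mapping.single x c \<otimes>\<^bsub>MA\<^esub> Poly_Mapping.single y d = Poly_Mapping.single (x \<otimes> y) (c * d)"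
  by (simp add: monoid_alg_def)

lemma MA_mult_zero: "0 \<otimes>\<^bsub>MA\<^esub> p = 0" "p \<otimes>\<^bsub>MA\<^esub> 0 = 0"
  by (simp_all add: monoid_alg_def)

lemma MA_smult_add: "c \<odot>\<^bsub>MA\<^esub> (p + q) = c \<odot>\<^bsub>MA\<^esub> p + c \<odot>\<^bsub>MA\<^esub> q"
  unfolding monoid_alg_def
  by simp (rule sum_keys_add, simp_all add: distrib_left single_add)

lemma MA_smult_single: "c \<odot>\<^bsub>MA\<^esub> Poly_Mapping.single x d = Poly_Mapping.single x (c * d)"
  by (simp add: monoid_alg_def)

lemma MA_smult_zero: "c \<odot>\<^bsub>MA\<^esub> 0 = 0"
  by (simp add: monoid_alg_def)

lemma MA_star_add: "star MA (p + q) = star MA p + star MA q"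
  unfolding monoid_alg_def
  by simp (rule sum_keys_add, simp_all add: single_add)

lemma MA_star_single: "star MA (Poly_Mapping.single x d) = Poly_Mapping.single (s x) (cnj d)"
  by (simp add: monoid_alg_def)

lemma MA_star_zero: "star MA 0 = 0"
  by (simp add: monoid_alg_def)

lemmas MA_simps = MA_mult_add_l MA_mult_add_r MA_mult_single MA_mult_zero MA_smult_add
  MA_smult_single MA_smult_zero MA_star_add MA_star_single MA_star_zero

lemma MA_induct [consumes 1, case_names zero add]:
  assumes "p \<in> carrier MA" "P 0"
    "\<And>x c p. x \<in> carrier M \<Longrightarrow> p \<in> carrier MA \<Longrightarrow> P p \<Longrightarrow> P (Poly_Mapping.single x c + p)"
  shows "P p"
  using assms(1)[unfolded MA_carrier mem_Collect_eq]
  by (induct rule: poly_mapping_induct_keys) (use assms(2,3) in \<open>auto simp: MA_carrier\<close>)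

lemma MA_closed_add: "p \<in> carrier MA \<Longrightarrow> q \<in> carrier MA \<Longrightarrow> p + q \<in> carrier MA"
  using Poly_Mapping.keys_add[of p q] by (auto simp: MA_carrier)

lemma MA_closed_single: "x \<in> carrier M \<Longrightarrow> Poly_Mapping.single x c \<in> carrier MA"
  by (auto simp: MA_carrier)

lemma MA_closed_zero: "0 \<in> carrier MA"
  by (auto simp: MA_carrier)

lemmas MA_closed = MA_closed_add MA_closed_single MA_closed_zero

lemma MA_closed_smult: "p \<in> carrier MA \<Longrightarrow> c \<odot>\<^bsub>MA\<^esub> p \<in> carrier MA"
  by (induct rule: MA_induct) (simp_all add: MA_simps MA_closed)

lemma MA_closed_star: "p \<in> carrier MA \<Longrightarrow> star MA p \<in> carrier MA"
  by (induct rule: MA_induct) (simp_all add: MA_simps MA_closed)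

lemma MA_closed_mult1: "p \<in> carrier MA \<Longrightarrow> x \<in> carrier M \<Longrightarrow> Poly_Mapping.single x c \<otimes>\<^bsub>MA\<^esub> p \<in> carrier MA"
  by (induct rule: MA_induct) (simp_all add: MA_simps MA_closed)

lemma MA_closed_mult: "p \<in> carrier MA \<Longrightarrow> q \<in> carrier MA \<Longrightarrow> p \<otimes>\<^bsub>MA\<^esub> q \<in> carrier MA"
  by (induct rule: MA_induct) (simp_all add: MA_simps MA_closed MA_closed_mult1)

text \<open>Each axiom is additive in every argument, so \<open>MA_induct\<close> reduces it one
  argument at a time to single terms. There it is a law of the monoid, of \<open>s\<close> or of the
  complex numbers.\<close>

lemma staralg_MA: "staralg MA"
proof -
  have uminus: "- p \<in> carrier MA" if "p \<in> carrier MA" for p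
    using that by (simp add: MA_carrier)
  have ag: "abelian_group MA"
    by (rule abelian_groupI)
      (auto simp: MA_add MA_zero MA_closed add.assoc add.commute intro: bexI[OF _ uminus])
  have a1: "Poly_Mapping.single x c \<otimes>\<^bsub>MA\<^esub> Poly_Mapping.single y d \<otimes>\<^bsub>MA\<^esub> r = Poly_Mapping.single x c \<otimes>\<^bsub>MA\<^esub> (Poly_Mapping.single y d \<otimes>\<^bsub>MA\<^esub> r)"
    if "r \<in> carrier MA" "x \<in> carrier M" "y \<in> carrier M" for x y c d r
    using that by (induct rule: MA_induct) (simp_all add: MA_simps m_assoc mult.assoc)
  have a2: "Poly_Mapping.single x c \<otimes>\<^bsub>MA\<^esub> q \<otimes>\<^bsub>MA\<^esub> r = Poly_Mapping.single x c \<otimes>\<^bsub>MA\<^esub> (q \<otimes>\<^bsub>MA\<^esub> r)"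
    if "q \<in> carrier MA" "r \<in> carrier MA" "x \<in> carrier M" for x q c r
    using that by (induct rule: MA_induct) (simp_all add: MA_simps a1[unfolded MA_mult_single])
  have a3: "p \<otimes>\<^bsub>MA\<^esub> q \<otimes>\<^bsub>MA\<^esub> r = p \<otimes>\<^bsub>MA\<^esub> (q \<otimes>\<^bsub>MA\<^esub> r)"
    if "p \<in> carrier MA" "q \<in> carrier MA" "r \<in> carrier MA" for p q r
    using that by (induct rule: MA_induct) (simp_all add: MA_simps a2)
  have o: "Poly_Mapping.single \<one> 1 \<otimes>\<^bsub>MA\<^esub> p = p" "p \<otimes>\<^bsub>MA\<^esub> Poly_Mapping.single \<one> 1 = p" if "p \<in> carrier MA" for p
    using that by (induct rule: MA_induct, simp_all add: MA_simps)+
  have mo: "monoid MA"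
    by (rule monoidI) (simp_all add: MA_closed_mult MA_one MA_closed a3 o)
  have "ring MA"
    by (rule ringI[OF ag mo]) (simp_all add: MA_add MA_simps)
  then interpret R: ring MA .
  have l: "(c + d) \<odot>\<^bsub>MA\<^esub> p = c \<odot>\<^bsub>MA\<^esub> p + d \<odot>\<^bsub>MA\<^esub> p"
    "c \<odot>\<^bsub>MA\<^esub> (d \<odot>\<^bsub>MA\<^esub> p) = (c * d) \<odot>\<^bsub>MA\<^esub> p" "1 \<odot>\<^bsub>MA\<^esub> p = p"
    "star MA (star MA p) = p" "star MA (c \<odot>\<^bsub>MA\<^esub> p) = cnj c \<odot>\<^bsub>MA\<^esub> star MA p"
    if "p \<in> carrier MA" for c d p
    using that by (induct rule: MA_induct, simp_all add: MA_simps distrib_right single_add add.assoc add.left_commute mult.assoc)+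
  have sm1: "(c \<odot>\<^bsub>MA\<^esub> Poly_Mapping.single x d) \<otimes>\<^bsub>MA\<^esub> q = c \<odot>\<^bsub>MA\<^esub> (Poly_Mapping.single x d \<otimes>\<^bsub>MA\<^esub> q)"
    "Poly_Mapping.single x d \<otimes>\<^bsub>MA\<^esub> (c \<odot>\<^bsub>MA\<^esub> q) = c \<odot>\<^bsub>MA\<^esub> (Poly_Mapping.single x d \<otimes>\<^bsub>MA\<^esub> q)"
    "star MA (Poly_Mapping.single x d \<otimes>\<^bsub>MA\<^esub> q) = star MA q \<otimes>\<^bsub>MA\<^esub> star MA (Poly_Mapping.single x d)"
    if "q \<in> carrier MA" "x \<in> carrier M" for c d x q
    using that by (induct rule: MA_induct, simp_all add: MA_simps s_mult mult.assoc mult.left_commute mult.commute)+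
  have sm: "(c \<odot>\<^bsub>MA\<^esub> p) \<otimes>\<^bsub>MA\<^esub> q = c \<odot>\<^bsub>MA\<^esub> (p \<otimes>\<^bsub>MA\<^esub> q)"
    "p \<otimes>\<^bsub>MA\<^esub> (c \<odot>\<^bsub>MA\<^esub> q) = c \<odot>\<^bsub>MA\<^esub> (p \<otimes>\<^bsub>MA\<^esub> q)"
    "star MA (p \<otimes>\<^bsub>MA\<^esub> q) = star MA q \<otimes>\<^bsub>MA\<^esub> star MA p"
    if "p \<in> carrier MA" "q \<in> carrier MA" for c p q
    using that
    by (induct rule: MA_induct, simp_all add: MA_mult_add_l MA_mult_add_r MA_mult_zero
      MA_smult_add MA_smult_zero MA_star_add MA_star_zero sm1)+
  show ?thesis
    by unfold_locales
      (simp_all add: MA_add l sm MA_closed_smult MA_closed_star MA_smult_add MA_star_add)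
qed

lemma MA_singles: "{Poly_Mapping.single x 1 | x. x \<in> carrier M} \<subseteq> carrier MA"
  by (auto simp: MA_closed)

lemma MA_span: "carrier MA \<subseteq> lin_span MA {Poly_Mapping.single x 1 | x. x \<in> carrier M}"
proof
  note cl = lin_span_closed[OF staralg_MA MA_singles]
  fix p assume "p \<in> carrier MA"
  then show "p \<in> lin_span MA {Poly_Mapping.single x 1 | x. x \<in> carrier M}"
  proof (induct rule: MA_induct)
    case zero show ?case using cl(1) by (simp add: MA_zero)
  next
    case (add x c p)
    have "Poly_Mapping.single x 1 \<in> lin_span MA {Poly_Mapping.single x 1 | x. x \<in> carrier M}"
      using add(1) by (intro lin_span_base) auto
    from cl(3)[OF this, of c] cl(2)[OF _ add(3)] show ?case by (simp add: MA_smult_single MA_add)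
  qed
qed

context
  fixes B :: "('b, 'y) star_alg_scheme" and f
  assumes B: "staralg B" and f: "\<And>x. x \<in> carrier M \<Longrightarrow> f x \<in> carrier B"
begin

interpretation B: staralg B by (rule B)

lemma lin_ext_superset:
  assumes "finite S" "Poly_Mapping.keys p \<subseteq> S" "S \<subseteq> carrier M"
  shows "lin_ext B f p = (\<Oplus>\<^bsub>B\<^esub>x\<in>S. Poly_Mapping.lookup p x \<odot>\<^bsub>B\<^esub> f x)"
  unfolding lin_ext_def
  by (rule B.add.finprod_mono_neutral_cong_left) (use assms f in \<open>auto simp: in_keys_iff subset_iff\<close>)

lemma lin_ext_single: "x \<in> carrier M \<Longrightarrow> lin_ext B f (Poly_Mapping.single x c) = c \<odot>\<^bsub>B\<^esub> f x"
  using f by (subst lin_ext_superset[of "{x}"]) auto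

lemma lin_ext_add:
  assumes "p \<in> carrier MA" "q \<in> carrier MA"
  shows "lin_ext B f (p + q) = lin_ext B f p \<oplus>\<^bsub>B\<^esub> lin_ext B f q"
proof -
  let ?S = "Poly_Mapping.keys p \<union> Poly_Mapping.keys q"
  have S: "?S \<subseteq> carrier M" using assms by (simp add: MA_carrier)
  have e: "lin_ext B f r = (\<Oplus>\<^bsub>B\<^esub>x\<in>?S. Poly_Mapping.lookup r x \<odot>\<^bsub>B\<^esub> f x)" if "Poly_Mapping.keys r \<subseteq> ?S" for r
    using lin_ext_superset[of ?S r] S that by simp
  have "lin_ext B f (p + q) = (\<Oplus>\<^bsub>B\<^esub>x\<in>?S. Poly_Mapping.lookup p x \<odot>\<^bsub>B\<^esub> f x \<oplus>\<^bsub>B\<^esub> Poly_Mapping.lookup q x \<odot>\<^bsub>B\<^esub> f x)"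
    unfolding e[OF Poly_Mapping.keys_add[of p q]]
    by (rule B.finsum_cong') (use S f in \<open>auto simp: lookup_add B.smult_l_distr subset_iff\<close>)
  also have "\<dots> = lin_ext B f p \<oplus>\<^bsub>B\<^esub> lin_ext B f q"
    using S f by (subst B.finsum_addf) (auto simp: e)
  finally show ?thesis .
qed

lemma lin_ext_zero: "lin_ext B f 0 = \<zero>\<^bsub>B\<^esub>"
  by (simp add: lin_ext_def)

lemma lin_ext_lin: "lin_hom MA B (lin_ext B f)"
proof (rule lin_homI)
  show cl: "lin_ext B f p \<in> carrier B" if "p \<in> carrier MA" for p
    using that by (induct rule: MA_induct) (simp_all add: lin_ext_zero lin_ext_add lin_ext_single MA_closed f)
  show "lin_ext B f (c \<odot>\<^bsub>MA\<^esub> p) = c \<odot>\<^bsub>B\<^esub> lin_ext B f p" if "p \<in> carrier MA" for c p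
    using that by (induct rule: MA_induct)
      (simp_all add: MA_simps lin_ext_zero lin_ext_add lin_ext_single MA_closed MA_closed_smult f cl B.smult_r_distr B.smult_smult)
qed (simp add: MA_add lin_ext_add)

text \<open>Universal property of the monoid algebra. It is the source of the homomorphisms out of
  group algebras and out of free *-algebras.\<close>

lemma lin_ext_star_hom:
  assumes "\<And>x y. x \<in> carrier M \<Longrightarrow> y \<in> carrier M \<Longrightarrow> f (x \<otimes> y) = f x \<otimes>\<^bsub>B\<^esub> f y" "f \<one> = \<one>\<^bsub>B\<^esub>"
    "\<And>x. x \<in> carrier M \<Longrightarrow> f (s x) = star B (f x)"
  shows "star_hom MA B (lin_ext B f)"
  by (rule star_homI_span[OF staralg_MA B lin_ext_lin MA_singles MA_span])
    (auto simp: MA_simps MA_one lin_ext_single f assms)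

end

end

section \<open>Tensor products\<close>

context star_monoid begin

lemma MA_closed_diff: "p \<in> carrier MA \<Longrightarrow> q \<in> carrier MA \<Longrightarrow> p - q \<in> carrier MA"
  using MA_closed_add[of p "- q"] by (simp add: MA_carrier)

lemma MA_minus:
  assumes "p \<in> carrier MA" "q \<in> carrier MA"
  shows "p \<ominus>\<^bsub>MA\<^esub> q = p - q"
proof -
  interpret R: staralg MA by (rule staralg_MA)
  have "\<ominus>\<^bsub>MA\<^esub> q = - q"
    using assms by (intro R.minus_equality) (simp_all add: MA_add MA_zero MA_carrier)
  then show ?thesis by (simp add: a_minus_def MA_add)
qed

lemma MA_mult_diff_l: "(p - q) \<otimes>\<^bsub>MA\<^esub> r = p \<otimes>\<^bsub>MA\<^esub> r - q \<otimes>\<^bsub>MA\<^esub> r"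
  using MA_mult_add_l[of "p - q" q r] by simp

lemma MA_mult_diff_r: "r \<otimes>\<^bsub>MA\<^esub> (p - q) = r \<otimes>\<^bsub>MA\<^esub> p - r \<otimes>\<^bsub>MA\<^esub> q"
  using MA_mult_add_r[of r "p - q" q] by simp

lemma MA_star_diff: "star MA (p - q) = star MA p - star MA q"
  using MA_star_add[of "p - q" q] by simp

end

definition bilin ::
    "('a, 'x) star_alg_scheme \<Rightarrow> ('b, 'y) star_alg_scheme \<Rightarrow> ('v, 'z) star_alg_scheme \<Rightarrow> ('a \<Rightarrow> 'b \<Rightarrow> 'v) \<Rightarrow> bool" where
  "bilin A B V \<beta> \<longleftrightarrow>
     (\<forall>a\<in>carrier A. lin_hom B V (\<beta> a)) \<and> (\<forall>b\<in>carrier B. lin_hom A V (\<lambda>a. \<beta> a b))"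

lemma bilinD:
  assumes "bilin A B V \<beta>"
  shows "a \<in> carrier A \<Longrightarrow> b \<in> carrier B \<Longrightarrow> \<beta> a b \<in> carrier V"
    "a \<in> carrier A \<Longrightarrow> a' \<in> carrier A \<Longrightarrow> b \<in> carrier B \<Longrightarrow> \<beta> (a \<oplus>\<^bsub>A\<^esub> a') b = \<beta> a b \<oplus>\<^bsub>V\<^esub> \<beta> a' b"
    "a \<in> carrier A \<Longrightarrow> b \<in> carrier B \<Longrightarrow> b' \<in> carrier B \<Longrightarrow> \<beta> a (b \<oplus>\<^bsub>B\<^esub> b') = \<beta> a b \<oplus>\<^bsub>V\<^esub> \<beta> a b'"
    "a \<in> carrier A \<Longrightarrow> b \<in> carrier B \<Longrightarrow> \<beta> (c \<odot>\<^bsub>A\<^esub> a) b = c \<odot>\<^bsub>V\<^esub> \<beta> a b"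
    "a \<in> carrier A \<Longrightarrow> b \<in> carrier B \<Longrightarrow> \<beta> a (c \<odot>\<^bsub>B\<^esub> b) = c \<odot>\<^bsub>V\<^esub> \<beta> a b"
  using assms by (auto simp: bilin_def lin_hom_def)

lemma bilinI:
  assumes "\<And>a b. a \<in> carrier A \<Longrightarrow> b \<in> carrier B \<Longrightarrow> \<beta> a b \<in> carrier V"
    "\<And>a a' b. a \<in> carrier A \<Longrightarrow> a' \<in> carrier A \<Longrightarrow> b \<in> carrier B \<Longrightarrow> \<beta> (a \<oplus>\<^bsub>A\<^esub> a') b = \<beta> a b \<oplus>\<^bsub>V\<^esub> \<beta> a' b"
    "\<And>a b b'. a \<in> carrier A \<Longrightarrow> b \<in> carrier B \<Longrightarrow> b' \<in> carrier B \<Longrightarrow> \<beta> a (b \<oplus>\<^bsub>B\<^esub> b') = \<beta> a b \<oplus>\<^bsub>V\<^esub> \<beta> a b'"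
    "\<And>a b c. a \<in> carrier A \<Longrightarrow> b \<in> carrier B \<Longrightarrow> \<beta> (c \<odot>\<^bsub>A\<^esub> a) b = c \<odot>\<^bsub>V\<^esub> \<beta> a b"
    "\<And>a b c. a \<in> carrier A \<Longrightarrow> b \<in> carrier B \<Longrightarrow> \<beta> a (c \<odot>\<^bsub>B\<^esub> b) = c \<odot>\<^bsub>V\<^esub> \<beta> a b"
  shows "bilin A B V \<beta>"
  using assms by (auto simp: bilin_def lin_hom_def)

locale star_tensor = A: staralg A + B: staralg B
  for A :: "('a, 'x) star_alg_scheme" and B :: "('b, 'y) star_alg_scheme"
begin

abbreviation "P \<equiv> A \<times>\<times> B"
abbreviation "sP \<equiv> map_prod (star A) (star B)"

sublocale P: star_monoid P sP
proof -
  interpret monoid "A \<times>\<times> B" by (rule DirProd_monoid[OF A.is_monoid B.is_monoid])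
  show "star_monoid P sP"
    by unfold_locales (auto simp: A.star_mult B.star_mult)
qed

abbreviation "sgl a b \<equiv> Poly_Mapping.single (a, b) (1::complex)"
abbreviation "R \<equiv> bilinear_relations A B"

lemma P_one: "\<one>\<^bsub>P\<^esub> = (\<one>\<^bsub>A\<^esub>, \<one>\<^bsub>B\<^esub>)"
  by (simp add: DirProd_def)

lemma relI:
  "a \<in> carrier A \<Longrightarrow> a' \<in> carrier A \<Longrightarrow> b \<in> carrier B \<Longrightarrow> sgl (a \<oplus>\<^bsub>A\<^esub> a') b - sgl a b - sgl a' b \<in> R"
  "a \<in> carrier A \<Longrightarrow> b \<in> carrier B \<Longrightarrow> b' \<in> carrier B \<Longrightarrow> sgl a (b \<oplus>\<^bsub>B\<^esub> b') - sgl a b - sgl a b' \<in> R"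
  "a \<in> carrier A \<Longrightarrow> b \<in> carrier B \<Longrightarrow> sgl (c \<odot>\<^bsub>A\<^esub> a) b - Poly_Mapping.single (a, b) c \<in> R"
  "a \<in> carrier A \<Longrightarrow> b \<in> carrier B \<Longrightarrow> sgl a (c \<odot>\<^bsub>B\<^esub> b) - Poly_Mapping.single (a, b) c \<in> R"
  unfolding bilinear_relations_def by blast+

lemma relE:
  assumes "r \<in> R"
    "\<And>a a' b. a \<in> carrier A \<Longrightarrow> a' \<in> carrier A \<Longrightarrow> b \<in> carrier B \<Longrightarrow> Q (sgl (a \<oplus>\<^bsub>A\<^esub> a') b - sgl a b - sgl a' b)"
    "\<And>a b b'. a \<in> carrier A \<Longrightarrow> b \<in> carrier B \<Longrightarrow> b' \<in> carrier B \<Longrightarrow> Q (sgl a (b \<oplus>\<^bsub>B\<^esub> b') - sgl a b - sgl a b')"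
    "\<And>a b c. a \<in> carrier A \<Longrightarrow> b \<in> carrier B \<Longrightarrow> Q (sgl (c \<odot>\<^bsub>A\<^esub> a) b - Poly_Mapping.single (a, b) c)"
    "\<And>a b c. a \<in> carrier A \<Longrightarrow> b \<in> carrier B \<Longrightarrow> Q (sgl a (c \<odot>\<^bsub>B\<^esub> b) - Poly_Mapping.single (a, b) c)"
  shows "Q r"
  using assms(1) unfolding bilinear_relations_def
  by (elim UnE CollectE exE conjE) (simp_all add: assms(2-))

lemma R_subset: "R \<subseteq> carrier P.MA"
proof
  fix r assume "r \<in> R"
  then show "r \<in> carrier P.MA"
    by (rule relE) (intro P.MA_closed_diff P.MA_closed_single; simp)+
qed

lemma star_ideal_bilinear_span: "star_ideal (bilinear_span A B) P.MA"
  unfolding bilinear_span_def pair_alg_def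
proof (rule star_ideal_lin_span[OF P.staralg_MA R_subset P.MA_singles P.MA_span])
  fix r b assume r: "r \<in> R" and "b \<in> {Poly_Mapping.single x (1::complex) |x. x \<in> carrier P}"
  then obtain x y where xy: "x \<in> carrier A" "y \<in> carrier B" and b: "b = sgl x y" by auto
  from r have "b \<otimes>\<^bsub>P.MA\<^esub> r \<in> R"
    by (rule relE)
      (use xy in \<open>simp_all add: b P.MA_mult_diff_r P.MA_mult_single A.r_distr B.r_distr
        A.smult_mult_r B.smult_mult_r relI\<close>)
  then show "b \<otimes>\<^bsub>P.MA\<^esub> r \<in> lin_span P.MA R" by (rule lin_span_base)
  from r have "r \<otimes>\<^bsub>P.MA\<^esub> b \<in> R"
    by (rule relE)
      (use xy in \<open>simp_all add: b P.MA_mult_diff_l P.MA_mult_single A.l_distr B.l_distr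
        A.smult_mult_l B.smult_mult_l relI\<close>)
  then show "r \<otimes>\<^bsub>P.MA\<^esub> b \<in> lin_span P.MA R" by (rule lin_span_base)
next
  fix r assume "r \<in> R"
  then have "star P.MA r \<in> R"
    by (rule relE)
      (simp_all add: P.MA_star_diff P.MA_star_single A.star_add B.star_add A.star_smult B.star_smult relI)
  then show "star P.MA r \<in> lin_span P.MA R" by (rule lin_span_base)
qed

sublocale T: star_quotient P.MA "bilinear_span A B"
  using P.staralg_MA star_ideal_bilinear_span
  by (simp add: star_quotient_def star_quotient_axioms_def)

lemma tensor_eq: "tensor A B = star_quot P.MA (bilinear_span A B)"
  by (simp add: tensor_def pair_alg_def)

lemma pure_eq: "pure_tensor A B a b = T.q (sgl a b)"
  by (simp add: pure_tensor_def pair_alg_def)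

lemma staralg_tensor: "staralg (tensor A B)"
  unfolding tensor_eq by (rule T.staralg_quot)

lemma pure_closed: "a \<in> carrier A \<Longrightarrow> b \<in> carrier B \<Longrightarrow> pure_tensor A B a b \<in> carrier (tensor A B)"
  unfolding pure_eq tensor_eq by (rule T.quot_closed) (simp add: P.MA_closed)

lemma rel_span: "r \<in> R \<Longrightarrow> r \<in> bilinear_span A B"
  unfolding bilinear_span_def by (rule lin_span_base)

lemma pure_add_l:
  assumes "a \<in> carrier A" "a' \<in> carrier A" "b \<in> carrier B"
  shows "pure_tensor A B (a \<oplus>\<^bsub>A\<^esub> a') b = pure_tensor A B a b \<oplus>\<^bsub>tensor A B\<^esub> pure_tensor A B a' b"
  using assms rel_span[OF relI(1)[OF assms]]
  by (simp add: pure_eq tensor_eq T.quot_add T.quot_eq_iff P.MA_closed P.MA_minus P.MA_add diff_diff_eq)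

lemma pure_add_r:
  assumes "a \<in> carrier A" "b \<in> carrier B" "b' \<in> carrier B"
  shows "pure_tensor A B a (b \<oplus>\<^bsub>B\<^esub> b') = pure_tensor A B a b \<oplus>\<^bsub>tensor A B\<^esub> pure_tensor A B a b'"
  using assms rel_span[OF relI(2)[OF assms]]
  by (simp add: pure_eq tensor_eq T.quot_add T.quot_eq_iff P.MA_closed P.MA_minus P.MA_add diff_diff_eq)

lemma pure_smult_l:
  assumes "a \<in> carrier A" "b \<in> carrier B"
  shows "pure_tensor A B (c \<odot>\<^bsub>A\<^esub> a) b = c \<odot>\<^bsub>tensor A B\<^esub> pure_tensor A B a b"
  using assms rel_span[OF relI(3)[OF assms]]
  by (simp add: pure_eq tensor_eq T.quot_smult T.quot_eq_iff P.MA_closed P.MA_minus P.MA_smult_single)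

lemma pure_smult_r:
  assumes "a \<in> carrier A" "b \<in> carrier B"
  shows "pure_tensor A B a (c \<odot>\<^bsub>B\<^esub> b) = c \<odot>\<^bsub>tensor A B\<^esub> pure_tensor A B a b"
  using assms rel_span[OF relI(4)[OF assms]]
  by (simp add: pure_eq tensor_eq T.quot_smult T.quot_eq_iff P.MA_closed P.MA_minus P.MA_smult_single)

lemma bilin_pure: "bilin A B (tensor A B) (pure_tensor A B)"
  by (rule bilinI) (simp_all add: pure_closed pure_add_l pure_add_r pure_smult_l pure_smult_r)

lemma pure_lin_l: "b \<in> carrier B \<Longrightarrow> lin_hom A (tensor A B) (\<lambda>a. pure_tensor A B a b)"
  and pure_lin_r: "a \<in> carrier A \<Longrightarrow> lin_hom B (tensor A B) (pure_tensor A B a)"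
  using bilin_pure by (auto simp: bilin_def)

lemma pure_mult:
  "a \<in> carrier A \<Longrightarrow> b \<in> carrier B \<Longrightarrow> a' \<in> carrier A \<Longrightarrow> b' \<in> carrier B \<Longrightarrow>
    pure_tensor A B a b \<otimes>\<^bsub>tensor A B\<^esub> pure_tensor A B a' b' = pure_tensor A B (a \<otimes>\<^bsub>A\<^esub> a') (b \<otimes>\<^bsub>B\<^esub> b')"
  by (simp add: pure_eq tensor_eq T.quot_mult P.MA_closed P.MA_mult_single)

lemma pure_star:
  "a \<in> carrier A \<Longrightarrow> b \<in> carrier B \<Longrightarrow>
    star (tensor A B) (pure_tensor A B a b) = pure_tensor A B (star A a) (star B b)"
  by (simp add: pure_eq tensor_eq T.quot_star P.MA_closed P.MA_star_single)

lemma tensor_one: "\<one>\<^bsub>tensor A B\<^esub> = pure_tensor A B \<one>\<^bsub>A\<^esub> \<one>\<^bsub>B\<^esub>"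
  by (simp add: pure_eq tensor_eq T.quot_one P.MA_one P_one)

lemma pure_zero_l: "b \<in> carrier B \<Longrightarrow> pure_tensor A B \<zero>\<^bsub>A\<^esub> b = \<zero>\<^bsub>tensor A B\<^esub>"
  by (rule lin_hom_zero[OF A.staralg_axioms staralg_tensor pure_lin_l])

lemma pure_zero_r: "a \<in> carrier A \<Longrightarrow> pure_tensor A B a \<zero>\<^bsub>B\<^esub> = \<zero>\<^bsub>tensor A B\<^esub>"
  by (rule lin_hom_zero[OF B.staralg_axioms staralg_tensor pure_lin_r])

lemma pure_finsum_l:
  "finite K \<Longrightarrow> f \<in> K \<rightarrow> carrier A \<Longrightarrow> b \<in> carrier B \<Longrightarrow>
    pure_tensor A B (\<Oplus>\<^bsub>A\<^esub>k\<in>K. f k) b = (\<Oplus>\<^bsub>tensor A B\<^esub>k\<in>K. pure_tensor A B (f k) b)"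
  by (rule lin_hom_finsum[OF A.staralg_axioms staralg_tensor pure_lin_l])

lemma pure_finsum_r:
  "finite K \<Longrightarrow> f \<in> K \<rightarrow> carrier B \<Longrightarrow> a \<in> carrier A \<Longrightarrow>
    pure_tensor A B a (\<Oplus>\<^bsub>B\<^esub>k\<in>K. f k) = (\<Oplus>\<^bsub>tensor A B\<^esub>k\<in>K. pure_tensor A B a (f k))"
  by (rule lin_hom_finsum[OF B.staralg_axioms staralg_tensor pure_lin_r])

text \<open>Zero and scalar multiples need no case of their own: 0 = 0 \<otimes> 0 is pure, and a
  scalar is absorbed into the left factor.\<close>

lemma tensor_induct [consumes 1, case_names pure add]:
  assumes x: "x \<in> carrier (tensor A B)"
    and pure: "\<And>a b. a \<in> carrier A \<Longrightarrow> b \<in> carrier B \<Longrightarrow> Q (pure_tensor A B a b)"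
    and add: "\<And>x y. x \<in> carrier (tensor A B) \<Longrightarrow> y \<in> carrier (tensor A B) \<Longrightarrow> Q x \<Longrightarrow> Q y \<Longrightarrow> Q (x \<oplus>\<^bsub>tensor A B\<^esub> y)"
  shows "Q x"
proof -
  have "Q (T.q p)" if "p \<in> carrier P.MA" for p
    using that
  proof (induct rule: P.MA_induct)
    case zero
    then show ?case using pure[of "\<zero>\<^bsub>A\<^esub>" "\<zero>\<^bsub>B\<^esub>"]
      by (simp add: pure_zero_l) (simp add: tensor_eq T.quot_zero P.MA_zero)
  next
    case (add x c p)
    obtain a b where x: "x = (a, b)" "a \<in> carrier A" "b \<in> carrier B" using add(1) by auto
    have "T.q (Poly_Mapping.single x c) = pure_tensor A B (c \<odot>\<^bsub>A\<^esub> a) b"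
      using x by (simp add: pure_smult_l) (simp add: pure_eq tensor_eq T.quot_smult P.MA_closed P.MA_smult_single)
    moreover have "T.q (Poly_Mapping.single x c + p) = T.q (Poly_Mapping.single x c) \<oplus>\<^bsub>tensor A B\<^esub> T.q p"
      using add x by (simp add: tensor_eq T.quot_add P.MA_closed P.MA_add)
    ultimately show ?case using x add assms(2)[of "c \<odot>\<^bsub>A\<^esub> a" b]
      by (auto simp: pure_closed tensor_eq T.quot_closed[OF add(2)] intro!: assms(3)[unfolded tensor_eq] pure_closed[unfolded tensor_eq])
  qed
  then show ?thesis using x by (auto simp: tensor_eq T.quot_carrier)
qed

lemma pures_subset: "{pure_tensor A B a b | a b. a \<in> carrier A \<and> b \<in> carrier B} \<subseteq> carrier (tensor A B)"
  by (auto simp: pure_closed)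

lemma pures_span: "carrier (tensor A B) \<subseteq> lin_span (tensor A B) {pure_tensor A B a b | a b. a \<in> carrier A \<and> b \<in> carrier B}"
proof
  note cl = lin_span_closed[OF staralg_tensor pures_subset]
  fix x assume "x \<in> carrier (tensor A B)"
  then show "x \<in> lin_span (tensor A B) {pure_tensor A B a b | a b. a \<in> carrier A \<and> b \<in> carrier B}"
    by (induct rule: tensor_induct) (auto intro: lin_span_base cl)
qed

section \<open>The universal property of the tensor product\<close>

context
  fixes V :: "('v, 'z) star_alg_scheme" and \<beta>
  assumes V: "staralg V" and \<beta>: "bilin A B V \<beta>"
begin

lemma lin_ext_bilin: "lin_hom P.MA V (lin_ext V (case_prod \<beta>))"
  by (rule P.lin_ext_lin[OF V]) (auto simp: bilinD[OF \<beta>])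

lemma lin_ext_bilin_single:
  "a \<in> carrier A \<Longrightarrow> b \<in> carrier B \<Longrightarrow> lin_ext V (case_prod \<beta>) (Poly_Mapping.single (a, b) c) = c \<odot>\<^bsub>V\<^esub> \<beta> a b"
  by (subst P.lin_ext_single[OF V]) (auto simp: bilinD[OF \<beta>])

text \<open>The ideal dividing out the bilinearity relations is merely their linear span, so a
  linear extension that kills the relations kills the ideal. This is why \<open>\<beta>\<close> may
  be any bilinear map, multiplicative or not.\<close>

lemma lin_ext_bilin_span: "r \<in> bilinear_span A B \<Longrightarrow> lin_ext V (case_prod \<beta>) r = \<zero>\<^bsub>V\<^esub>"
proof -
  interpret V: staralg V by (rule V)
  have v: "x \<oplus>\<^bsub>V\<^esub> y \<ominus>\<^bsub>V\<^esub> x \<ominus>\<^bsub>V\<^esub> y = \<zero>\<^bsub>V\<^esub>" if "x \<in> carrier V" "y \<in> carrier V" for x y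
  proof -
    have "x \<oplus>\<^bsub>V\<^esub> y \<ominus>\<^bsub>V\<^esub> x \<ominus>\<^bsub>V\<^esub> y = (x \<oplus>\<^bsub>V\<^esub> y) \<oplus>\<^bsub>V\<^esub> \<ominus>\<^bsub>V\<^esub> (x \<oplus>\<^bsub>V\<^esub> y)"
      using that by (simp add: V.minus_eq V.minus_add V.a_assoc)
    then show ?thesis using that by (simp add: V.r_neg)
  qed
  have w: "x \<ominus>\<^bsub>V\<^esub> x = \<zero>\<^bsub>V\<^esub>" if "x \<in> carrier V" for x
    using that by (simp add: V.minus_eq V.r_neg)
  have d: "lin_ext V (case_prod \<beta>) (p - q) = lin_ext V (case_prod \<beta>) p \<ominus>\<^bsub>V\<^esub> lin_ext V (case_prod \<beta>) q"
    if "p \<in> carrier P.MA" "q \<in> carrier P.MA" for p q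
    using that lin_hom_minus[OF P.staralg_MA V lin_ext_bilin, of p q] by (simp add: P.MA_minus)
  have "R \<subseteq> {r \<in> carrier P.MA. lin_ext V (case_prod \<beta>) r = \<zero>\<^bsub>V\<^esub>}"
  proof
    fix r assume r: "r \<in> R"
    then have "lin_ext V (case_prod \<beta>) r = \<zero>\<^bsub>V\<^esub>"
      by (rule relE)
        (simp_all add: d P.MA_closed_diff P.MA_closed lin_ext_bilin_single bilinD[OF \<beta>] v w)
    then show "r \<in> {r \<in> carrier P.MA. lin_ext V (case_prod \<beta>) r = \<zero>\<^bsub>V\<^esub>}"
      using r R_subset by auto
  qed
  from lin_span_minimal[OF submodule_kernel[OF P.staralg_MA V lin_ext_bilin] this]
  show "r \<in> bilinear_span A B \<Longrightarrow> lin_ext V (case_prod \<beta>) r = \<zero>\<^bsub>V\<^esub>"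
    by (auto simp: bilinear_span_def pair_alg_def)
qed

lemma tensor_lift_pure:
  "a \<in> carrier A \<Longrightarrow> b \<in> carrier B \<Longrightarrow> tensor_lift V \<beta> (pure_tensor A B a b) = \<beta> a b"
  unfolding tensor_lift_def pure_eq
  by (subst T.quot_lift[OF V lin_ext_bilin lin_ext_bilin_span])
    (simp_all add: P.MA_closed lin_ext_bilin_single bilinD[OF \<beta>] staralg.smult_one[OF V])

lemma tensor_lift_lin: "lin_hom (tensor A B) V (tensor_lift V \<beta>)"
  unfolding tensor_lift_def tensor_eq
  by (rule T.quot_lift_lin[OF V lin_ext_bilin lin_ext_bilin_span])

lemma tensor_lift_sum:
  assumes "finite K" "\<And>k. k \<in> K \<Longrightarrow> f k \<in> carrier A" "\<And>k. k \<in> K \<Longrightarrow> g k \<in> carrier B"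
  shows "tensor_lift V \<beta> (\<Oplus>\<^bsub>tensor A B\<^esub>k\<in>K. pure_tensor A B (f k) (g k)) = (\<Oplus>\<^bsub>V\<^esub>k\<in>K. \<beta> (f k) (g k))"
proof -
  interpret V: staralg V by (rule V)
  have "tensor_lift V \<beta> (\<Oplus>\<^bsub>tensor A B\<^esub>k\<in>K. pure_tensor A B (f k) (g k)) =
      (\<Oplus>\<^bsub>V\<^esub>k\<in>K. tensor_lift V \<beta> (pure_tensor A B (f k) (g k)))"
    by (rule lin_hom_finsum[OF staralg_tensor V tensor_lift_lin]) (use assms in \<open>auto simp: pure_closed\<close>)
  also have "\<dots> = (\<Oplus>\<^bsub>V\<^esub>k\<in>K. \<beta> (f k) (g k))"
    by (rule V.finsum_cong') (use assms in \<open>auto simp: tensor_lift_pure bilinD[OF \<beta>]\<close>)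
  finally show ?thesis .
qed

lemma tensor_lift_star_hom:
  assumes "\<And>a b a' b'. a \<in> carrier A \<Longrightarrow> b \<in> carrier B \<Longrightarrow> a' \<in> carrier A \<Longrightarrow> b' \<in> carrier B \<Longrightarrow>
      \<beta> (a \<otimes>\<^bsub>A\<^esub> a') (b \<otimes>\<^bsub>B\<^esub> b') = \<beta> a b \<otimes>\<^bsub>V\<^esub> \<beta> a' b'"
    and "\<beta> \<one>\<^bsub>A\<^esub> \<one>\<^bsub>B\<^esub> = \<one>\<^bsub>V\<^esub>"
    and "\<And>a b. a \<in> carrier A \<Longrightarrow> b \<in> carrier B \<Longrightarrow> \<beta> (star A a) (star B b) = star V (\<beta> a b)"
  shows "star_hom (tensor A B) V (tensor_lift V \<beta>)"
  by (rule star_homI_span[OF staralg_tensor V tensor_lift_lin pures_subset pures_span])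
    (auto simp: pure_mult pure_star tensor_one tensor_lift_pure assms)

end

lemma tensor_lin_eqI:
  assumes "staralg V" "lin_hom (tensor A B) V f" "lin_hom (tensor A B) V g"
    "\<And>a b. a \<in> carrier A \<Longrightarrow> b \<in> carrier B \<Longrightarrow> f (pure_tensor A B a b) = g (pure_tensor A B a b)"
    "x \<in> carrier (tensor A B)"
  shows "f x = g x"
  using assms(5)
  by (induct rule: tensor_induct) (simp_all add: assms(4) lin_homD(2)[OF assms(2)] lin_homD(2)[OF assms(3)])

end

lemma star_tensorI: "staralg A \<Longrightarrow> staralg B \<Longrightarrow> star_tensor A B"
  by (simp add: star_tensor_def)

lemma bilin_tensor_map:
  assumes "staralg C" "staralg D" "lin_hom A C f" "lin_hom B D g"
  shows "bilin A B (tensor C D) (\<lambda>a b. pure_tensor C D (f a) (g b))"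
proof -
  interpret CD: star_tensor C D using assms by (simp add: star_tensorI)
  show ?thesis
    by (rule bilinI) (simp_all add: lin_homD[OF assms(3)] lin_homD[OF assms(4)] bilinD[OF CD.bilin_pure])
qed

lemma tensor_map_pure:
  assumes "staralg A" "staralg B" "staralg C" "staralg D" "lin_hom A C f" "lin_hom B D g"
    "a \<in> carrier A" "b \<in> carrier B"
  shows "tensor_map C D f g (pure_tensor A B a b) = pure_tensor C D (f a) (g b)"
  unfolding tensor_map_def
  by (rule star_tensor.tensor_lift_pure[OF star_tensorI[OF assms(1,2)]
      star_tensor.staralg_tensor[OF star_tensorI[OF assms(3,4)]] bilin_tensor_map[OF assms(3-6)] assms(7,8)])

lemma tensor_map_lin:
  assumes "staralg A" "staralg B" "staralg C" "staralg D" "lin_hom A C f" "lin_hom B D g"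
  shows "lin_hom (tensor A B) (tensor C D) (tensor_map C D f g)"
  unfolding tensor_map_def
  by (rule star_tensor.tensor_lift_lin[OF star_tensorI[OF assms(1,2)]
      star_tensor.staralg_tensor[OF star_tensorI[OF assms(3,4)]] bilin_tensor_map[OF assms(3-6)]])

lemma tensor_map_sum:
  assumes "staralg A" "staralg B" "staralg C" "staralg D" "lin_hom A C f" "lin_hom B D g"
    "finite K" "\<And>k. k \<in> K \<Longrightarrow> x k \<in> carrier A" "\<And>k. k \<in> K \<Longrightarrow> y k \<in> carrier B"
  shows "tensor_map C D f g (\<Oplus>\<^bsub>tensor A B\<^esub>k\<in>K. pure_tensor A B (x k) (y k)) =
    (\<Oplus>\<^bsub>tensor C D\<^esub>k\<in>K. pure_tensor C D (f (x k)) (g (y k)))"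
  unfolding tensor_map_def
  by (rule star_tensor.tensor_lift_sum[OF star_tensorI[OF assms(1,2)]
      star_tensor.staralg_tensor[OF star_tensorI[OF assms(3,4)]] bilin_tensor_map[OF assms(3-6)] assms(7-9)])

lemma tensor_map_star_hom:
  assumes "staralg A" "staralg B" "staralg C" "staralg D" "star_hom A C f" "star_hom B D g"
  shows "star_hom (tensor A B) (tensor C D) (tensor_map C D f g)"
proof -
  interpret AB: star_tensor A B using assms by (simp add: star_tensorI)
  interpret CD: star_tensor C D using assms by (simp add: star_tensorI)
  note l = star_hom_lin[OF assms(5)] star_hom_lin[OF assms(6)]
  show ?thesis
    unfolding tensor_map_def
    by (rule AB.tensor_lift_star_hom[OF CD.staralg_tensor bilin_tensor_map[OF assms(3,4) l]])
      (simp_all add: star_homD[OF assms(5)] star_homD[OF assms(6)] CD.pure_mult CD.tensor_one CD.pure_star)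
qed

section \<open>Double sums and matrix identities over noncommutative rings\<close>

context abelian_monoid begin

lemma finsum_swap:
  assumes "finite I" "finite J" "\<And>i j. i \<in> I \<Longrightarrow> j \<in> J \<Longrightarrow> f i j \<in> carrier G"
  shows "(\<Oplus>i\<in>I. \<Oplus>j\<in>J. f i j) = (\<Oplus>j\<in>J. \<Oplus>i\<in>I. f i j)"
  using assms(1,3)
proof (induct set: finite)
  case empty
  then show ?case by simp
next
  case (insert x I)
  have "(\<Oplus>j\<in>J. \<Oplus>i\<in>insert x I. f i j) = (\<Oplus>j\<in>J. f x j \<oplus> (\<Oplus>i\<in>I. f i j))"
    by (rule finsum_cong') (use insert in \<open>auto simp: Pi_def intro!: finsum_insert finsum_closed\<close>)
  also have "\<dots> = (\<Oplus>j\<in>J. f x j) \<oplus> (\<Oplus>j\<in>J. \<Oplus>i\<in>I. f i j)"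
    by (rule finsum_addf) (use insert in \<open>auto intro!: finsum_closed\<close>)
  finally show ?case using insert by (simp add: Pi_def)
qed

text \<open>The numbers below n m are written uniquely as a m + b. This indexes the tensor product
  of an n-dimensional and an m-dimensional corepresentation.\<close>

lemma finsum_div_mod:
  fixes n m :: nat
  assumes "0 < m" "\<And>a b. a < n \<Longrightarrow> b < m \<Longrightarrow> f a b \<in> carrier G"
  shows "(\<Oplus>k\<in>{..<n * m}. f (k div m) (k mod m)) = (\<Oplus>a\<in>{..<n}. \<Oplus>b\<in>{..<m}. f a b)"
  using assms(2)
proof (induct n)
  case (Suc n)
  have d: "k div m < l" if "k < l * m" for k l
    using that by (simp add: less_mult_imp_div_less)
  have e: "{..<Suc n * m} = {..<n * m} \<union> (\<lambda>b. n * m + b) ` {..<m}"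
  proof (rule Set.set_eqI)
    fix k show "k \<in> {..<Suc n * m} \<longleftrightarrow> k \<in> {..<n * m} \<union> (\<lambda>b. n * m + b) ` {..<m}"
      by (cases "k < n * m") (auto simp: image_iff not_less intro!: bexI[of _ "k - n * m"])
  qed
  have "(\<Oplus>k\<in>{..<Suc n * m}. f (k div m) (k mod m)) =
    (\<Oplus>k\<in>{..<n * m}. f (k div m) (k mod m)) \<oplus> (\<Oplus>k\<in>(\<lambda>b. n * m + b) ` {..<m}. f (k div m) (k mod m))"
    unfolding e using assms(1) d[of _ n] Suc.prems
    by (intro finsum_Un_disjoint) (auto simp: less_SucI)
  also have "(\<Oplus>k\<in>(\<lambda>b. n * m + b) ` {..<m}. f (k div m) (k mod m)) = (\<Oplus>b\<in>{..<m}. f ((n * m + b) div m) ((n * m + b) mod m))"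
    by (rule finsum_reindex) (use assms(1) Suc.prems in \<open>auto simp: inj_on_def\<close>)
  also have "\<dots> = (\<Oplus>b\<in>{..<m}. f n b)"
    by (rule finsum_cong') (use assms(1) Suc.prems in auto)
  also have "(\<Oplus>k\<in>{..<n * m}. f (k div m) (k mod m)) = (\<Oplus>a\<in>{..<n}. \<Oplus>b\<in>{..<m}. f a b)"
    using Suc by simp
  finally show ?case
    using Suc.prems by (subst lessThan_Suc, subst finsum_insert) (auto intro!: a_comm finsum_closed)
qed simp

end

lemma (in staralg) finsum_mult_finsum:
  assumes "finite I" "finite J" "\<And>i. i \<in> I \<Longrightarrow> f i \<in> carrier A" "\<And>j. j \<in> J \<Longrightarrow> g j \<in> carrier A"
  shows "(\<Oplus>i\<in>I. f i) \<otimes> (\<Oplus>j\<in>J. g j) = (\<Oplus>i\<in>I. \<Oplus>j\<in>J. f i \<otimes> g j)"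
proof -
  have "(\<Oplus>i\<in>I. f i) \<otimes> (\<Oplus>j\<in>J. g j) = (\<Oplus>i\<in>I. f i \<otimes> (\<Oplus>j\<in>J. g j))"
    using assms by (intro finsum_ldistr) (auto intro!: finsum_closed)
  also have "\<dots> = (\<Oplus>i\<in>I. \<Oplus>j\<in>J. f i \<otimes> g j)"
    by (rule finsum_cong') (use assms in \<open>auto intro!: finsum_closed finsum_rdistr\<close>)
  finally show ?thesis .
qed

text \<open>The entries need not commute, so the adjacent pair y w has to be contracted before x and
  z can meet. This is the shape of U U^* for a product of two unitary matrices.\<close>

lemma (in staralg) nested_unitary_sum:
  assumes fin: "finite I" "finite J"
    and c: "\<And>i. i \<in> I \<Longrightarrow> x i \<in> carrier A" "\<And>i. i \<in> I \<Longrightarrow> z i \<in> carrier A"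
      "\<And>j. j \<in> J \<Longrightarrow> y j \<in> carrier A" "\<And>j. j \<in> J \<Longrightarrow> w j \<in> carrier A"
    and P: "(\<Oplus>i\<in>I. x i \<otimes> z i) = (if P then \<one> else \<zero>)"
    and Q: "(\<Oplus>j\<in>J. y j \<otimes> w j) = (if Q then \<one> else \<zero>)"
  shows "(\<Oplus>i\<in>I. \<Oplus>j\<in>J. x i \<otimes> y j \<otimes> (w j \<otimes> z i)) = (if P \<and> Q then \<one> else \<zero>)"
proof -
  have "(\<Oplus>i\<in>I. \<Oplus>j\<in>J. x i \<otimes> y j \<otimes> (w j \<otimes> z i)) = (\<Oplus>i\<in>I. if Q then x i \<otimes> z i else \<zero>)"
  proof (rule finsum_cong')
    fix i assume i: "i \<in> I"
    have "(\<Oplus>j\<in>J. x i \<otimes> y j \<otimes> (w j \<otimes> z i)) = (\<Oplus>j\<in>J. x i \<otimes> (y j \<otimes> w j) \<otimes> z i)"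
      by (rule finsum_cong') (use c i in \<open>auto simp: m_assoc\<close>)
    also have "\<dots> = x i \<otimes> (\<Oplus>j\<in>J. y j \<otimes> w j) \<otimes> z i"
      using c i fin by (simp add: finsum_ldistr finsum_rdistr Pi_def)
    also have "\<dots> = (if Q then x i \<otimes> z i else \<zero>)" using c i by (simp add: Q)
    finally show "(\<Oplus>j\<in>J. x i \<otimes> y j \<otimes> (w j \<otimes> z i)) = (if Q then x i \<otimes> z i else \<zero>)" .
  qed (use c in auto)
  then show ?thesis using P by (cases Q) simp_all
qed

lemma (in staralg) finsum_delta:
  assumes "finite I" "i \<in> I" "f i \<in> carrier A"
  shows "(\<Oplus>k\<in>I. if k = i then f k else \<zero>) = f i"
proof -
  have "(\<Oplus>k\<in>I. if k = i then f k else \<zero>) = (\<Oplus>k\<in>I. if i = k then (\<lambda>_. f i) k else \<zero>)"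
    by (rule finsum_cong') (use assms in auto)
  also have "\<dots> = f i" using assms by (subst finsum_singleton) auto
  finally show ?thesis .
qed

section \<open>The associator of the tensor product\<close>

context
  fixes A :: "('a, 'x) star_alg_scheme" and B :: "('b, 'y) star_alg_scheme" and C :: "('c, 'z) star_alg_scheme"
  assumes A: "staralg A" and B: "staralg B" and C: "staralg C"
begin

interpretation A: staralg A by (rule A)
interpretation B: staralg B by (rule B)
interpretation C: staralg C by (rule C)
interpretation AB: star_tensor A B by (rule star_tensorI[OF A B])
interpretation BC: star_tensor B C by (rule star_tensorI[OF B C])
interpretation A_BC: star_tensor A "tensor B C" by (rule star_tensorI[OF A BC.staralg_tensor])
interpretation AB_C: star_tensor "tensor A B" C by (rule star_tensorI[OF AB.staralg_tensor C])
interpretation V: staralg "tensor A (tensor B C)" by (rule A_BC.staralg_tensor)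

abbreviation (input) "pABC \<equiv> (\<lambda>c a b. pure_tensor A (tensor B C) a (pure_tensor B C b c))"
abbreviation (input) "lABC \<equiv> (\<lambda>t c. tensor_lift (tensor A (tensor B C)) (pABC c) t)"

lemma assoc_bilin_inner: "c \<in> carrier C \<Longrightarrow> bilin A B (tensor A (tensor B C)) (pABC c)"
  by (rule bilinI) (simp_all add: bilinD[OF BC.bilin_pure] bilinD[OF A_BC.bilin_pure])

lemma assoc_inner_pure:
  "a \<in> carrier A \<Longrightarrow> b \<in> carrier B \<Longrightarrow> c \<in> carrier C \<Longrightarrow> lABC (pure_tensor A B a b) c = pABC c a b"
  by (rule AB.tensor_lift_pure[OF A_BC.staralg_tensor assoc_bilin_inner])

lemma assoc_inner_lin: "c \<in> carrier C \<Longrightarrow> lin_hom (tensor A B) (tensor A (tensor B C)) (\<lambda>t. lABC t c)"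
  by (rule AB.tensor_lift_lin[OF A_BC.staralg_tensor assoc_bilin_inner])

text \<open>Here \<open>c\<close> is a parameter of the bilinear map that is being lifted, so
  linearity in \<open>c\<close> does not come with the lift; it is verified on pure tensors
  \<open>t\<close> and carried over to sums.\<close>

lemma assoc_inner_lin_r:
  assumes t: "t \<in> carrier (tensor A B)"
  shows "lin_hom C (tensor A (tensor B C)) (\<lambda>c. lABC t c)"
proof (rule lin_homI)
  show "lABC t c \<in> carrier (tensor A (tensor B C))" if "c \<in> carrier C" for c
    using lin_homD(1)[OF assoc_inner_lin[OF that] t] .
  show "lABC t (c \<oplus>\<^bsub>C\<^esub> d) = lABC t c \<oplus>\<^bsub>tensor A (tensor B C)\<^esub> lABC t d" if "c \<in> carrier C" "d \<in> carrier C" for c d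
    using t
    by (induct rule: AB.tensor_induct)
      (simp_all add: that assoc_inner_pure bilinD[OF BC.bilin_pure] bilinD[OF A_BC.bilin_pure]
        lin_homD[OF assoc_inner_lin] V.a_ac)
  show "lABC t (k \<odot>\<^bsub>C\<^esub> c) = k \<odot>\<^bsub>tensor A (tensor B C)\<^esub> lABC t c" if "c \<in> carrier C" for c k
    using t
    by (induct rule: AB.tensor_induct)
      (simp_all add: that assoc_inner_pure bilinD[OF BC.bilin_pure] bilinD[OF A_BC.bilin_pure]
        lin_homD[OF assoc_inner_lin] V.smult_r_distr)
qed

lemma assoc_bilin: "bilin (tensor A B) C (tensor A (tensor B C)) lABC"
  unfolding bilin_def using assoc_inner_lin assoc_inner_lin_r by blast

lemma assoc_inner_mult:
  assumes t: "t \<in> carrier (tensor A B)" and t': "t' \<in> carrier (tensor A B)" and c: "c \<in> carrier C" "c' \<in> carrier C"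
  shows "lABC (t \<otimes>\<^bsub>tensor A B\<^esub> t') (c \<otimes>\<^bsub>C\<^esub> c') = lABC t c \<otimes>\<^bsub>tensor A (tensor B C)\<^esub> lABC t' c'"
proof -
  note lin = lin_homD[OF assoc_inner_lin]
  have 1: "lABC (pure_tensor A B a b \<otimes>\<^bsub>tensor A B\<^esub> t') (c \<otimes>\<^bsub>C\<^esub> c') =
      lABC (pure_tensor A B a b) c \<otimes>\<^bsub>tensor A (tensor B C)\<^esub> lABC t' c'"
    if "a \<in> carrier A" "b \<in> carrier B" for a b
    using t'
    by (induct rule: AB.tensor_induct)
      (simp_all add: that c AB.pure_mult assoc_inner_pure BC.pure_mult A_BC.pure_mult BC.pure_closed
        A_BC.pure_closed lin AB_C.A.r_distr V.r_distr AB.pure_closed)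
  show ?thesis
    using t
    by (induct rule: AB.tensor_induct)
      (simp_all add: 1 c t' lin AB_C.A.l_distr V.l_distr)
qed

lemma assoc_inner_star:
  assumes t: "t \<in> carrier (tensor A B)" and c: "c \<in> carrier C"
  shows "lABC (star (tensor A B) t) (star C c) = star (tensor A (tensor B C)) (lABC t c)"
  using t
  by (induct rule: AB.tensor_induct)
    (simp_all add: c assoc_inner_pure AB.pure_star BC.pure_star A_BC.pure_star BC.pure_closed
      lin_homD[OF assoc_inner_lin] AB_C.A.star_add V.star_add)

text \<open>Makes both sides of coassociativity *-homomorphisms into the same algebra, so that they
  can be compared on generators.\<close>

lemma tensor_assoc_star_hom:
  "star_hom (tensor (tensor A B) C) (tensor A (tensor B C)) (tensor_assoc A B C)"
  unfolding tensor_assoc_def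
  by (rule AB_C.tensor_lift_star_hom[OF A_BC.staralg_tensor assoc_bilin])
    (simp_all add: assoc_inner_mult assoc_inner_star AB.tensor_one A_BC.tensor_one BC.tensor_one assoc_inner_pure)

lemma tensor_assoc_pure:
  "a \<in> carrier A \<Longrightarrow> b \<in> carrier B \<Longrightarrow> c \<in> carrier C \<Longrightarrow>
    tensor_assoc A B C (pure_tensor (tensor A B) C (pure_tensor A B a b) c) =
    pure_tensor A (tensor B C) a (pure_tensor B C b c)"
  unfolding tensor_assoc_def
  by (subst AB_C.tensor_lift_pure[OF A_BC.staralg_tensor assoc_bilin]) (simp_all add: AB.pure_closed assoc_inner_pure)

end

section \<open>Hopf *-algebras generated by unitary corepresentations\<close>

text \<open>The antipode is a \<open>*\<close>-homomorphism into the opposite algebra. The remaining Hopf axioms can then be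
  tested on generators.\<close>

definition pre_hopf :: "('a, 'x) hopf_star_alg_scheme \<Rightarrow> bool" where
  "pre_hopf A \<longleftrightarrow> staralg A \<and> star_hom A (tensor A A) (comult A) \<and>
     star_hom A complex_alg (counit A) \<and> star_hom A (opposite A) (antipode A)"

lemma delta_smult_sum:
  fixes j n :: nat
  assumes "staralg A" "j < n" "\<And>k. k < n \<Longrightarrow> u k \<in> carrier A"
  shows "(\<Oplus>\<^bsub>A\<^esub>k\<in>{..<n}. (if k = j then 1 else 0) \<odot>\<^bsub>A\<^esub> u k) = u j"
    "(\<Oplus>\<^bsub>A\<^esub>k\<in>{..<n}. (if j = k then 1 else 0) \<odot>\<^bsub>A\<^esub> u k) = u j"
proof -
  interpret staralg A by fact
  have "(\<Oplus>\<^bsub>A\<^esub>k\<in>{..<n}. (if k = j then 1 else 0) \<odot>\<^bsub>A\<^esub> u k) = (\<Oplus>\<^bsub>A\<^esub>k\<in>{..<n}. if k = j then u k else \<zero>\<^bsub>A\<^esub>)"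
    "(\<Oplus>\<^bsub>A\<^esub>k\<in>{..<n}. (if j = k then 1 else 0) \<odot>\<^bsub>A\<^esub> u k) = (\<Oplus>\<^bsub>A\<^esub>k\<in>{..<n}. if k = j then u k else \<zero>\<^bsub>A\<^esub>)"
    by (rule finsum_cong'; use assms in auto)+
  then show "(\<Oplus>\<^bsub>A\<^esub>k\<in>{..<n}. (if k = j then 1 else 0) \<odot>\<^bsub>A\<^esub> u k) = u j"
    "(\<Oplus>\<^bsub>A\<^esub>k\<in>{..<n}. (if j = k then 1 else 0) \<odot>\<^bsub>A\<^esub> u k) = u j"
    using assms finsum_delta[of "{..<n}" j u] by simp_all
qed

locale pre_hopf_alg = fixes H :: "('a, 'x) hopf_star_alg_scheme" (structure)
  assumes pre_hopf: "pre_hopf H"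
begin

lemma alg: "staralg H" and comult: "star_hom H (tensor H H) (comult H)"
  and counit: "star_hom H complex_alg (counit H)" and antipode: "star_hom H (opposite H) (antipode H)"
  using pre_hopf by (simp_all add: pre_hopf_def)

sublocale H: staralg H by (rule alg)
sublocale HH: star_tensor H H by (rule star_tensorI[OF alg alg])
sublocale T: staralg "tensor H H" by (rule HH.staralg_tensor)

abbreviation "S \<equiv> antipode H"
abbreviation "\<epsilon> \<equiv> counit H"
abbreviation "\<Delta> \<equiv> comult H"

lemma \<epsilon>_simps:
  "x \<in> carrier H \<Longrightarrow> y \<in> carrier H \<Longrightarrow> \<epsilon> (x \<oplus> y) = \<epsilon> x + \<epsilon> y"
  "x \<in> carrier H \<Longrightarrow> y \<in> carrier H \<Longrightarrow> \<epsilon> (x \<otimes> y) = \<epsilon> x * \<epsilon> y"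
  "\<epsilon> \<one> = 1" "x \<in> carrier H \<Longrightarrow> \<epsilon> (c \<odot> x) = c * \<epsilon> x" "x \<in> carrier H \<Longrightarrow> \<epsilon> (star H x) = cnj (\<epsilon> x)"
  using star_homD[OF counit] by auto

lemma S_simps:
  "x \<in> carrier H \<Longrightarrow> S x \<in> carrier H"
  "x \<in> carrier H \<Longrightarrow> y \<in> carrier H \<Longrightarrow> S (x \<oplus> y) = S x \<oplus> S y"
  "x \<in> carrier H \<Longrightarrow> y \<in> carrier H \<Longrightarrow> S (x \<otimes> y) = S y \<otimes> S x"
  "S \<one> = \<one>" "x \<in> carrier H \<Longrightarrow> S (c \<odot> x) = c \<odot> S x" "x \<in> carrier H \<Longrightarrow> S (star H x) = star H (S x)"
  using star_homD[OF antipode] by auto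

lemma bilin_counit_l: "bilin H H H (\<lambda>a b. \<epsilon> a \<odot> b)"
  by (rule bilinI) (simp_all add: \<epsilon>_simps H.smult_l_distr H.smult_r_distr H.smult_smult mult.commute)

lemma bilin_counit_r: "bilin H H H (\<lambda>a b. \<epsilon> b \<odot> a)"
  by (rule bilinI) (simp_all add: \<epsilon>_simps H.smult_l_distr H.smult_r_distr H.smult_smult mult.commute)

text \<open>Multiplicative because the values of \<epsilon> are scalars and commute with everything;
  the counit laws can thus be tested on generators.\<close>

lemma counit_l_hom: "star_hom (tensor H H) H (tensor_lift H (\<lambda>a b. \<epsilon> a \<odot> b))"
  by (rule HH.tensor_lift_star_hom[OF alg bilin_counit_l])
    (simp_all add: \<epsilon>_simps H.smult_mult_l H.smult_mult_r H.smult_smult H.star_smult mult.commute)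

lemma counit_r_hom: "star_hom (tensor H H) H (tensor_lift H (\<lambda>a b. \<epsilon> b \<odot> a))"
  by (rule HH.tensor_lift_star_hom[OF alg bilin_counit_r])
    (simp_all add: \<epsilon>_simps H.smult_mult_l H.smult_mult_r H.smult_smult H.star_smult mult.commute)

lemma bilin_S_l: "bilin H H H (\<lambda>a b. S a \<otimes> b)"
  by (rule bilinI) (simp_all add: S_simps H.l_distr H.r_distr H.smult_mult_l H.smult_mult_r)

lemma bilin_S_r: "bilin H H H (\<lambda>a b. a \<otimes> S b)"
  by (rule bilinI) (simp_all add: S_simps H.l_distr H.r_distr H.smult_mult_l H.smult_mult_r)

abbreviation "Sl \<equiv> tensor_lift H (\<lambda>a b. S a \<otimes> b)"
abbreviation "Sr \<equiv> tensor_lift H (\<lambda>a b. a \<otimes> S b)"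

lemmas Sl_pure = HH.tensor_lift_pure[OF alg bilin_S_l]
lemmas Sr_pure = HH.tensor_lift_pure[OF alg bilin_S_r]
lemmas Sl_lin = HH.tensor_lift_lin[OF alg bilin_S_l]
lemmas Sr_lin = HH.tensor_lift_lin[OF alg bilin_S_r]

text \<open>On pure tensors S(a c) b d = S(c) (S(a) b) d: the contraction of \<open>s\<close> ends
  up enclosed between S(c) and d.\<close>

lemma Sl_mult_pure:
  assumes "s \<in> carrier (tensor H H)" "c \<in> carrier H" "d \<in> carrier H"
  shows "Sl (s \<otimes>\<^bsub>tensor H H\<^esub> pure_tensor H H c d) = S c \<otimes> Sl s \<otimes> d"
  using assms(1)
proof (induct rule: HH.tensor_induct)
  case (pure a b)
  then show ?case using assms by (simp add: HH.pure_mult Sl_pure S_simps H.m_assoc)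
next
  case (add x y)
  then show ?case using assms lin_homD(1)[OF Sl_lin]
    by (simp add: T.l_distr HH.pure_closed lin_homD(2)[OF Sl_lin] S_simps H.l_distr H.r_distr)
qed

lemma Sr_mult_pure:
  assumes "t \<in> carrier (tensor H H)" "a \<in> carrier H" "b \<in> carrier H"
  shows "Sr (pure_tensor H H a b \<otimes>\<^bsub>tensor H H\<^esub> t) = a \<otimes> Sr t \<otimes> S b"
  using assms(1)
proof (induct rule: HH.tensor_induct)
  case (pure c d)
  then show ?case using assms by (simp add: HH.pure_mult Sr_pure S_simps H.m_assoc)
next
  case (add x y)
  then show ?case using assms lin_homD(1)[OF Sr_lin]
    by (simp add: T.r_distr HH.pure_closed lin_homD(2)[OF Sr_lin] S_simps H.l_distr H.r_distr)
qed

text \<open>If the enclosed contraction is a scalar, it moves out and leaves the contraction of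
  \<open>t\<close>. For \<open>Sr\<close> the enclosed factor is the second one, so there the
  assumption falls on \<open>t\<close>.\<close>

lemma Sl_mult:
  assumes "s \<in> carrier (tensor H H)" "t \<in> carrier (tensor H H)" "Sl s = e \<odot> \<one>"
  shows "Sl (s \<otimes>\<^bsub>tensor H H\<^esub> t) = e \<odot> Sl t"
  using assms(2)
proof (induct rule: HH.tensor_induct)
  case (pure c d)
  then show ?case
    by (simp add: Sl_mult_pure assms S_simps H.smult_mult_l H.smult_mult_r Sl_pure)
next
  case (add x y)
  then show ?case using assms lin_homD(1)[OF Sl_lin]
    by (simp add: T.r_distr lin_homD(2)[OF Sl_lin] H.smult_r_distr)
qed

lemma Sr_mult:
  assumes "s \<in> carrier (tensor H H)" "t \<in> carrier (tensor H H)" "Sr t = e \<odot> \<one>"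
  shows "Sr (s \<otimes>\<^bsub>tensor H H\<^esub> t) = e \<odot> Sr s"
  using assms(1)
proof (induct rule: HH.tensor_induct)
  case (pure c d)
  then show ?case
    by (simp add: Sr_mult_pure assms S_simps H.smult_mult_l H.smult_mult_r Sr_pure)
next
  case (add x y)
  then show ?case using assms lin_homD(1)[OF Sr_lin]
    by (simp add: T.l_distr lin_homD(2)[OF Sr_lin] H.smult_r_distr)
qed

lemma id_hom: "star_hom H H id"
  using star_hom_id[OF alg] by (simp add: id_def)

text \<open>Both sides are the double sum of u_il \<otimes> u_lk \<otimes> u_kj, obtained with the
  two possible orders of summation.\<close>

lemma unitary_corep_coassoc:
  assumes u: "unitary_corep H n u" and ij: "i < n" "j < n"
  shows "tensor_assoc H H H (tensor_map (tensor H H) H \<Delta> id (\<Delta> (u i j))) =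
    tensor_map H (tensor H H) id \<Delta> (\<Delta> (u i j))"
proof -
  interpret H_HH: star_tensor H "tensor H H" by (rule star_tensorI[OF alg HH.staralg_tensor])
  interpret HH_H: star_tensor "tensor H H" H by (rule star_tensorI[OF HH.staralg_tensor alg])
  interpret HHH: staralg "tensor H (tensor H H)" by (rule H_HH.staralg_tensor)
  interpret HHH': staralg "tensor (tensor H H) H" by (rule HH_H.staralg_tensor)
  have uc: "u i j \<in> carrier H" if "i < n" "j < n" for i j
    using u that by (simp add: unitary_corep_def)
  have ud: "\<Delta> (u i j) = (\<Oplus>\<^bsub>tensor H H\<^esub>k\<in>{..<n}. pure_tensor H H (u i k) (u k j))" if "i < n" "j < n" for i j
    using u that by (simp add: unitary_corep_def)
  have cl: "\<Delta> x \<in> carrier (tensor H H)" if "x \<in> carrier H" for x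
    using star_homD(1)[OF comult that] .
  note la = star_hom_lin[OF tensor_assoc_star_hom[OF alg alg alg]]
  have 1: "tensor_assoc H H H (pure_tensor (tensor H H) H (\<Delta> (u i k)) (u k j)) =
      (\<Oplus>\<^bsub>tensor H (tensor H H)\<^esub>l\<in>{..<n}. pure_tensor H (tensor H H) (u i l) (pure_tensor H H (u l k) (u k j)))"
    if "k < n" for k
  proof -
    have e: "pure_tensor (tensor H H) H (\<Delta> (u i k)) (u k j) =
      (\<Oplus>\<^bsub>tensor (tensor H H) H\<^esub>l\<in>{..<n}. pure_tensor (tensor H H) H (pure_tensor H H (u i l) (u l k)) (u k j))"
      unfolding ud[OF ij(1) that]
      by (rule HH_H.pure_finsum_l) (use ij that in \<open>auto simp: uc HH.pure_closed\<close>)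
    have "tensor_assoc H H H (pure_tensor (tensor H H) H (\<Delta> (u i k)) (u k j)) =
      (\<Oplus>\<^bsub>tensor H (tensor H H)\<^esub>l\<in>{..<n}. tensor_assoc H H H (pure_tensor (tensor H H) H (pure_tensor H H (u i l) (u l k)) (u k j)))"
      unfolding e by (rule lin_hom_finsum[OF HH_H.staralg_tensor H_HH.staralg_tensor la])
        (use ij that in \<open>auto simp: uc HH.pure_closed HH_H.pure_closed\<close>)
    also have "\<dots> = (\<Oplus>\<^bsub>tensor H (tensor H H)\<^esub>l\<in>{..<n}. pure_tensor H (tensor H H) (u i l) (pure_tensor H H (u l k) (u k j)))"
      by (rule HHH.finsum_cong')
        (use ij that in \<open>auto simp: uc HH.pure_closed H_HH.pure_closed tensor_assoc_pure[OF alg alg alg]\<close>)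
    finally show ?thesis .
  qed
  have e: "tensor_map (tensor H H) H \<Delta> id (\<Delta> (u i j)) =
     (\<Oplus>\<^bsub>tensor (tensor H H) H\<^esub>k\<in>{..<n}. pure_tensor (tensor H H) H (\<Delta> (u i k)) (id (u k j)))"
    unfolding ud[OF ij]
    by (rule tensor_map_sum[OF alg alg HH.staralg_tensor alg star_hom_lin[OF comult] star_hom_lin[OF id_hom]])
      (use ij in \<open>simp_all add: uc\<close>)
  have "tensor_assoc H H H (tensor_map (tensor H H) H \<Delta> id (\<Delta> (u i j))) =
     (\<Oplus>\<^bsub>tensor H (tensor H H)\<^esub>k\<in>{..<n}. tensor_assoc H H H (pure_tensor (tensor H H) H (\<Delta> (u i k)) (u k j)))"
    unfolding e id_apply by (rule lin_hom_finsum[OF HH_H.staralg_tensor H_HH.staralg_tensor la])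
      (use ij in \<open>auto simp: uc cl HH_H.pure_closed\<close>)
  also have "\<dots> = (\<Oplus>\<^bsub>tensor H (tensor H H)\<^esub>k\<in>{..<n}. \<Oplus>\<^bsub>tensor H (tensor H H)\<^esub>l\<in>{..<n}.
      pure_tensor H (tensor H H) (u i l) (pure_tensor H H (u l k) (u k j)))"
    by (rule HHH.finsum_cong')
      (use ij in \<open>auto simp: 1 uc HH.pure_closed H_HH.pure_closed intro!: HHH.finsum_closed\<close>)
  also have "\<dots> = (\<Oplus>\<^bsub>tensor H (tensor H H)\<^esub>l\<in>{..<n}. \<Oplus>\<^bsub>tensor H (tensor H H)\<^esub>k\<in>{..<n}.
      pure_tensor H (tensor H H) (u i l) (pure_tensor H H (u l k) (u k j)))"
    by (rule HHH.finsum_swap) (use ij in \<open>auto simp: uc HH.pure_closed H_HH.pure_closed\<close>)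
  also have "\<dots> = (\<Oplus>\<^bsub>tensor H (tensor H H)\<^esub>l\<in>{..<n}. pure_tensor H (tensor H H) (id (u i l)) (\<Delta> (u l j)))"
  proof (rule HHH.finsum_cong')
    fix l assume "l \<in> {..<n}"
    then have l: "l < n" by simp
    show "(\<Oplus>\<^bsub>tensor H (tensor H H)\<^esub>k\<in>{..<n}. pure_tensor H (tensor H H) (u i l) (pure_tensor H H (u l k) (u k j))) =
      pure_tensor H (tensor H H) (id (u i l)) (\<Delta> (u l j))"
      unfolding ud[OF l ij(2)] id_apply
      by (rule H_HH.pure_finsum_r[symmetric]) (use ij l in \<open>auto simp: uc HH.pure_closed\<close>)
  qed (use ij in \<open>auto simp: uc cl H_HH.pure_closed\<close>)
  also have "\<dots> = tensor_map H (tensor H H) id \<Delta> (\<Delta> (u i j))"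
    unfolding ud[OF ij]
    by (rule tensor_map_sum[OF alg alg alg HH.staralg_tensor star_hom_lin[OF id_hom] star_hom_lin[OF comult], symmetric])
      (use ij in \<open>simp_all add: uc\<close>)
  finally show ?thesis .
qed

lemma unitary_corep_lift:
  assumes "staralg V" "bilin H H V \<beta>" "unitary_corep H n u" "i < n" "j < n"
  shows "tensor_lift V \<beta> (\<Delta> (u i j)) = (\<Oplus>\<^bsub>V\<^esub>k\<in>{..<n}. \<beta> (u i k) (u k j))"
  using HH.tensor_lift_sum[OF assms(1,2), of "{..<n}" "\<lambda>k. u i k" "\<lambda>k. u k j"] assms(3-5)
  by (simp add: unitary_corep_def)

lemma unitary_corep_counit:
  assumes u: "unitary_corep H n u" and ij: "i < n" "j < n"
  shows "tensor_lift H (\<lambda>a b. \<epsilon> a \<odot> b) (\<Delta> (u i j)) = u i j"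
    "tensor_lift H (\<lambda>a b. \<epsilon> b \<odot> a) (\<Delta> (u i j)) = u i j"
proof -
  have uc: "u i j \<in> carrier H" "\<epsilon> (u i j) = (if i = j then 1 else 0)" if "i < n" "j < n" for i j
    using u that by (simp_all add: unitary_corep_def)
  have "tensor_lift H (\<lambda>a b. \<epsilon> a \<odot> b) (\<Delta> (u i j)) = (\<Oplus>k\<in>{..<n}. (if i = k then 1 else 0) \<odot> u k j)"
    unfolding unitary_corep_lift[OF alg bilin_counit_l u ij] by (rule H.finsum_cong') (use ij in \<open>auto simp: uc\<close>)
  also have "\<dots> = u i j" by (rule delta_smult_sum[OF alg]) (use ij in \<open>auto simp: uc\<close>)
  finally show "tensor_lift H (\<lambda>a b. \<epsilon> a \<odot> b) (\<Delta> (u i j)) = u i j" .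
  have "tensor_lift H (\<lambda>a b. \<epsilon> b \<odot> a) (\<Delta> (u i j)) = (\<Oplus>k\<in>{..<n}. (if k = j then 1 else 0) \<odot> u i k)"
    unfolding unitary_corep_lift[OF alg bilin_counit_r u ij] by (rule H.finsum_cong') (use ij in \<open>auto simp: uc\<close>)
  also have "\<dots> = u i j" by (rule delta_smult_sum[OF alg]) (use ij in \<open>auto simp: uc\<close>)
  finally show "tensor_lift H (\<lambda>a b. \<epsilon> b \<odot> a) (\<Delta> (u i j)) = u i j" .
qed

text \<open>When S(u) = u^* entrywise, the two antipode laws are the (i, j) entries of u^* u = 1 and
  u u^* = 1.\<close>

lemma unitary_corep_antipode:
  assumes u: "unitary_corep H n u" and ij: "i < n" "j < n"
    and S: "\<And>i j. i < n \<Longrightarrow> j < n \<Longrightarrow> S (u i j) = star H (u j i)"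
  shows "Sl (\<Delta> (u i j)) = \<epsilon> (u i j) \<odot> \<one>" "Sr (\<Delta> (u i j)) = \<epsilon> (u i j) \<odot> \<one>"
proof -
  have uc: "u i j \<in> carrier H" if "i < n" "j < n" for i j
    using u that by (simp add: unitary_corep_def)
  have "Sl (\<Delta> (u i j)) = (\<Oplus>k\<in>{..<n}. star H (u k i) \<otimes> u k j)"
    unfolding unitary_corep_lift[OF alg bilin_S_l u ij] by (rule H.finsum_cong') (use ij in \<open>auto simp: uc S\<close>)
  then show "Sl (\<Delta> (u i j)) = \<epsilon> (u i j) \<odot> \<one>" using u ij by (auto simp: unitary_corep_def)
  have "Sr (\<Delta> (u i j)) = (\<Oplus>k\<in>{..<n}. u i k \<otimes> star H (u j k))"
    unfolding unitary_corep_lift[OF alg bilin_S_r u ij] by (rule H.finsum_cong') (use ij in \<open>auto simp: uc S\<close>)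
  then show "Sr (\<Delta> (u i j)) = \<epsilon> (u i j) \<odot> \<one>" using u ij by (auto simp: unitary_corep_def)
qed

text \<open>The condition on the antipode concerns all entries of the matrix, since the antipode law
  at one coefficient involves a whole row and a whole column.\<close>

definition "corep_coeff x \<longleftrightarrow> (\<exists>n u i j. unitary_corep H n u \<and> i < n \<and> j < n \<and> x = u i j \<and>
   (\<forall>i<n. \<forall>j<n. S (u i j) = star H (u j i)))"

lemma hopf_star_algebraI:
  assumes gen: "generates H G" and G: "\<And>x. x \<in> G \<Longrightarrow> corep_coeff x"
  shows "hopf_star_algebra H"
proof -
  have h1: "star_hom H (tensor H (tensor H H)) (\<lambda>x. tensor_assoc H H H (tensor_map (tensor H H) H \<Delta> id (\<Delta> x)))"
    by (rule star_hom_comp[OF star_hom_comp[OF comult tensor_map_star_hom] tensor_assoc_star_hom])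
      (simp_all add: alg HH.staralg_tensor comult id_hom)
  have h2: "star_hom H (tensor H (tensor H H)) (\<lambda>x. tensor_map H (tensor H H) id \<Delta> (\<Delta> x))"
    by (rule star_hom_comp[OF comult tensor_map_star_hom])
      (simp_all add: alg HH.staralg_tensor comult id_hom)
  have GE: thesis if "x \<in> G" "\<And>n u i j. unitary_corep H n u \<Longrightarrow> i < n \<Longrightarrow> j < n \<Longrightarrow> x = u i j \<Longrightarrow>
      (\<And>i j. i < n \<Longrightarrow> j < n \<Longrightarrow> S (u i j) = star H (u j i)) \<Longrightarrow> thesis" for x thesis
    using G[OF that(1)] that(2) unfolding corep_coeff_def by blast
  have c1: "tensor_assoc H H H (tensor_map (tensor H H) H \<Delta> id (\<Delta> x)) = tensor_map H (tensor H H) id \<Delta> (\<Delta> x)"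
    if "x \<in> carrier H" for x
  proof (rule star_hom_eq_on_generators[OF alg gen h1 h2 _ that])
    fix x assume "x \<in> G"
    then obtain n u i j where "unitary_corep H n u" "i < n" "j < n" and x: "x = u i j" by (rule GE)
    then show "tensor_assoc H H H (tensor_map (tensor H H) H \<Delta> id (\<Delta> x)) = tensor_map H (tensor H H) id \<Delta> (\<Delta> x)"
      unfolding x by (intro unitary_corep_coassoc)
  qed
  have c2: "tensor_lift H (\<lambda>a b. \<epsilon> a \<odot> b) (\<Delta> x) = x" if "x \<in> carrier H" for x
  proof (rule star_hom_eq_on_generators[OF alg gen star_hom_comp[OF comult counit_l_hom] star_hom_id[OF alg] _ that])
    fix x assume "x \<in> G"
    then obtain n u i j where "unitary_corep H n u" "i < n" "j < n" and x: "x = u i j" by (rule GE)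
    then show "tensor_lift H (\<lambda>a b. \<epsilon> a \<odot> b) (\<Delta> x) = x"
      unfolding x by (intro unitary_corep_counit)
  qed
  have c3: "tensor_lift H (\<lambda>a b. \<epsilon> b \<odot> a) (\<Delta> x) = x" if "x \<in> carrier H" for x
  proof (rule star_hom_eq_on_generators[OF alg gen star_hom_comp[OF comult counit_r_hom] star_hom_id[OF alg] _ that])
    fix x assume "x \<in> G"
    then obtain n u i j where "unitary_corep H n u" "i < n" "j < n" and x: "x = u i j" by (rule GE)
    then show "tensor_lift H (\<lambda>a b. \<epsilon> b \<odot> a) (\<Delta> x) = x"
      unfolding x by (intro unitary_corep_counit)
  qed
  note cD = star_homD[OF comult]
  \<comment> \<open>Neither side of the contraction is a homomorphism in x, so agreement on
    generators would not suffice; both laws are carried through the generation of x. For a product x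
    y, the left law uses that the contraction at x is scalar, the right law that the one at y
    is.\<close>
  have a: "Sl (\<Delta> x) = \<epsilon> x \<odot> \<one> \<and> Sr (\<Delta> x) = \<epsilon> x \<odot> \<one>" if "x \<in> carrier H" for x
    using alg gen that
  proof (induct rule: generates_induct)
    case (gen x)
    then obtain n u i j where "unitary_corep H n u" "i < n" "j < n" and x: "x = u i j"
      and "\<And>i j. i < n \<Longrightarrow> j < n \<Longrightarrow> S (u i j) = star H (u j i)" by (rule GE) blast
    then show ?case unfolding x by (intro conjI unitary_corep_antipode)
  next
    case one
    then show ?case by (simp add: cD HH.tensor_one Sl_pure Sr_pure S_simps \<epsilon>_simps)
  next
    case (add x y)
    then show ?case
      by (simp add: cD lin_homD[OF Sl_lin] lin_homD[OF Sr_lin] \<epsilon>_simps H.smult_l_distr)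
  next
    case (mult x y)
    then show ?case
      by (simp add: cD \<epsilon>_simps H.smult_smult mult.commute Sl_mult[of "\<Delta> x" "\<Delta> y" "\<epsilon> x"]
        Sr_mult[of "\<Delta> x" "\<Delta> y" "\<epsilon> y"])
  next
    case (smult c x)
    then show ?case
      by (simp add: cD lin_homD[OF Sl_lin] lin_homD[OF Sr_lin] \<epsilon>_simps H.smult_smult)
  qed
  show ?thesis
    unfolding hopf_star_algebra_def star_algebra_iff
    using c1 c2 c3 a by (auto simp: alg comult counit S_simps)
qed

lemma unitary_corep_grouplike:
  assumes "g \<in> carrier H" "\<Delta> g = pure_tensor H H g g" "\<epsilon> g = 1"
    "g \<otimes> star H g = \<one>" "star H g \<otimes> g = \<one>"
  shows "unitary_corep H 1 (\<lambda>_ _. g)"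
  by (simp add: unitary_corep_def lessThan_Suc assms HH.pure_closed)

lemma unitary_corep_one: "unitary_corep H 1 (\<lambda>_ _. \<one>)"
  by (rule unitary_corep_grouplike) (simp_all add: \<epsilon>_simps star_homD(4)[OF comult] HH.tensor_one)

text \<open>The tensor product of two corepresentations; the index pair (a, b) is encoded as the
  number a m + b.\<close>

lemma unitary_corep_mult:
  assumes u: "unitary_corep H n u" and v: "unitary_corep H m v" and m: "0 < m"
  shows "unitary_corep H (n * m) (\<lambda>p q. u (p div m) (q div m) \<otimes> v (p mod m) (q mod m))"
  unfolding unitary_corep_def
proof (intro allI impI conjI)
  have uc: "u i j \<in> carrier H" "\<epsilon> (u i j) = (if i = j then 1 else 0)"
    "\<Delta> (u i j) = (\<Oplus>\<^bsub>tensor H H\<^esub>k\<in>{..<n}. pure_tensor H H (u i k) (u k j))"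
    "(\<Oplus>k\<in>{..<n}. u i k \<otimes> star H (u j k)) = (if i = j then \<one> else \<zero>)"
    "(\<Oplus>k\<in>{..<n}. star H (u k i) \<otimes> u k j) = (if i = j then \<one> else \<zero>)"
    if "i < n" "j < n" for i j
    using u that by (simp_all add: unitary_corep_def)
  have vc: "v i j \<in> carrier H" "\<epsilon> (v i j) = (if i = j then 1 else 0)"
    "\<Delta> (v i j) = (\<Oplus>\<^bsub>tensor H H\<^esub>k\<in>{..<m}. pure_tensor H H (v i k) (v k j))"
    "(\<Oplus>k\<in>{..<m}. v i k \<otimes> star H (v j k)) = (if i = j then \<one> else \<zero>)"
    "(\<Oplus>k\<in>{..<m}. star H (v k i) \<otimes> v k j) = (if i = j then \<one> else \<zero>)"
    if "i < m" "j < m" for i j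
    using v that by (simp_all add: unitary_corep_def)
  fix i j assume "i < n * m" "j < n * m"
  then have ij: "i div m < n" "j div m < n" "i mod m < m" "j mod m < m"
    using m by (simp_all add: less_mult_imp_div_less)
  have eq: "i = j \<longleftrightarrow> i div m = j div m \<and> i mod m = j mod m"
    by (metis div_mult_mod_eq)
  show "u (i div m) (j div m) \<otimes> v (i mod m) (j mod m) \<in> carrier H"
    using ij by (simp add: uc vc)
  show "\<epsilon> (u (i div m) (j div m) \<otimes> v (i mod m) (j mod m)) = (if i = j then 1 else 0)"
    using ij eq by (simp add: uc vc \<epsilon>_simps)
  have "\<Delta> (u (i div m) (j div m) \<otimes> v (i mod m) (j mod m)) =
    (\<Oplus>\<^bsub>tensor H H\<^esub>a\<in>{..<n}. pure_tensor H H (u (i div m) a) (u a (j div m))) \<otimes>\<^bsub>tensor H H\<^esub>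
    (\<Oplus>\<^bsub>tensor H H\<^esub>b\<in>{..<m}. pure_tensor H H (v (i mod m) b) (v b (j mod m)))"
    using ij by (simp add: star_homD(3)[OF comult] uc vc)
  also have "\<dots> = (\<Oplus>\<^bsub>tensor H H\<^esub>a\<in>{..<n}. \<Oplus>\<^bsub>tensor H H\<^esub>b\<in>{..<m}.
      pure_tensor H H (u (i div m) a) (u a (j div m)) \<otimes>\<^bsub>tensor H H\<^esub> pure_tensor H H (v (i mod m) b) (v b (j mod m)))"
    by (rule T.finsum_mult_finsum) (use ij in \<open>simp_all add: uc vc HH.pure_closed\<close>)
  also have "\<dots> = (\<Oplus>\<^bsub>tensor H H\<^esub>k\<in>{..<n * m}.
      pure_tensor H H (u (i div m) (k div m)) (u (k div m) (j div m)) \<otimes>\<^bsub>tensor H H\<^esub>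
      pure_tensor H H (v (i mod m) (k mod m)) (v (k mod m) (j mod m)))"
    by (rule T.finsum_div_mod[OF m, symmetric]) (use ij in \<open>simp_all add: uc vc HH.pure_closed\<close>)
  also have "\<dots> = (\<Oplus>\<^bsub>tensor H H\<^esub>k\<in>{..<n * m}.
      pure_tensor H H (u (i div m) (k div m) \<otimes> v (i mod m) (k mod m)) (u (k div m) (j div m) \<otimes> v (k mod m) (j mod m)))"
    by (rule T.finsum_cong')
      (use ij m in \<open>simp_all add: uc vc HH.pure_closed HH.pure_mult less_mult_imp_div_less\<close>)
  finally show "\<Delta> (u (i div m) (j div m) \<otimes> v (i mod m) (j mod m)) = (\<Oplus>\<^bsub>tensor H H\<^esub>k\<in>{..<n * m}.
      pure_tensor H H (u (i div m) (k div m) \<otimes> v (i mod m) (k mod m)) (u (k div m) (j div m) \<otimes> v (k mod m) (j mod m)))" .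
  let ?U = "\<lambda>p q. u (p div m) (q div m) \<otimes> v (p mod m) (q mod m)"
  have "(\<Oplus>k\<in>{..<n * m}. ?U i k \<otimes> star H (?U j k)) =
    (\<Oplus>a\<in>{..<n}. \<Oplus>b\<in>{..<m}. u (i div m) a \<otimes> v (i mod m) b \<otimes> star H (u (j div m) a \<otimes> v (j mod m) b))"
    by (rule H.finsum_div_mod[OF m]) (use ij in \<open>simp_all add: uc vc\<close>)
  also have "\<dots> = (\<Oplus>a\<in>{..<n}. \<Oplus>b\<in>{..<m}. u (i div m) a \<otimes> v (i mod m) b \<otimes> (star H (v (j mod m) b) \<otimes> star H (u (j div m) a)))"
    using ij by (intro H.finsum_cong') (auto simp: uc vc H.star_mult intro!: H.finsum_cong')
  also have "\<dots> = (if i div m = j div m \<and> i mod m = j mod m then \<one> else \<zero>)"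
    by (rule H.nested_unitary_sum) (use ij in \<open>simp_all add: uc vc\<close>)
  also have "\<dots> = (if i = j then \<one> else \<zero>)" using eq by simp
  finally show "(\<Oplus>k\<in>{..<n * m}. ?U i k \<otimes> star H (?U j k)) = (if i = j then \<one> else \<zero>)" .
  have "(\<Oplus>k\<in>{..<n * m}. star H (?U k i) \<otimes> ?U k j) =
    (\<Oplus>a\<in>{..<n}. \<Oplus>b\<in>{..<m}. star H (u a (i div m) \<otimes> v b (i mod m)) \<otimes> (u a (j div m) \<otimes> v b (j mod m)))"
    by (rule H.finsum_div_mod[OF m]) (use ij in \<open>simp_all add: uc vc\<close>)
  \<comment> \<open>In U^* U the entries of u are the inner ones, v^* u^* u v, so their index a has
    to be summed first.\<close>
  also have "\<dots> = (\<Oplus>b\<in>{..<m}. \<Oplus>a\<in>{..<n}. star H (u a (i div m) \<otimes> v b (i mod m)) \<otimes> (u a (j div m) \<otimes> v b (j mod m)))"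
    by (rule H.finsum_swap) (use ij in \<open>simp_all add: uc vc\<close>)
  also have "\<dots> = (\<Oplus>b\<in>{..<m}. \<Oplus>a\<in>{..<n}. star H (v b (i mod m)) \<otimes> star H (u a (i div m)) \<otimes> (u a (j div m) \<otimes> v b (j mod m)))"
    using ij by (intro H.finsum_cong') (auto simp: uc vc H.star_mult intro!: H.finsum_cong')
  also have "\<dots> = (if i mod m = j mod m \<and> i div m = j div m then \<one> else \<zero>)"
    by (rule H.nested_unitary_sum) (use ij in \<open>simp_all add: uc vc\<close>)
  also have "\<dots> = (if i = j then \<one> else \<zero>)" using eq by auto
  finally show "(\<Oplus>k\<in>{..<n * m}. star H (?U k i) \<otimes> ?U k j) = (if i = j then \<one> else \<zero>)" .
qed

abbreviation "coeffs \<equiv> {u i j | u n i j. unitary_corep H n u \<and> i < n \<and> j < n}"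

lemma coeffs_subset: "coeffs \<subseteq> carrier H"
  by (auto simp: unitary_corep_def)

lemma coeffsI: "unitary_corep H n u \<Longrightarrow> i < n \<Longrightarrow> j < n \<Longrightarrow> u i j \<in> coeffs"
  by blast

lemma coeffs_mult:
  assumes "x \<in> coeffs" "y \<in> coeffs"
  shows "x \<otimes> y \<in> coeffs"
proof -
  obtain u n i j where u: "unitary_corep H n u" "i < n" "j < n" "x = u i j" using assms(1) by auto
  obtain v m k l where v: "unitary_corep H m v" "k < m" "l < m" "y = v k l" using assms(2) by auto
  have m: "0 < m" using v by simp
  have lt: "a * m + b < n * m" if "a < n" "b < m" for a b
  proof -
    have "a * m + b < (a + 1) * m" using that by simp
    also have "\<dots> \<le> n * m" using that by (intro mult_le_mono1) simp
    finally show ?thesis .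
  qed
  let ?U = "\<lambda>p q. u (p div m) (q div m) \<otimes> v (p mod m) (q mod m)"
  have "x \<otimes> y = ?U (i * m + k) (j * m + l)" using u v m by simp
  with coeffsI[OF unitary_corep_mult[OF u(1) v(1) m] lt[OF u(2) v(2)] lt[OF u(3) v(3)]]
  show ?thesis by (simp only:)
qed

lemma cqg_algebraI:
  assumes gen: "generates H G" and G: "\<And>x. x \<in> G \<Longrightarrow> corep_coeff x"
  shows "cqg_algebra H"
proof -
  note cl = lin_span_closed[OF alg coeffs_subset]
  note sp = lin_span_induct[OF alg coeffs_subset]
  have m1: "x \<otimes> y \<in> lin_span H coeffs" if "x \<in> coeffs" "y \<in> lin_span H coeffs" for x y
    using that(2)
  proof (rule sp)
    have x: "x \<in> carrier H" using that(1) coeffs_subset by (rule subsetD[rotated])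
    show "x \<otimes> y \<in> lin_span H coeffs" if "y \<in> coeffs" for y
      by (rule lin_span_base[OF coeffs_mult[OF \<open>x \<in> coeffs\<close> that]])
  qed (use coeffs_subset that(1) in \<open>simp_all only: subsetD cl H.r_distr H.smult_mult_r H.r_null\<close>)
  have m2: "x \<otimes> y \<in> lin_span H coeffs" if "x \<in> lin_span H coeffs" "y \<in> lin_span H coeffs" for x y
    using that(1)
  proof (rule sp)
    have y: "y \<in> carrier H" using that(2) lin_span_subset[OF alg coeffs_subset] by (rule subsetD[rotated])
    show "x \<otimes> y \<in> lin_span H coeffs" if "x \<in> coeffs" for x
      by (rule m1[OF that \<open>y \<in> lin_span H coeffs\<close>])
    show "\<zero> \<otimes> y \<in> lin_span H coeffs" using y by (simp only: H.l_null cl)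
  qed (use lin_span_subset[OF alg coeffs_subset] that(2) in \<open>simp_all only: subsetD cl H.l_distr H.smult_mult_l\<close>)
  have "x \<in> lin_span H coeffs" if "x \<in> carrier H" for x
    using alg gen that
  proof (induct rule: generates_induct)
    case (gen x)
    then show ?case using G[OF gen] by (intro lin_span_base) (auto simp: corep_coeff_def)
  next
    case one
    have "\<one> \<in> coeffs" using coeffsI[OF unitary_corep_one, of 0 0] by simp
    then show ?case by (rule lin_span_base)
  qed (simp_all add: cl m2)
  then have "carrier H = lin_span H coeffs" using lin_span_subset[OF alg coeffs_subset] by blast
  then show ?thesis using hopf_star_algebraI[OF assms] by (simp add: cqg_algebra_def)
qed

end

section \<open>Quotients by Hopf *-ideals\<close>

lemma extend_simps [simp]:
  "carrier (star_alg.extend A m) = carrier A"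
  "monoid.mult (star_alg.extend A m) = monoid.mult A"
  "monoid.one (star_alg.extend A m) = monoid.one A"
  "ring.zero (star_alg.extend A m) = ring.zero A"
  "ring.add (star_alg.extend A m) = ring.add A"
  "module.smult (star_alg.extend A m) = module.smult A"
  "star (star_alg.extend A m) = star A"
  by (simp_all add: star_alg.defs)

lemma extend_hopf_simps [simp]:
  "comult (star_alg.extend A (hopf_star_alg.fields c e s)) = c"
  "counit (star_alg.extend A (hopf_star_alg.fields c e s)) = e"
  "antipode (star_alg.extend A (hopf_star_alg.fields c e s)) = s"
  by (simp_all add: star_alg.defs hopf_star_alg.defs)

lemma staralg_extend:
  assumes "staralg A"
  shows "staralg (star_alg.extend A m)"
proof -
  interpret staralg A by fact
  have "\<exists>y\<in>carrier A. y \<oplus>\<^bsub>A\<^esub> x = \<zero>\<^bsub>A\<^esub>" if "x \<in> carrier A" for x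
    using that l_neg by blast
  then have "abelian_group (star_alg.extend A m)" by (intro abelian_groupI) (auto simp: a_ac)
  moreover have "monoid (star_alg.extend A m)" by (intro monoidI) (auto simp: m_assoc)
  ultimately have "ring (star_alg.extend A m)" by (intro ringI) (auto simp: l_distr r_distr)
  then interpret o: ring "star_alg.extend A m" .
  show ?thesis
    by unfold_locales
      (auto simp: smult_l_distr smult_r_distr smult_smult smult_mult_l smult_mult_r star_smult star_add star_mult)
qed

lemma star_hom_extend [simp]:
  "star_hom (star_alg.extend A m) B f \<longleftrightarrow> star_hom A B f"
  "star_hom B (star_alg.extend A m) g \<longleftrightarrow> star_hom B A g"
  "star_hom B (opposite (star_alg.extend A m)) g \<longleftrightarrow> star_hom B (opposite A) g"
  by (simp_all add: star_hom_def ring_hom_def)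

lemma DirProd_extend: "star_alg.extend A m \<times>\<times> star_alg.extend B n = A \<times>\<times> B"
  by (simp add: DirProd_def)

lemma tensor_extend [simp]: "tensor (star_alg.extend A m) (star_alg.extend B n) = tensor A B"
  by (simp add: tensor_def bilinear_span_def bilinear_relations_def pair_alg_def DirProd_extend)

lemma pure_tensor_extend [simp]: "pure_tensor (star_alg.extend A m) (star_alg.extend B n) = pure_tensor A B"
  by (intro ext) (simp add: pure_tensor_def bilinear_span_def bilinear_relations_def pair_alg_def DirProd_extend)

lemma tensor_map_extend [simp]: "tensor_map (star_alg.extend A m) (star_alg.extend B n) = tensor_map A B"
  by (intro ext) (simp add: tensor_map_def)

lemma generates_extend [simp]: "generates (star_alg.extend A m) G = generates A G"
proof -
  have "x \<in> gen_alg A G" if "x \<in> gen_alg (star_alg.extend A m) G" for x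
    using that by induct (auto intro: gen_alg.intros)
  moreover have "x \<in> gen_alg (star_alg.extend A m) G" if "x \<in> gen_alg A G" for x
    using that by induct (use gen_alg.intros[where A = "star_alg.extend A m"] in auto)
  ultimately show ?thesis by (auto simp: generates_def)
qed

lemma tensor_map_cong:
  assumes "staralg A" "staralg B" "staralg C" "staralg D"
    "lin_hom A C f" "lin_hom B D g" "lin_hom A C f'" "lin_hom B D g'"
    "\<And>a. a \<in> carrier A \<Longrightarrow> f a = f' a" "\<And>b. b \<in> carrier B \<Longrightarrow> g b = g' b" "x \<in> carrier (tensor A B)"
  shows "tensor_map C D f g x = tensor_map C D f' g' x"
  by (rule star_tensor.tensor_lin_eqI[OF star_tensorI[OF assms(1,2)] star_tensor.staralg_tensor[OF star_tensorI[OF assms(3,4)]]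
      tensor_map_lin[OF assms(1-6)] tensor_map_lin[OF assms(1-4,7,8)] _ assms(11)])
    (simp add: tensor_map_pure[OF assms(1-6)] tensor_map_pure[OF assms(1-4,7,8)] assms(9,10))

lemma tensor_map_comp:
  assumes "staralg A" "staralg B" "staralg C" "staralg D" "staralg E" "staralg F"
    "lin_hom A C f" "lin_hom B D g" "lin_hom C E h" "lin_hom D F k" "x \<in> carrier (tensor A B)"
  shows "tensor_map E F h k (tensor_map C D f g x) = tensor_map E F (\<lambda>a. h (f a)) (\<lambda>b. k (g b)) x"
  by (rule star_tensor.tensor_lin_eqI[OF star_tensorI[OF assms(1,2)] star_tensor.staralg_tensor[OF star_tensorI[OF assms(5,6)]]
      lin_hom_comp[OF tensor_map_lin[OF assms(1-4,7,8)] tensor_map_lin[OF assms(3-6,9,10)]]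
      tensor_map_lin[OF assms(1,2,5,6) lin_hom_comp[OF assms(7,9)] lin_hom_comp[OF assms(8,10)]] _ assms(11)])
    (simp add: tensor_map_pure[OF assms(1-4,7,8)] tensor_map_pure[OF assms(3-6,9,10)]
      tensor_map_pure[OF assms(1,2,5,6) lin_hom_comp[OF assms(7,9)] lin_hom_comp[OF assms(8,10)]]
      lin_homD[OF assms(7)] lin_homD[OF assms(8)])

text \<open>Each compatibility condition compares two *-homomorphisms. For the antipodes the common
  target is the opposite algebra, where \<open>f\<close> is a *-homomorphism as well.\<close>

lemma hopf_star_hom_on_generators:
  assumes A: "pre_hopf A" and B: "pre_hopf B" and f: "star_hom A B f" and gen: "generates A G"
    and com: "\<And>x. x \<in> G \<Longrightarrow> comult B (f x) = tensor_map B B f f (comult A x)"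
    and cou: "\<And>x. x \<in> G \<Longrightarrow> counit B (f x) = counit A x"
    and anti: "\<And>x. x \<in> G \<Longrightarrow> antipode B (f x) = f (antipode A x)"
  shows "hopf_star_hom A B f"
proof -
  interpret A: pre_hopf_alg A using A by (simp add: pre_hopf_alg_def)
  interpret B: pre_hopf_alg B using B by (simp add: pre_hopf_alg_def)
  have o: "star_hom (opposite A) (opposite B) f"
    using f by (auto simp: star_hom_def ring_hom_def)
  have "comult B (f x) = tensor_map B B f f (comult A x)" if "x \<in> carrier A" for x
    by (rule star_hom_eq_on_generators[OF A.alg gen star_hom_comp[OF f B.comult]
        star_hom_comp[OF A.comult tensor_map_star_hom[OF A.alg A.alg B.alg B.alg f f]] com that])
  moreover have "counit B (f x) = counit A x" if "x \<in> carrier A" for x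
    by (rule star_hom_eq_on_generators[OF A.alg gen star_hom_comp[OF f B.counit] A.counit cou that])
  moreover have "antipode B (f x) = f (antipode A x)" if "x \<in> carrier A" for x
    by (rule star_hom_eq_on_generators[OF A.alg gen star_hom_comp[OF f B.antipode] star_hom_comp[OF A.antipode o] anti that])
  ultimately show ?thesis using f by (simp add: hopf_star_hom_def)
qed

section \<open>Hopf *-ideals\<close>

context pre_hopf_alg begin

definition "coideal_set J = lin_span (tensor H H)
   ({pure_tensor H H a b | a b. a \<in> J \<and> b \<in> carrier H} \<union> {pure_tensor H H a b | a b. a \<in> carrier H \<and> b \<in> J})"

lemma coideal_base: "a \<in> J \<Longrightarrow> b \<in> carrier H \<Longrightarrow> pure_tensor H H a b \<in> coideal_set J"
  "a \<in> carrier H \<Longrightarrow> b \<in> J \<Longrightarrow> pure_tensor H H a b \<in> coideal_set J"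
  unfolding coideal_set_def by (rule lin_span_base; blast)+

text \<open>Because J \<otimes> H + H \<otimes> J is a *-ideal, the elements that \<Delta> maps into
  it form a *-ideal too; the coideal condition can then be checked on generators.\<close>

lemma star_ideal_coideal_set:
  assumes J: "star_ideal J H"
  shows "star_ideal (coideal_set J) (tensor H H)"
proof -
  note cl = star_ideal_closed[OF alg J]
  have Jc: "x \<in> carrier H" if "x \<in> J" for x using cl(1) that by auto
  let ?S = "{pure_tensor H H a b | a b. a \<in> J \<and> b \<in> carrier H} \<union> {pure_tensor H H a b | a b. a \<in> carrier H \<and> b \<in> J}"
  show ?thesis
    unfolding coideal_set_def
  proof (rule star_ideal_lin_span[OF HH.staralg_tensor _ HH.pures_subset HH.pures_span])
    show "?S \<subseteq> carrier (tensor H H)" using Jc by (auto simp: HH.pure_closed)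
  next
    fix s b assume s: "s \<in> ?S" and "b \<in> {pure_tensor H H a b |a b. a \<in> carrier H \<and> b \<in> carrier H}"
    then obtain x y where b: "b = pure_tensor H H x y" "x \<in> carrier H" "y \<in> carrier H" by blast
    from s obtain c d where s: "s = pure_tensor H H c d" and cd: "c \<in> J \<and> d \<in> carrier H \<or> c \<in> carrier H \<and> d \<in> J" by blast
    then have "c \<in> carrier H" "d \<in> carrier H" using Jc by auto
    with b s have e: "b \<otimes>\<^bsub>tensor H H\<^esub> s = pure_tensor H H (x \<otimes> c) (y \<otimes> d)" "s \<otimes>\<^bsub>tensor H H\<^esub> b = pure_tensor H H (c \<otimes> x) (d \<otimes> y)"
      by (simp_all add: HH.pure_mult)
    show "b \<otimes>\<^bsub>tensor H H\<^esub> s \<in> lin_span (tensor H H) ?S" "s \<otimes>\<^bsub>tensor H H\<^esub> b \<in> lin_span (tensor H H) ?S"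
      unfolding e using cd b coideal_base[where J = J, unfolded coideal_set_def]
      by (auto simp: cl(6,7))
  next
    fix s assume s: "s \<in> ?S"
    then obtain c d where s: "s = pure_tensor H H c d" and cd: "c \<in> J \<and> d \<in> carrier H \<or> c \<in> carrier H \<and> d \<in> J" by blast
    then have "c \<in> carrier H" "d \<in> carrier H" using Jc by auto
    with s have e: "star (tensor H H) s = pure_tensor H H (star H c) (star H d)"
      by (simp add: HH.pure_star)
    show "star (tensor H H) s \<in> lin_span (tensor H H) ?S"
      unfolding e using cd coideal_base[where J = J, unfolded coideal_set_def]
      by (auto simp: cl(8))
  qed
qed

text \<open>The elements satisfying all three conditions form a *-ideal, which contains
  \<open>J\<close> once it contains \<open>X\<close>. The assumption \<open>min\<close> expresses
  that \<open>X\<close> generates \<open>J\<close>; in this form it also suits an ideal given as a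
  span of products.\<close>

lemma hopf_star_idealI:
  assumes J: "star_ideal J H" and min: "\<And>I. star_ideal I H \<Longrightarrow> X \<subseteq> I \<Longrightarrow> J \<subseteq> I" and X: "X \<subseteq> carrier H"
    and com: "\<And>x. x \<in> X \<Longrightarrow> \<Delta> x \<in> coideal_set J" and cou: "\<And>x. x \<in> X \<Longrightarrow> \<epsilon> x = 0"
    and anti: "\<And>x. x \<in> X \<Longrightarrow> S x \<in> J"
  shows "hopf_star_ideal J H"
proof -
  note cl = star_ideal_closed[OF alg J]
  note clK = star_ideal_closed[OF HH.staralg_tensor star_ideal_coideal_set[OF J]]
  let ?W = "{x \<in> carrier H. \<Delta> x \<in> coideal_set J \<and> \<epsilon> x = 0 \<and> S x \<in> J}"
  have z: "\<epsilon> \<zero> = 0" "S \<zero> = \<zero>" "\<Delta> \<zero> = \<zero>\<^bsub>tensor H H\<^esub>"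
    using lin_hom_zero[OF alg staralg_complex star_hom_lin[OF counit]]
      lin_hom_zero[OF alg staralg_opposite[OF alg] star_hom_lin[OF antipode]]
      lin_hom_zero[OF alg HH.staralg_tensor star_hom_lin[OF comult]] by simp_all
  have "star_ideal ?W H"
    by (rule star_idealI[OF alg iffD2[OF submodule_iff[OF alg]]])
      (auto simp: z cl clK star_homD[OF comult] \<epsilon>_simps S_simps)
  from min[OF this] have "J \<subseteq> ?W" using X com cou anti by auto
  then show ?thesis using J unfolding hopf_star_ideal_def coideal_set_def by auto
qed

end

locale hopf_quotient = pre_hopf_alg H for H :: "('a, 'x) hopf_star_alg_scheme" (structure) +
  fixes J assumes hopf_ideal: "hopf_star_ideal J H"
begin

lemma star_ideal_J: "star_ideal J H" using hopf_ideal by (simp add: hopf_star_ideal_def)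

sublocale Q: star_quotient H J
  using alg star_ideal_J by (simp add: star_quotient_def star_quotient_axioms_def)

abbreviation "Q0 \<equiv> star_quot H J"
abbreviation "Q \<equiv> hopf_quot H J"

lemma quot_comult_hom: "star_hom H (tensor Q0 Q0) (\<lambda>x. tensor_map Q0 Q0 Q.q Q.q (\<Delta> x))"
  by (rule star_hom_comp[OF comult tensor_map_star_hom[OF alg alg Q.staralg_quot Q.staralg_quot Q.star_hom_quot Q.star_hom_quot]])

text \<open>By the coideal condition \<Delta> x lies in J \<otimes> H + H \<otimes> J, and the
  quotient map applied in both legs makes one leg vanish.\<close>

lemma quot_comult_kills:
  assumes "x \<in> J"
  shows "tensor_map Q0 Q0 Q.q Q.q (\<Delta> x) = \<zero>\<^bsub>tensor Q0 Q0\<^esub>"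
proof -
  interpret QQ: star_tensor Q0 Q0 by (rule star_tensorI[OF Q.staralg_quot Q.staralg_quot])
  interpret Q0: staralg Q0 by (rule Q.staralg_quot)
  note ql = star_hom_lin[OF Q.star_hom_quot]
  note tl = tensor_map_lin[OF alg alg Q.staralg_quot Q.staralg_quot ql ql]
  have Jc: "x \<in> carrier H" if "x \<in> J" for x using star_ideal_closed(1)[OF alg star_ideal_J] that by auto
  have "{pure_tensor H H a b | a b. a \<in> J \<and> b \<in> carrier H} \<union> {pure_tensor H H a b | a b. a \<in> carrier H \<and> b \<in> J} \<subseteq>
      {t \<in> carrier (tensor H H). tensor_map Q0 Q0 Q.q Q.q t = \<zero>\<^bsub>tensor Q0 Q0\<^esub>}"
    by (auto simp: Jc HH.pure_closed tensor_map_pure[OF alg alg Q.staralg_quot Q.staralg_quot ql ql]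
        Q.quot_eq_zero[THEN iffD2, OF Jc] QQ.pure_zero_l QQ.pure_zero_r Q.quot_closed)
  from lin_span_minimal[OF submodule_kernel[OF HH.staralg_tensor QQ.staralg_tensor tl] this]
  show ?thesis using hopf_ideal assms by (auto simp: hopf_star_ideal_def)
qed

lemma quot_comult: "a \<in> carrier H \<Longrightarrow> comult Q (Q.q a) = tensor_map Q0 Q0 Q.q Q.q (\<Delta> a)"
  unfolding hopf_quot_def
  using Q.quot_lift[OF star_tensor.staralg_tensor[OF star_tensorI[OF Q.staralg_quot Q.staralg_quot]]
      star_hom_lin[OF quot_comult_hom] quot_comult_kills] by simp

lemma quot_counit: "a \<in> carrier H \<Longrightarrow> counit Q (Q.q a) = \<epsilon> a"
  unfolding hopf_quot_def
  using Q.quot_lift[OF staralg_complex star_hom_lin[OF counit]] hopf_ideal by (simp add: hopf_star_ideal_def)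

lemma quot_antipode:
  assumes a: "a \<in> carrier H"
  shows "antipode Q (Q.q a) = Q.q (S a)"
proof -
  have "Q.q (S x) = Q.q (S a)" if "x \<in> carrier H" "Q.q x = Q.q a" for x
  proof -
    have "x \<ominus> a \<in> J" using that a by (simp add: Q.quot_eq_iff)
    then have "S (x \<ominus> a) \<in> J" using hopf_ideal by (simp add: hopf_star_ideal_def)
    moreover have "S (x \<ominus> a) = S x \<ominus> S a"
      using lin_hom_minus[OF alg staralg_opposite[OF alg] star_hom_lin[OF antipode] that(1) a] by simp
    ultimately show ?thesis using that a by (simp add: Q.quot_eq_iff S_simps)
  qed
  then have "(\<Union>x\<in>Q.q a. Q.q (S x)) = Q.q (S a)" by (rule Q.UN_coset[OF a])
  then show ?thesis by (simp add: hopf_quot_def)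
qed

lemma quot_comult_star_hom: "star_hom Q0 (tensor Q0 Q0) (comult Q)"
  unfolding hopf_quot_def extend_hopf_simps
  by (rule Q.quot_lift_hom[OF star_tensor.staralg_tensor[OF star_tensorI[OF Q.staralg_quot Q.staralg_quot]]
      quot_comult_hom quot_comult_kills])

lemma quot_counit_star_hom: "star_hom Q0 complex_alg (counit Q)"
  unfolding hopf_quot_def extend_hopf_simps
  by (rule Q.quot_lift_hom[OF staralg_complex counit]) (use hopf_ideal in \<open>simp add: hopf_star_ideal_def\<close>)

lemma quot_antipode_star_hom: "star_hom Q0 (opposite Q0) (antipode Q)"
  by (rule star_homI)
    (auto simp: Q.quot_carrier Q.quot_add Q.quot_mult Q.quot_one Q.quot_smult Q.quot_star quot_antipode S_simps)

lemma pre_hopf_quot: "pre_hopf Q"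
  using quot_comult_star_hom quot_counit_star_hom quot_antipode_star_hom
  by (simp add: pre_hopf_def hopf_quot_def staralg_extend[OF Q.staralg_quot])

lemma hopf_star_hom_quot: "hopf_star_hom H Q Q.q"
  unfolding hopf_star_hom_def
  using Q.star_hom_quot by (auto simp: quot_comult quot_counit quot_antipode) (simp_all add: hopf_quot_def)

lemma carrier_Q: "carrier Q = Q.q ` carrier H"
  by (simp add: hopf_quot_def Q.quot_carrier)

lemma quot_lift_hopf:
  assumes K: "pre_hopf K" and p: "hopf_star_hom H K p" and kills: "\<And>x. x \<in> J \<Longrightarrow> p x = \<zero>\<^bsub>K\<^esub>"
  shows "hopf_star_hom Q K (\<lambda>X. the_elem (p ` X))"
proof -
  interpret K: pre_hopf_alg K using K by (simp add: pre_hopf_alg_def)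
  have ps: "star_hom H K p" using p by (simp add: hopf_star_hom_def)
  let ?t = "\<lambda>X. the_elem (p ` X)"
  have t: "?t (Q.q a) = p a" if "a \<in> carrier H" for a
    by (rule Q.quot_lift[OF K.alg star_hom_lin[OF ps] kills that])
  have th: "star_hom Q0 K ?t" by (rule Q.quot_lift_hom[OF K.alg ps kills])
  note tl = star_hom_lin[OF th] and ql = star_hom_lin[OF Q.star_hom_quot] and pl = star_hom_lin[OF ps]
  \<comment> \<open>With p = t q, functoriality gives p \<otimes> p = (t \<otimes> t)(q \<otimes>
    q), and (q \<otimes> q) \<Delta> is the comultiplication of the quotient.\<close>
  have c: "comult K (p a) = tensor_map K K ?t ?t (comult Q (Q.q a))" if a: "a \<in> carrier H" for a
  proof -
    have d: "\<Delta> a \<in> carrier (tensor H H)" using star_homD(1)[OF comult a] .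
    have "comult K (p a) = tensor_map K K p p (\<Delta> a)" using p a by (simp add: hopf_star_hom_def)
    also have "\<dots> = tensor_map K K (\<lambda>x. ?t (Q.q x)) (\<lambda>x. ?t (Q.q x)) (\<Delta> a)"
      by (rule tensor_map_cong[OF alg alg K.alg K.alg pl pl lin_hom_comp[OF ql tl] lin_hom_comp[OF ql tl] _ _ d])
        (simp_all add: t)
    also have "\<dots> = tensor_map K K ?t ?t (tensor_map Q0 Q0 Q.q Q.q (\<Delta> a))"
      by (rule tensor_map_comp[OF alg alg Q.staralg_quot Q.staralg_quot K.alg K.alg ql ql tl tl d, symmetric])
    finally show ?thesis by (simp add: quot_comult a)
  qed
  have "star_hom Q K ?t" using th by (simp add: hopf_quot_def)
  then show ?thesis
    using p by (auto simp: hopf_star_hom_def carrier_Q t c quot_counit quot_antipode S_simps)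
qed

end

section \<open>Group algebras and presented algebras\<close>

lemma lin_ext_opposite [simp]: "lin_ext (opposite A) = lin_ext A"
  by (intro ext) (simp add: lin_ext_def)

lemma (in star_monoid) MA_generates:
  "generates MA {Poly_Mapping.single x 1 | x. x \<in> carrier M}"
proof -
  interpret R: staralg MA by (rule staralg_MA)
  let ?G = "{Poly_Mapping.single x (1::complex) | x. x \<in> carrier M}"
  have "p \<in> gen_alg MA ?G" if "p \<in> carrier MA" for p
    using that
  proof (induct rule: MA_induct)
    case zero
    show ?case using gen_alg.smult[OF gen_alg.one, where c = 0 and A = MA and G = ?G] by (simp add: MA_zero)
  next
    case (add x c p)
    have "Poly_Mapping.single x c \<in> gen_alg MA ?G"
      using gen_alg.smult[OF gen_alg.gen, where x = "Poly_Mapping.single x 1" and G = ?G and A = MA and c = c] add(1) by (auto simp: MA_smult_single)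
    from gen_alg.add[OF this add(3)] show ?case by (simp add: MA_add)
  qed
  then show ?thesis using MA_singles by (auto simp: generates_def)
qed

text \<open>A sublocale of \<^locale>\<open>group\<close> itself would also be inherited by the additive groups of all rings.\<close>

locale group_algebra = group
begin

sublocale GA: star_monoid G "m_inv G"
  by unfold_locales (auto simp: inv_mult_group)

lemma group_elt_closed: "g \<in> carrier G \<Longrightarrow> group_elt g \<in> carrier GA.MA"
  by (simp add: group_elt_def GA.MA_closed)

lemma group_elt_mult: "group_elt g \<otimes>\<^bsub>GA.MA\<^esub> group_elt h = group_elt (g \<otimes> h)"
  by (simp add: group_elt_def GA.MA_simps)

lemma group_elt_one: "\<one>\<^bsub>GA.MA\<^esub> = group_elt \<one>"
  by (simp add: group_elt_def GA.MA_one)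

lemma group_elt_star: "star GA.MA (group_elt g) = group_elt (inv g)"
  by (simp add: group_elt_def GA.MA_simps)

lemma lin_ext_group_elt:
  "staralg B \<Longrightarrow> (\<And>g. g \<in> carrier G \<Longrightarrow> f g \<in> carrier B) \<Longrightarrow> g \<in> carrier G \<Longrightarrow> lin_ext B f (group_elt g) = f g"
  by (simp add: group_elt_def GA.lin_ext_single[where f = f] staralg.smult_one)

lemma pre_hopf_dual_group: "pre_hopf (dual_group G)"
proof -
  interpret R: staralg GA.MA by (rule GA.staralg_MA)
  interpret T: star_tensor GA.MA GA.MA by (rule star_tensorI[OF GA.staralg_MA GA.staralg_MA])
  have "star_hom GA.MA (tensor GA.MA GA.MA) (lin_ext (tensor GA.MA GA.MA) (\<lambda>g. pure_tensor GA.MA GA.MA (group_elt g) (group_elt g)))"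
    by (rule GA.lin_ext_star_hom[OF T.staralg_tensor])
      (simp_all add: T.pure_closed T.pure_mult T.pure_star group_elt_closed group_elt_mult group_elt_star T.tensor_one group_elt_one)
  moreover have "star_hom GA.MA complex_alg (lin_ext complex_alg (\<lambda>g. 1))"
    by (rule GA.lin_ext_star_hom[OF staralg_complex]) simp_all
  moreover have "star_hom GA.MA (opposite GA.MA) (lin_ext (opposite GA.MA) (\<lambda>g. group_elt (inv g)))"
    by (rule GA.lin_ext_star_hom[OF staralg_opposite[OF GA.staralg_MA]])
      (simp_all add: group_elt_closed group_elt_mult group_elt_star group_elt_one inv_mult_group)
  ultimately show ?thesis
    by (simp add: pre_hopf_def dual_group_def Let_def staralg_extend[OF GA.staralg_MA])
qed

lemma dual_group_simps:
  "carrier (dual_group G) = carrier GA.MA"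
  "monoid.mult (dual_group G) = monoid.mult GA.MA"
  "monoid.one (dual_group G) = monoid.one GA.MA"
  "ring.zero (dual_group G) = ring.zero GA.MA"
  "ring.add (dual_group G) = ring.add GA.MA"
  "module.smult (dual_group G) = module.smult GA.MA"
  "star (dual_group G) = star GA.MA"
  "tensor (dual_group G) (dual_group G) = tensor GA.MA GA.MA"
  "pure_tensor (dual_group G) (dual_group G) = pure_tensor GA.MA GA.MA"
  "star_hom (dual_group G) B f = star_hom GA.MA B f"
  "generates (dual_group G) X = generates GA.MA X"
  by (simp_all add: dual_group_def Let_def)

lemma dual_group_elt:
  assumes g: "g \<in> carrier G"
  shows "comult (dual_group G) (group_elt g) = pure_tensor GA.MA GA.MA (group_elt g) (group_elt g)"
    "counit (dual_group G) (group_elt g) = 1"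
    "antipode (dual_group G) (group_elt g) = group_elt (inv g)"
proof -
  interpret T: star_tensor GA.MA GA.MA by (rule star_tensorI[OF GA.staralg_MA GA.staralg_MA])
  show "comult (dual_group G) (group_elt g) = pure_tensor GA.MA GA.MA (group_elt g) (group_elt g)"
    "counit (dual_group G) (group_elt g) = 1"
    "antipode (dual_group G) (group_elt g) = group_elt (inv g)"
    using g by (simp_all add: dual_group_def Let_def lin_ext_group_elt T.staralg_tensor T.pure_closed
        group_elt_closed staralg_complex GA.staralg_MA)
qed

lemma dual_group_generates: "generates (dual_group G) (group_elt ` carrier G)"
proof -
  have "group_elt ` carrier G = {Poly_Mapping.single x 1 | x. x \<in> carrier G}" by (auto simp: group_elt_def)
  then show ?thesis using GA.MA_generates by (simp add: dual_group_simps)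
qed

text \<open>Each group element is a one-dimensional unitary corepresentation, with S(g) = g^-1 =
  g^*.\<close>

lemma hopf_dual_group: "hopf_star_algebra (dual_group G)"
proof -
  interpret D: pre_hopf_alg "dual_group G" using pre_hopf_dual_group by (simp add: pre_hopf_alg_def)
  show ?thesis
  proof (rule D.hopf_star_algebraI[OF dual_group_generates])
    fix x assume "x \<in> group_elt ` carrier G"
    then obtain g where g: "g \<in> carrier G" and x: "x = group_elt g" by auto
    have "unitary_corep (dual_group G) 1 (\<lambda>_ _. group_elt g)"
      using g by (intro D.unitary_corep_grouplike)
        (simp_all add: dual_group_elt dual_group_simps group_elt_closed group_elt_star group_elt_mult group_elt_one)
    then show "D.corep_coeff x"
      unfolding D.corep_coeff_def x using g
      by (intro exI[of _ 1] exI[of _ "\<lambda>_ _. group_elt g"] exI[of _ 0])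
         (simp add: dual_group_elt dual_group_simps group_elt_star)
  qed
qed

end

section \<open>Free and presented *-algebras\<close>

lemma word_monoid_simps:
  "carrier (word_monoid X) = lists (X \<times> UNIV)" "v \<otimes>\<^bsub>word_monoid X\<^esub> w = v @ w" "\<one>\<^bsub>word_monoid X\<^esub> = []"
  by (simp_all add: word_monoid_def)

lemma star_monoid_word: "star_monoid (word_monoid X) word_star"
proof -
  have 1: "word_star (word_star w) = w" for w :: "('a \<times> bool) list"
  proof -
    have "apsnd Not \<circ> apsnd Not = (id :: 'a \<times> bool \<Rightarrow> _)" by auto
    then show ?thesis by (simp add: word_star_def rev_map)
  qed
  have "monoid (word_monoid X)" by (rule monoidI) (auto simp: word_monoid_simps)
  then interpret monoid "word_monoid X" .
  show ?thesis
    by unfold_locales (auto simp: word_monoid_simps 1, auto simp: word_star_def lists_eq_set)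
qed

interpretation W: star_monoid "word_monoid X" word_star for X
  by (rule star_monoid_word)

lemma free_star_alg_eq: "free_star_alg X = W.MA X"
  by (simp add: free_star_alg_def)

lemma staralg_free: "staralg (free_star_alg X)"
  unfolding free_star_alg_eq by (rule W.staralg_MA)

lemma free_gen_closed: "x \<in> X \<Longrightarrow> free_gen x \<in> carrier (free_star_alg X)"
  by (simp add: free_star_alg_eq free_gen_def W.MA_closed word_monoid_simps)

text \<open>Both kinds of letters are needed as generators, the letter \<open>(x, True)\<close>
  being the adjoint of \<open>(x, False)\<close>.\<close>

lemma free_generates:
  "generates (free_star_alg X) (free_gen ` X \<union> star (free_star_alg X) ` free_gen ` X)"
proof -
  let ?F = "free_star_alg X" and ?G = "free_gen ` X \<union> star (free_star_alg X) ` free_gen ` X"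
  interpret F: staralg ?F by (rule staralg_free)
  have l: "Poly_Mapping.single [(x, s)] 1 \<in> ?G" if "x \<in> X" for x s
    using that by (cases s) (auto simp: free_gen_def free_star_alg_eq W.MA_simps word_star_def image_iff)
  have w: "Poly_Mapping.single w 1 \<in> gen_alg ?F ?G" if "w \<in> lists (X \<times> UNIV)" for w
    using that
  proof (induct w)
    case Nil
    then show ?case using gen_alg.one[of ?F ?G] by (simp add: free_star_alg_eq W.MA_one word_monoid_simps)
  next
    case (Cons y w)
    obtain x s where y: "y = (x, s)" "x \<in> X" using Cons by auto
    from gen_alg.mult[OF gen_alg.gen[OF l[OF y(2)]] Cons(3), of s]
    show ?case by (simp add: free_star_alg_eq W.MA_simps word_monoid_simps y)
  qed
  have "p \<in> gen_alg ?F ?G" if "p \<in> carrier ?F" for p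
    using staralg_free W.MA_generates[of X, folded free_star_alg_eq] that
    by (induct rule: generates_induct) (auto simp: word_monoid_simps intro: w gen_alg.intros)
  moreover have "?G \<subseteq> carrier ?F" by (auto intro: free_gen_closed)
  ultimately show ?thesis by (auto simp: generates_def)
qed

text \<open>Evaluating a word letter by letter is multiplicative under concatenation and carries
  \<open>word_star\<close> to the star of \<open>B\<close>; its linear extension is then a
  *-homomorphism.\<close>

lemma free_ext:
  assumes B: "staralg B" and f: "\<And>x. x \<in> X \<Longrightarrow> f x \<in> carrier B"
  shows "star_hom (free_star_alg X) B (free_ext B f)"
    "x \<in> X \<Longrightarrow> free_ext B f (free_gen x) = f x"
proof -
  interpret B: staralg B by (rule B)
  let ?F = "\<lambda>w. foldr (\<lambda>(x, s) b. (if s then star B (f x) else f x) \<otimes>\<^bsub>B\<^esub> b) w \<one>\<^bsub>B\<^esub>"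
  have cl: "?F w \<in> carrier B" if "w \<in> lists (X \<times> UNIV)" for w
    using that by (induct w) (auto simp: f)
  have ap: "?F (v @ w) = ?F v \<otimes>\<^bsub>B\<^esub> ?F w" if "v \<in> lists (X \<times> UNIV)" "w \<in> lists (X \<times> UNIV)" for v w
    using that(1)
  proof (induct v)
    case (Cons y v)
    then show ?case using cl[of v] cl[OF that(2)] by (auto simp: f B.m_assoc)
  qed (simp add: cl[OF that(2)] del: foldr_append)
  have st: "?F (word_star w) = star B (?F w)" if "w \<in> lists (X \<times> UNIV)" for w
    using that
  proof (induct w)
    case (Cons y w)
    obtain x s where y: "y = (x, s)" "x \<in> X" using Cons by auto
    \<comment> \<open>Reversal moves the first letter to the end with its mark flipped, which
      matches (x b)^* = b^* x^* in \<open>B\<close>.\<close>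
    have "word_star (y # w) = word_star w @ [(x, \<not> s)]" by (simp add: word_star_def y)
    moreover have "word_star w \<in> lists (X \<times> UNIV)"
      using Cons by (auto simp: word_star_def lists_eq_set)
    ultimately have "?F (word_star (y # w)) = ?F (word_star w) \<otimes>\<^bsub>B\<^esub> ?F [(x, \<not> s)]"
      using ap[of "word_star w" "[(x, \<not> s)]"] y by simp
    then show ?case using Cons y cl[of w] by (auto simp: f B.star_mult)
  qed (simp add: word_star_def)
  show "star_hom (free_star_alg X) B (free_ext B f)"
    unfolding free_star_alg_eq free_ext_def
    by (rule W.lin_ext_star_hom[OF B])
      (use cl ap st in \<open>simp_all add: word_monoid_simps del: foldr_append\<close>)
  show "x \<in> X \<Longrightarrow> free_ext B f (free_gen x) = f x"
    unfolding free_ext_def free_gen_def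
    by (subst W.lin_ext_single[OF B, where X = X]) (use cl in \<open>simp_all add: word_monoid_simps f\<close>)
qed

locale presentation =
  fixes X :: "'x set" and R :: "(('x \<times> bool) list \<Rightarrow>\<^sub>0 complex) set"
  assumes R: "R \<subseteq> carrier (free_star_alg X)"
begin

sublocale PQ: star_quotient "free_star_alg X" "relation_ideal X R"
  using staralg_free star_ideal_gen_ideal[OF staralg_free R]
  by (simp add: star_quotient_def star_quotient_axioms_def relation_ideal_def)

lemma presented_eq: "presented_alg X R = star_quot (free_star_alg X) (relation_ideal X R)"
  by (simp add: presented_alg_def)

lemma staralg_presented: "staralg (presented_alg X R)"
  unfolding presented_eq by (rule PQ.staralg_quot)

lemma presented_relation: "r \<in> R \<Longrightarrow> PQ.q r = \<zero>\<^bsub>presented_alg X R\<^esub>"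
  unfolding presented_eq using R
  by (subst PQ.quot_eq_zero) (auto simp: relation_ideal_def star_ideal_gen_base)

lemma presented_generates:
  "generates (presented_alg X R) (presented_gen X R ` X \<union> star (presented_alg X R) ` presented_gen X R ` X)"
proof -
  have "generates (presented_alg X R) (PQ.q ` (free_gen ` X \<union> star (free_star_alg X) ` free_gen ` X))"
    by (rule generates_image[OF staralg_free staralg_presented free_generates])
      (auto simp: presented_eq PQ.star_hom_quot PQ.quot_carrier)
  moreover have "PQ.q ` (free_gen ` X \<union> star (free_star_alg X) ` free_gen ` X) =
      presented_gen X R ` X \<union> star (presented_alg X R) ` presented_gen X R ` X"
    by (force simp: image_Un image_image presented_gen_def presented_eq PQ.quot_star free_gen_closed)
  ultimately show ?thesis by simp
qed

text \<open>The kernel of the homomorphism on the free *-algebra is a *-ideal containing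
  \<open>R\<close>, hence contains the whole relation ideal.\<close>

lemma presented_ext:
  assumes B: "staralg B" and f: "\<And>x. x \<in> X \<Longrightarrow> f x \<in> carrier B"
    and kills: "\<And>r. r \<in> R \<Longrightarrow> free_ext B f r = \<zero>\<^bsub>B\<^esub>"
  shows "star_hom (presented_alg X R) B (presented_ext B f)"
    "x \<in> X \<Longrightarrow> presented_ext B f (presented_gen X R x) = f x"
proof -
  note h = free_ext(1)[where X = X, OF B f]
  have k: "free_ext B f r = \<zero>\<^bsub>B\<^esub>" if "r \<in> relation_ideal X R" for r
  proof -
    have "relation_ideal X R \<subseteq> {r \<in> carrier (free_star_alg X). free_ext B f r = \<zero>\<^bsub>B\<^esub>}"
      unfolding relation_ideal_def
      by (rule star_ideal_gen_minimal[OF star_ideal_kernel[OF staralg_free B h]]) (use R kills in auto)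
    then show ?thesis using that by auto
  qed
  show "star_hom (presented_alg X R) B (presented_ext B f)"
    unfolding presented_eq presented_ext_def[abs_def]
    by (rule PQ.quot_lift_hom[OF B h k])
  show "x \<in> X \<Longrightarrow> presented_ext B f (presented_gen X R x) = f x"
    unfolding presented_gen_def presented_ext_def
    by (subst PQ.quot_lift[OF B star_hom_lin[OF h] k]) (simp_all add: free_gen_closed free_ext(2)[where X = X, OF B f])
qed

end

section \<open>The relations of the quantum reflection groups\<close>

text \<open>Keeps the index set \<open>{1..N}\<close> from being rewritten to \<open>{Suc 0..N}\<close>.\<close>

declare One_nat_def [simp del] atLeastAtMost_iff [simp del]

lemma (in staralg) minus_eq_zero_iff: "x \<in> carrier A \<Longrightarrow> y \<in> carrier A \<Longrightarrow> x \<ominus> y = \<zero> \<longleftrightarrow> x = y"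
  by (metis add.inv_closed add.inv_solve_right' l_zero minus_eq minus_equality minus_minus r_neg zero_closed)

lemma (in staralg) finsum_if_zero:
  assumes "finite I" "\<And>i. i \<in> I \<Longrightarrow> f i \<in> carrier A"
  shows "(\<Oplus>i\<in>I. if P then f i else \<zero>) = (if P then (\<Oplus>i\<in>I. f i) else \<zero>)"
  using assms by simp

lemma generates_mono: "generates A G \<Longrightarrow> G \<subseteq> G' \<Longrightarrow> G' \<subseteq> carrier A \<Longrightarrow> generates A G'"
proof -
  assume "generates A G" "G \<subseteq> G'" "G' \<subseteq> carrier A"
  moreover have "x \<in> gen_alg A G'" if "x \<in> gen_alg A G" for x
    using that by induct (use \<open>G \<subseteq> G'\<close> in \<open>auto intro: gen_alg.intros\<close>)
  ultimately show "generates A G'" by (auto simp: generates_def)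
qed

lemma star_ideal_finsum:
  assumes A: "staralg A" and I: "star_ideal I A" and "finite K" "\<And>k. k \<in> K \<Longrightarrow> f k \<in> I"
  shows "(\<Oplus>\<^bsub>A\<^esub>k\<in>K. f k) \<in> I"
proof -
  interpret staralg A by (rule A)
  note cl = star_ideal_closed[OF A I]
  show ?thesis using assms(3,4)
  proof (induct set: finite)
    case (insert x F)
    then have "f x \<in> carrier A" "f \<in> F \<rightarrow> carrier A" using cl(1) by auto
    with insert show ?case by (simp add: cl)
  qed (simp add: cl)
qed

text \<open>Common core of the row and the column relations for \<Delta>. Orthogonality in one leg
  removes the terms with m different from l; the other leg then yields \<open>Q\<close>, the
  Kronecker condition on the outer indices.\<close>

lemma (in star_tensor) pure_sum_mult:
  assumes I: "finite I" and c: "\<And>l. l \<in> I \<Longrightarrow> x l \<in> carrier A \<and> y l \<in> carrier B \<and> z l \<in> carrier A \<and> w l \<in> carrier B"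
    and t: "\<And>l. l \<in> I \<Longrightarrow> t l \<in> carrier (tensor A B)"
    and eq: "\<And>l m. l \<in> I \<Longrightarrow> m \<in> I \<Longrightarrow>
      pure_tensor A B (x l \<otimes>\<^bsub>A\<^esub> z m) (y l \<otimes>\<^bsub>B\<^esub> w m) = (if m = l then if Q then t l else \<zero>\<^bsub>tensor A B\<^esub> else \<zero>\<^bsub>tensor A B\<^esub>)"
  shows "(\<Oplus>\<^bsub>tensor A B\<^esub>l\<in>I. pure_tensor A B (x l) (y l)) \<otimes>\<^bsub>tensor A B\<^esub> (\<Oplus>\<^bsub>tensor A B\<^esub>m\<in>I. pure_tensor A B (z m) (w m)) =
    (if Q then (\<Oplus>\<^bsub>tensor A B\<^esub>l\<in>I. t l) else \<zero>\<^bsub>tensor A B\<^esub>)" (is "?L = _")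
proof -
  interpret T: staralg "tensor A B" by (rule staralg_tensor)
  have "?L = (\<Oplus>\<^bsub>tensor A B\<^esub>l\<in>I. \<Oplus>\<^bsub>tensor A B\<^esub>m\<in>I. pure_tensor A B (x l) (y l) \<otimes>\<^bsub>tensor A B\<^esub> pure_tensor A B (z m) (w m))"
    by (rule T.finsum_mult_finsum) (use I c in \<open>auto simp: pure_closed\<close>)
  also have "\<dots> = (\<Oplus>\<^bsub>tensor A B\<^esub>l\<in>I. if Q then t l else \<zero>\<^bsub>tensor A B\<^esub>)"
  proof (rule T.finsum_cong')
    fix l assume l: "l \<in> I"
    have "(\<Oplus>\<^bsub>tensor A B\<^esub>m\<in>I. pure_tensor A B (x l) (y l) \<otimes>\<^bsub>tensor A B\<^esub> pure_tensor A B (z m) (w m)) =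
      (\<Oplus>\<^bsub>tensor A B\<^esub>m\<in>I. if m = l then if Q then t l else \<zero>\<^bsub>tensor A B\<^esub> else \<zero>\<^bsub>tensor A B\<^esub>)"
      by (rule T.finsum_cong') (use l c t in \<open>simp_all add: pure_mult eq\<close>)
    also have "\<dots> = (if Q then t l else \<zero>\<^bsub>tensor A B\<^esub>)"
      by (rule T.finsum_delta[where f = "\<lambda>_. if Q then t l else \<zero>\<^bsub>tensor A B\<^esub>"]) (use I l t in auto)
    finally show "(\<Oplus>\<^bsub>tensor A B\<^esub>m\<in>I. pure_tensor A B (x l) (y l) \<otimes>\<^bsub>tensor A B\<^esub> pure_tensor A B (z m) (w m)) = \<dots>" .
  qed (use t in auto)
  also have "\<dots> = (if Q then (\<Oplus>\<^bsub>tensor A B\<^esub>l\<in>I. t l) else \<zero>\<^bsub>tensor A B\<^esub>)"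
    by (rule T.finsum_if_zero) (use I t in auto)
  finally show ?thesis .
qed

locale hyp_family =
  G: group G + B: staralg B
  for N :: nat and G :: "('g, 'x) monoid_scheme" and B :: "('b, 'y) star_alg_scheme" (structure)
    and a :: "nat \<Rightarrow> nat \<Rightarrow> 'g \<Rightarrow> 'b" +
  assumes fam_closed [simp]: "i \<in> {1..N} \<Longrightarrow> j \<in> {1..N} \<Longrightarrow> g \<in> carrier G \<Longrightarrow> a i j g \<in> carrier B"
    and fam_star: "i \<in> {1..N} \<Longrightarrow> j \<in> {1..N} \<Longrightarrow> g \<in> carrier G \<Longrightarrow> star B (a i j g) = a i j (inv\<^bsub>G\<^esub> g)"
    and fam_row: "i \<in> {1..N} \<Longrightarrow> j \<in> {1..N} \<Longrightarrow> k \<in> {1..N} \<Longrightarrow> g \<in> carrier G \<Longrightarrow> h \<in> carrier G \<Longrightarrow>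
      a i j g \<otimes> a i k h = (if j = k then a i j (g \<otimes>\<^bsub>G\<^esub> h) else \<zero>)"
    and fam_col: "i \<in> {1..N} \<Longrightarrow> j \<in> {1..N} \<Longrightarrow> k \<in> {1..N} \<Longrightarrow> g \<in> carrier G \<Longrightarrow> h \<in> carrier G \<Longrightarrow>
      a j i g \<otimes> a k i h = (if j = k then a j i (g \<otimes>\<^bsub>G\<^esub> h) else \<zero>)"
    and fam_rsum: "i \<in> {1..N} \<Longrightarrow> (\<Oplus>k\<in>{1..N}. a i k \<one>\<^bsub>G\<^esub>) = \<one>"
    and fam_csum: "j \<in> {1..N} \<Longrightarrow> (\<Oplus>k\<in>{1..N}. a k j \<one>\<^bsub>G\<^esub>) = \<one>"
begin

definition "rs i g = (\<Oplus>k\<in>{1..N}. a i k g)"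
definition "cs j g = (\<Oplus>k\<in>{1..N}. a k j g)"

lemma rs_closed [simp]: "i \<in> {1..N} \<Longrightarrow> g \<in> carrier G \<Longrightarrow> rs i g \<in> carrier B"
  unfolding rs_def by (rule B.finsum_closed) auto

lemma cs_closed [simp]: "i \<in> {1..N} \<Longrightarrow> g \<in> carrier G \<Longrightarrow> cs i g \<in> carrier B"
  unfolding cs_def by (rule B.finsum_closed) auto

lemma rs_one: "i \<in> {1..N} \<Longrightarrow> rs i \<one>\<^bsub>G\<^esub> = \<one>"
  unfolding rs_def by (rule fam_rsum)

lemma rs_star: "i \<in> {1..N} \<Longrightarrow> g \<in> carrier G \<Longrightarrow> star B (rs i g) = rs i (inv\<^bsub>G\<^esub> g)"
  unfolding rs_def by (subst B.star_finsum) (auto simp: fam_star intro!: B.finsum_cong')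

text \<open>Row orthogonality keeps only the summand k = j. The row sum and the generator must
  belong to the same row here.\<close>

lemma rs_fam:
  assumes "i \<in> {1..N}" "j \<in> {1..N}" "g \<in> carrier G" "h \<in> carrier G"
  shows "rs i g \<otimes> a i j h = a i j (g \<otimes>\<^bsub>G\<^esub> h)"
proof -
  have "rs i g \<otimes> a i j h = (\<Oplus>k\<in>{1..N}. a i k g \<otimes> a i j h)"
    unfolding rs_def by (rule B.finsum_ldistr) (use assms in auto)
  also have "\<dots> = (\<Oplus>k\<in>{1..N}. if k = j then a i k (g \<otimes>\<^bsub>G\<^esub> h) else \<zero>)"
    by (rule B.finsum_cong') (use assms in \<open>auto simp: fam_row\<close>)
  also have "\<dots> = a i j (g \<otimes>\<^bsub>G\<^esub> h)" by (rule B.finsum_delta) (use assms in auto)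
  finally show ?thesis .
qed

lemma fam_rs:
  assumes "i \<in> {1..N}" "j \<in> {1..N}" "g \<in> carrier G" "h \<in> carrier G"
  shows "a i j h \<otimes> rs i g = a i j (h \<otimes>\<^bsub>G\<^esub> g)"
proof -
  have "a i j h \<otimes> rs i g = (\<Oplus>k\<in>{1..N}. a i j h \<otimes> a i k g)"
    unfolding rs_def by (rule B.finsum_rdistr) (use assms in auto)
  also have "\<dots> = (\<Oplus>k\<in>{1..N}. if k = j then a i k (h \<otimes>\<^bsub>G\<^esub> g) else \<zero>)"
    by (rule B.finsum_cong') (use assms in \<open>auto simp: fam_row\<close>)
  also have "\<dots> = a i j (h \<otimes>\<^bsub>G\<^esub> g)" by (rule B.finsum_delta) (use assms in auto)
  finally show ?thesis .
qed

lemma rs_mult: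
  assumes "i \<in> {1..N}" "g \<in> carrier G" "h \<in> carrier G"
  shows "rs i g \<otimes> rs i h = rs i (g \<otimes>\<^bsub>G\<^esub> h)"
proof -
  have "rs i g \<otimes> rs i h = (\<Oplus>k\<in>{1..N}. rs i g \<otimes> a i k h)"
    unfolding rs_def[of i h] by (rule B.finsum_rdistr) (use assms in auto)
  also have "\<dots> = rs i (g \<otimes>\<^bsub>G\<^esub> h)"
    unfolding rs_def[of i "g \<otimes>\<^bsub>G\<^esub> h"] by (rule B.finsum_cong') (use assms in \<open>auto simp: rs_fam\<close>)
  finally show ?thesis .
qed

text \<open>If all row sums \<open>r(g)\<close> agree, then \<open>r(g) = \<Sum>\<^sub>k r(g) a\<^sub>k\<^sub>j(e) = \<Sum>\<^sub>k a\<^sub>k\<^sub>j(g)\<close>. This is why the antipode,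
  which exchanges row and column sums, preserves the ideal of the row sum relations.\<close>

lemma cs_eq_rs:
  assumes j: "j \<in> {1..N}" and i: "i \<in> {1..N}" and g: "g \<in> carrier G"
    and eq: "\<And>k. k \<in> {1..N} \<Longrightarrow> rs k g = rs i g"
  shows "cs j g = rs i g"
proof -
  have "rs i g = rs i g \<otimes> (\<Oplus>k\<in>{1..N}. a k j \<one>\<^bsub>G\<^esub>)" using i j g by (simp add: fam_csum)
  also have "\<dots> = (\<Oplus>k\<in>{1..N}. rs i g \<otimes> a k j \<one>\<^bsub>G\<^esub>)"
    by (rule B.finsum_rdistr) (use i j g in auto)
  also have "\<dots> = cs j g"
    unfolding cs_def
  proof (rule B.finsum_cong')
    fix k assume k: "k \<in> {1..N}"
    show "rs i g \<otimes> a k j \<one>\<^bsub>G\<^esub> = a k j g"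
      unfolding eq[OF k, symmetric] using k j g by (simp add: rs_fam)
  qed (use j g in auto)
  finally show ?thesis by simp
qed

section \<open>New families from old: images, pullbacks, antipode, comultiplication, counit\<close>

lemma fam_image:
  assumes C: "staralg C" and f: "star_hom B C f"
  shows "hyp_family N G C (\<lambda>i j g. f (a i j g))"
proof -
  interpret C: staralg C by (rule C)
  note [simp] = lin_hom_zero[OF B.staralg_axioms C star_hom_lin[OF f]] star_homD(1,4)[OF f]
  note s = lin_hom_finsum[OF B.staralg_axioms C star_hom_lin[OF f], symmetric]
  have m: "f x \<otimes>\<^bsub>C\<^esub> f y = f (x \<otimes> y)" if "x \<in> carrier B" "y \<in> carrier B" for x y
    using star_homD(3)[OF f that] by simp
  have st: "star C (f x) = f (star B x)" if "x \<in> carrier B" for x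
    using star_homD(6)[OF f that] by simp
  show ?thesis
    by unfold_locales (auto simp: m st fam_star fam_row fam_col s Pi_def fam_rsum fam_csum)
qed

lemma fam_pullback:
  assumes K: "group K" and \<phi>: "\<And>g. g \<in> carrier K \<Longrightarrow> \<phi> g \<in> carrier G"
    "\<And>g h. g \<in> carrier K \<Longrightarrow> h \<in> carrier K \<Longrightarrow> \<phi> (g \<otimes>\<^bsub>K\<^esub> h) = \<phi> g \<otimes>\<^bsub>G\<^esub> \<phi> h"
  shows "hyp_family N K B (\<lambda>i j g. a i j (\<phi> g))"
proof -
  interpret K: group K by (rule K)
  have "\<phi> \<in> hom K G" using \<phi> by (auto simp: hom_def)
  then interpret h: group_hom K G \<phi> by unfold_locales
  show ?thesis
    by unfold_locales (auto simp: \<phi> fam_star fam_row fam_col fam_rsum fam_csum)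
qed

text \<open>The family behind the antipode. Transposition exchanges the row and column relations,
  and the reversal of products under inversion matches the opposite multiplication.\<close>

lemma fam_opposite: "hyp_family N G (opposite B) (\<lambda>i j g. a j i (inv\<^bsub>G\<^esub> g))"
proof -
  interpret O: staralg "opposite B" by (rule staralg_opposite[OF B.staralg_axioms])
  show ?thesis
    by unfold_locales (auto simp: fam_star fam_row fam_col fam_rsum fam_csum G.inv_mult_group)
qed

text \<open>The family behind the comultiplication, needed in an arbitrary family since only the
  relations enter.\<close>

lemma fam_tensor: "hyp_family N G (tensor B B) (\<lambda>i j g. \<Oplus>\<^bsub>tensor B B\<^esub>k\<in>{1..N}. pure_tensor B B (a i k g) (a k j g))"
proof -
  interpret BB: star_tensor B B by (rule star_tensorI[OF B.staralg_axioms B.staralg_axioms])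
  interpret T: staralg "tensor B B" by (rule BB.staralg_tensor)
  let ?T = "tensor B B" and ?p = "pure_tensor B B"
  show ?thesis
  proof unfold_locales
    fix i j g assume ij: "i \<in> {1..N}" "j \<in> {1..N}" and g: "g \<in> carrier G"
    show "(\<Oplus>\<^bsub>?T\<^esub>k\<in>{1..N}. ?p (a i k g) (a k j g)) \<in> carrier ?T"
      by (rule T.finsum_closed) (use ij g in \<open>auto simp: BB.pure_closed\<close>)
    have "star ?T (\<Oplus>\<^bsub>?T\<^esub>k\<in>{1..N}. ?p (a i k g) (a k j g)) = (\<Oplus>\<^bsub>?T\<^esub>k\<in>{1..N}. star ?T (?p (a i k g) (a k j g)))"
      by (rule T.star_finsum) (use ij g in \<open>auto simp: BB.pure_closed\<close>)
    also have "\<dots> = (\<Oplus>\<^bsub>?T\<^esub>k\<in>{1..N}. ?p (a i k (inv\<^bsub>G\<^esub> g)) (a k j (inv\<^bsub>G\<^esub> g)))"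
      by (rule T.finsum_cong') (use ij g in \<open>auto simp: BB.pure_closed BB.pure_star fam_star\<close>)
    finally show "star ?T (\<Oplus>\<^bsub>?T\<^esub>k\<in>{1..N}. ?p (a i k g) (a k j g)) =
       (\<Oplus>\<^bsub>?T\<^esub>k\<in>{1..N}. ?p (a i k (inv\<^bsub>G\<^esub> g)) (a k j (inv\<^bsub>G\<^esub> g)))" .
  next
    fix i j k g h assume ijk: "i \<in> {1..N}" "j \<in> {1..N}" "k \<in> {1..N}" and g: "g \<in> carrier G" "h \<in> carrier G"
    show "(\<Oplus>\<^bsub>?T\<^esub>l\<in>{1..N}. ?p (a i l g) (a l j g)) \<otimes>\<^bsub>?T\<^esub> (\<Oplus>\<^bsub>?T\<^esub>m\<in>{1..N}. ?p (a i m h) (a m k h)) =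
      (if j = k then (\<Oplus>\<^bsub>?T\<^esub>l\<in>{1..N}. ?p (a i l (g \<otimes>\<^bsub>G\<^esub> h)) (a l j (g \<otimes>\<^bsub>G\<^esub> h))) else \<zero>\<^bsub>?T\<^esub>)"
      by (rule BB.pure_sum_mult)
        (use ijk g in \<open>auto simp: BB.pure_closed fam_row BB.pure_zero_l BB.pure_zero_r\<close>)
    show "(\<Oplus>\<^bsub>?T\<^esub>l\<in>{1..N}. ?p (a j l g) (a l i g)) \<otimes>\<^bsub>?T\<^esub> (\<Oplus>\<^bsub>?T\<^esub>m\<in>{1..N}. ?p (a k m h) (a m i h)) =
      (if j = k then (\<Oplus>\<^bsub>?T\<^esub>l\<in>{1..N}. ?p (a j l (g \<otimes>\<^bsub>G\<^esub> h)) (a l i (g \<otimes>\<^bsub>G\<^esub> h))) else \<zero>\<^bsub>?T\<^esub>)"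
      by (rule BB.pure_sum_mult)
        (use ijk g in \<open>auto simp: BB.pure_closed fam_col BB.pure_zero_l BB.pure_zero_r\<close>)
  next
    fix i assume i: "i \<in> {1..N}"
    \<comment> \<open>After the exchange the sum over j is a row sum in the second leg and equals 1;
      what remains is a row sum in the first leg.\<close>
    have "(\<Oplus>\<^bsub>?T\<^esub>j\<in>{1..N}. \<Oplus>\<^bsub>?T\<^esub>k\<in>{1..N}. ?p (a i k \<one>\<^bsub>G\<^esub>) (a k j \<one>\<^bsub>G\<^esub>)) =
        (\<Oplus>\<^bsub>?T\<^esub>k\<in>{1..N}. \<Oplus>\<^bsub>?T\<^esub>j\<in>{1..N}. ?p (a i k \<one>\<^bsub>G\<^esub>) (a k j \<one>\<^bsub>G\<^esub>))"
      by (rule T.finsum_swap) (use i in \<open>auto simp: BB.pure_closed\<close>)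
    also have "\<dots> = (\<Oplus>\<^bsub>?T\<^esub>k\<in>{1..N}. ?p (a i k \<one>\<^bsub>G\<^esub>) (\<Oplus>j\<in>{1..N}. a k j \<one>\<^bsub>G\<^esub>))"
      proof (rule T.finsum_cong')
      fix k assume k: "k \<in> {1..N}"
      show "(\<Oplus>\<^bsub>?T\<^esub>j\<in>{1..N}. ?p (a i k \<one>\<^bsub>G\<^esub>) (a k j \<one>\<^bsub>G\<^esub>)) = ?p (a i k \<one>\<^bsub>G\<^esub>) (\<Oplus>j\<in>{1..N}. a k j \<one>\<^bsub>G\<^esub>)"
        by (rule BB.pure_finsum_r[symmetric]) (use i k in auto)
    qed (use i in \<open>auto simp: BB.pure_closed fam_rsum\<close>)
    also have "\<dots> = (\<Oplus>\<^bsub>?T\<^esub>k\<in>{1..N}. ?p (a i k \<one>\<^bsub>G\<^esub>) \<one>)"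
      by (rule T.finsum_cong') (use i in \<open>auto simp: BB.pure_closed fam_rsum\<close>)
    also have "\<dots> = ?p (\<Oplus>k\<in>{1..N}. a i k \<one>\<^bsub>G\<^esub>) \<one>"
      by (rule BB.pure_finsum_l[symmetric]) (use i in auto)
    finally show "(\<Oplus>\<^bsub>?T\<^esub>j\<in>{1..N}. \<Oplus>\<^bsub>?T\<^esub>k\<in>{1..N}. ?p (a i k \<one>\<^bsub>G\<^esub>) (a k j \<one>\<^bsub>G\<^esub>)) = \<one>\<^bsub>?T\<^esub>"
      using i by (simp add: fam_rsum BB.tensor_one)
    have "(\<Oplus>\<^bsub>?T\<^esub>j\<in>{1..N}. \<Oplus>\<^bsub>?T\<^esub>k\<in>{1..N}. ?p (a j k \<one>\<^bsub>G\<^esub>) (a k i \<one>\<^bsub>G\<^esub>)) =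
        (\<Oplus>\<^bsub>?T\<^esub>k\<in>{1..N}. \<Oplus>\<^bsub>?T\<^esub>j\<in>{1..N}. ?p (a j k \<one>\<^bsub>G\<^esub>) (a k i \<one>\<^bsub>G\<^esub>))"
      by (rule T.finsum_swap) (use i in \<open>auto simp: BB.pure_closed\<close>)
    also have "\<dots> = (\<Oplus>\<^bsub>?T\<^esub>k\<in>{1..N}. ?p \<one> (a k i \<one>\<^bsub>G\<^esub>))"
    proof (rule T.finsum_cong')
      fix k assume k: "k \<in> {1..N}"
      have "?p (\<Oplus>j\<in>{1..N}. a j k \<one>\<^bsub>G\<^esub>) (a k i \<one>\<^bsub>G\<^esub>) = (\<Oplus>\<^bsub>?T\<^esub>j\<in>{1..N}. ?p (a j k \<one>\<^bsub>G\<^esub>) (a k i \<one>\<^bsub>G\<^esub>))"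
        by (rule BB.pure_finsum_l) (use i k in auto)
      then show "(\<Oplus>\<^bsub>?T\<^esub>j\<in>{1..N}. ?p (a j k \<one>\<^bsub>G\<^esub>) (a k i \<one>\<^bsub>G\<^esub>)) = ?p \<one> (a k i \<one>\<^bsub>G\<^esub>)"
        using k by (simp add: fam_csum)
    qed (use i in \<open>auto simp: BB.pure_closed\<close>)
    also have "\<dots> = ?p \<one> (\<Oplus>k\<in>{1..N}. a k i \<one>\<^bsub>G\<^esub>)"
      by (rule BB.pure_finsum_r[symmetric]) (use i in auto)
    finally show "(\<Oplus>\<^bsub>?T\<^esub>j\<in>{1..N}. \<Oplus>\<^bsub>?T\<^esub>k\<in>{1..N}. ?p (a j k \<one>\<^bsub>G\<^esub>) (a k i \<one>\<^bsub>G\<^esub>)) = \<one>\<^bsub>?T\<^esub>"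
      using i by (simp add: fam_csum BB.tensor_one)
  qed
qed

end

text \<open>A unitary representation of the group placed on the diagonal. The trivial one gives the
  counit, and g as an element of the group algebra gives the map that detects injectivity of
  \<iota>.\<close>

lemma fam_diagonal:
  assumes G: "group G" and B: "staralg B"
    and u: "\<And>g. g \<in> carrier G \<Longrightarrow> u g \<in> carrier B" "\<And>g. g \<in> carrier G \<Longrightarrow> star B (u g) = u (inv\<^bsub>G\<^esub> g)"
      "\<And>g h. g \<in> carrier G \<Longrightarrow> h \<in> carrier G \<Longrightarrow> u g \<otimes>\<^bsub>B\<^esub> u h = u (g \<otimes>\<^bsub>G\<^esub> h)" "u \<one>\<^bsub>G\<^esub> = \<one>\<^bsub>B\<^esub>"
  shows "hyp_family N G B (\<lambda>i j g. if i = j then u g else \<zero>\<^bsub>B\<^esub>)"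
proof -
  interpret G: group G by (rule G)
  interpret B: staralg B by (rule B)
  have s: "(\<Oplus>\<^bsub>B\<^esub>k\<in>{1..N}. if k = i then u \<one>\<^bsub>G\<^esub> else \<zero>\<^bsub>B\<^esub>) = \<one>\<^bsub>B\<^esub>"
    "(\<Oplus>\<^bsub>B\<^esub>k\<in>{1..N}. if i = k then u \<one>\<^bsub>G\<^esub> else \<zero>\<^bsub>B\<^esub>) = \<one>\<^bsub>B\<^esub>" if "i \<in> {1..N}" for i
    using B.finsum_delta[of "{1..N}" i "\<lambda>_. \<one>\<^bsub>B\<^esub>"] B.finsum_singleton[of i "{1..N}" "\<lambda>_. \<one>\<^bsub>B\<^esub>"] that
    unfolding u(4) by simp_all
  show ?thesis
    by unfold_locales (use s in \<open>auto simp: u(1,2,3)\<close>)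
qed

text \<open>Used in both directions: for the quotient map it shows that the generators form a
  family, and for the extension of a given family it shows that the relations are killed.\<close>

lemma hyp_relations_kill_iff:
  fixes N :: nat and G :: "('g, 'x) monoid_scheme"
  defines "F \<equiv> free_star_alg (hyp_index N G)"
  assumes G: "group G" and B: "staralg B" and h: "star_hom F B h"
  shows "(\<forall>r\<in>hyp_relations N G. h r = \<zero>\<^bsub>B\<^esub>) \<longleftrightarrow> hyp_family N G B (\<lambda>i j g. h (free_gen (i, j, g)))"
proof -
  interpret G: group G by (rule G)
  interpret B: staralg B by (rule B)
  interpret F: staralg F unfolding F_def by (rule staralg_free)
  let ?a = "\<lambda>i j g. free_gen (i, j, g)"
  have c: "?a i j g \<in> carrier F" if "i \<in> {1..N}" "j \<in> {1..N}" "g \<in> carrier G" for i j g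
    unfolding F_def by (rule free_gen_closed) (use that in \<open>simp add: hyp_index_def\<close>)
  note hD = star_homD[OF h] lin_hom_zero[OF F.staralg_axioms B star_hom_lin[OF h]]
  note hs = lin_hom_finsum[OF F.staralg_axioms B star_hom_lin[OF h]]
  have z: "h (x \<ominus>\<^bsub>F\<^esub> y) = \<zero>\<^bsub>B\<^esub> \<longleftrightarrow> h x = h y" if "x \<in> carrier F" "y \<in> carrier F" for x y
    using that by (simp add: hD lin_hom_minus[OF F.staralg_axioms B star_hom_lin[OF h]] B.minus_eq_zero_iff)
  have if_closed: "(if P then x else \<zero>\<^bsub>F\<^esub>) \<in> carrier F" if "x \<in> carrier F" for P x
    using that by simp
  have if_h: "h (if P then x else \<zero>\<^bsub>F\<^esub>) = (if P then h x else \<zero>\<^bsub>B\<^esub>)" for P x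
    by (simp add: hD)
  have "(\<forall>r\<in>hyp_relations N G. h r = \<zero>\<^bsub>B\<^esub>) \<longleftrightarrow>
    (\<forall>i\<in>{1..N}. \<forall>j\<in>{1..N}. \<forall>g\<in>carrier G. h (star F (?a i j g) \<ominus>\<^bsub>F\<^esub> ?a i j (inv\<^bsub>G\<^esub> g)) = \<zero>\<^bsub>B\<^esub>) \<and>
    (\<forall>i\<in>{1..N}. \<forall>j\<in>{1..N}. \<forall>k\<in>{1..N}. \<forall>g\<in>carrier G. \<forall>h'\<in>carrier G.
       h (?a i j g \<otimes>\<^bsub>F\<^esub> ?a i k h' \<ominus>\<^bsub>F\<^esub> (if j = k then ?a i j (g \<otimes>\<^bsub>G\<^esub> h') else \<zero>\<^bsub>F\<^esub>)) = \<zero>\<^bsub>B\<^esub>) \<and>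
    (\<forall>i\<in>{1..N}. \<forall>j\<in>{1..N}. \<forall>k\<in>{1..N}. \<forall>g\<in>carrier G. \<forall>h'\<in>carrier G.
       h (?a j i g \<otimes>\<^bsub>F\<^esub> ?a k i h' \<ominus>\<^bsub>F\<^esub> (if j = k then ?a j i (g \<otimes>\<^bsub>G\<^esub> h') else \<zero>\<^bsub>F\<^esub>)) = \<zero>\<^bsub>B\<^esub>) \<and>
    (\<forall>i\<in>{1..N}. h ((\<Oplus>\<^bsub>F\<^esub>k\<in>{1..N}. ?a i k \<one>\<^bsub>G\<^esub>) \<ominus>\<^bsub>F\<^esub> \<one>\<^bsub>F\<^esub>) = \<zero>\<^bsub>B\<^esub>) \<and>
    (\<forall>i\<in>{1..N}. h ((\<Oplus>\<^bsub>F\<^esub>k\<in>{1..N}. ?a k i \<one>\<^bsub>G\<^esub>) \<ominus>\<^bsub>F\<^esub> \<one>\<^bsub>F\<^esub>) = \<zero>\<^bsub>B\<^esub>)"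
    unfolding hyp_relations_def Let_def F_def[symmetric] by blast
  also have "\<dots> \<longleftrightarrow>
    (\<forall>i\<in>{1..N}. \<forall>j\<in>{1..N}. \<forall>g\<in>carrier G. star B (h (?a i j g)) = h (?a i j (inv\<^bsub>G\<^esub> g))) \<and>
    (\<forall>i\<in>{1..N}. \<forall>j\<in>{1..N}. \<forall>k\<in>{1..N}. \<forall>g\<in>carrier G. \<forall>h'\<in>carrier G.
       h (?a i j g) \<otimes>\<^bsub>B\<^esub> h (?a i k h') = (if j = k then h (?a i j (g \<otimes>\<^bsub>G\<^esub> h')) else \<zero>\<^bsub>B\<^esub>)) \<and>
    (\<forall>i\<in>{1..N}. \<forall>j\<in>{1..N}. \<forall>k\<in>{1..N}. \<forall>g\<in>carrier G. \<forall>h'\<in>carrier G.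
       h (?a j i g) \<otimes>\<^bsub>B\<^esub> h (?a k i h') = (if j = k then h (?a j i (g \<otimes>\<^bsub>G\<^esub> h')) else \<zero>\<^bsub>B\<^esub>)) \<and>
    (\<forall>i\<in>{1..N}. (\<Oplus>\<^bsub>B\<^esub>k\<in>{1..N}. h (?a i k \<one>\<^bsub>G\<^esub>)) = \<one>\<^bsub>B\<^esub>) \<and>
    (\<forall>i\<in>{1..N}. (\<Oplus>\<^bsub>B\<^esub>k\<in>{1..N}. h (?a k i \<one>\<^bsub>G\<^esub>)) = \<one>\<^bsub>B\<^esub>)" (is "_ \<longleftrightarrow> ?R")
    by (intro conj_cong ball_cong refl; simp add: z c if_closed if_h hD hs Pi_def split del: if_split)
  also have "?R \<longleftrightarrow> hyp_family N G B (\<lambda>i j g. h (?a i j g))"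
  proof
    assume ?R
    then show "hyp_family N G B (\<lambda>i j g. h (?a i j g))"
      by (intro hyp_family.intro hyp_family_axioms.intro G B) (use hD(1) c in blast)+
  next
    assume "hyp_family N G B (\<lambda>i j g. h (?a i j g))"
    then interpret f: hyp_family N G B "\<lambda>i j g. h (?a i j g)" .
    show ?R by (intro conjI ballI f.fam_star f.fam_row f.fam_col f.fam_rsum f.fam_csum)
  qed
  finally show ?thesis .
qed

locale hyp_presentation = G: group G for N :: nat and G :: "('g, 'x) monoid_scheme"
begin

abbreviation "ix \<equiv> hyp_index N G"
abbreviation "rels \<equiv> hyp_relations N G"
abbreviation "F \<equiv> free_star_alg ix"

sublocale P: presentation ix rels
proof
  interpret F: staralg F by (rule staralg_free)
  have c: "free_gen (i, j, g) \<in> carrier F" if "i \<in> {1..N}" "j \<in> {1..N}" "g \<in> carrier G" for i j g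
    by (rule free_gen_closed) (use that in \<open>simp add: hyp_index_def\<close>)
  show "rels \<subseteq> carrier F"
    unfolding hyp_relations_def Let_def
    by (auto simp: c intro!: F.minus_closed F.finsum_closed)
qed

abbreviation "A \<equiv> hyp_alg N G"
abbreviation "a \<equiv> hyp_gen N G"

lemma staralg_hyp_alg: "staralg A"
  unfolding hyp_alg_def by (rule P.staralg_presented)

lemma fam_hyp_alg: "hyp_family N G A a"
proof -
  have "\<forall>r\<in>rels. P.PQ.q r = \<zero>\<^bsub>A\<^esub>" using P.presented_relation by (simp add: hyp_alg_def)
  moreover have "star_hom F A P.PQ.q" unfolding hyp_alg_def P.presented_eq by (rule P.PQ.star_hom_quot)
  ultimately show ?thesis
    using hyp_relations_kill_iff[OF G.is_group staralg_hyp_alg, of N P.PQ.q]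
    by (simp add: hyp_gen_def[abs_def] presented_gen_def)
qed

text \<open>The adjoint of a_ij(g) is the generator a_ij(g^-1), so adjoints add nothing to the
  generating set.\<close>

lemma hyp_alg_generates: "generates A {a i j g | i j g. i \<in> {1..N} \<and> j \<in> {1..N} \<and> g \<in> carrier G}"
proof -
  interpret f: hyp_family N G A a by (rule fam_hyp_alg)
  let ?G = "{a i j g | i j g. i \<in> {1..N} \<and> j \<in> {1..N} \<and> g \<in> carrier G}"
  have 1: "presented_gen ix rels x \<in> ?G" if x: "x \<in> ix" for x
  proof -
    obtain i j g where x: "x = (i, j, g)" "i \<in> {1..N}" "j \<in> {1..N}" "g \<in> carrier G"
      using x unfolding hyp_index_def by blast
    then have "presented_gen ix rels x = a i j g" by (simp add: hyp_gen_def)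
    with x show ?thesis by blast
  qed
  have 2: "star A y \<in> ?G" if y: "y \<in> ?G" for y
  proof -
    obtain i j g where y: "y = a i j g" "i \<in> {1..N}" "j \<in> {1..N}" "g \<in> carrier G" using y by blast
    then have "star A y = a i j (inv\<^bsub>G\<^esub> g)" by (simp add: f.fam_star)
    with y show ?thesis by blast
  qed
  show ?thesis
  proof (rule generates_mono[OF P.presented_generates[folded hyp_alg_def]])
    show "presented_gen ix rels ` ix \<union> star A ` presented_gen ix rels ` ix \<subseteq> ?G"
      using 1 2 by blast
    show "?G \<subseteq> carrier A" using f.fam_closed by blast
  qed
qed

lemma hyp_ext:
  assumes "hyp_family N G B b"
  shows "star_hom A B (presented_ext B (\<lambda>(i, j, g). b i j g))"
    "i \<in> {1..N} \<Longrightarrow> j \<in> {1..N} \<Longrightarrow> g \<in> carrier G \<Longrightarrow> presented_ext B (\<lambda>(i, j, g). b i j g) (a i j g) = b i j g"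
proof -
  interpret b: hyp_family N G B b by (rule assms)
  let ?f = "\<lambda>(i, j, g). b i j g"
  have f: "?f x \<in> carrier B" if "x \<in> ix" for x
    using that by (auto simp: hyp_index_def)
  note e = free_ext[where X = ix and f = ?f, OF b.B.staralg_axioms f]
  have v: "free_ext B ?f (free_gen (i, j, g)) = b i j g" if "i \<in> {1..N}" "j \<in> {1..N}" "g \<in> carrier G" for i j g
    using that by (subst e(2)) (auto simp: hyp_index_def)
  have "hyp_family N G B (\<lambda>i j g. free_ext B ?f (free_gen (i, j, g)))"
    by unfold_locales (simp_all add: v b.fam_star b.fam_row b.fam_col b.fam_rsum b.fam_csum cong: b.B.finsum_cong)
  then have k: "free_ext B ?f r = \<zero>\<^bsub>B\<^esub>" if "r \<in> rels" for r
    using hyp_relations_kill_iff[OF G.is_group b.B.staralg_axioms e(1)] that by blast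
  show "star_hom A B (presented_ext B ?f)"
    unfolding hyp_alg_def by (rule P.presented_ext(1)[where f = ?f, OF b.B.staralg_axioms f k])
  show "i \<in> {1..N} \<Longrightarrow> j \<in> {1..N} \<Longrightarrow> g \<in> carrier G \<Longrightarrow> presented_ext B ?f (a i j g) = b i j g"
    unfolding hyp_gen_def
    by (subst P.presented_ext(2)[where f = ?f, OF b.B.staralg_axioms f k]) (auto simp: hyp_index_def)
qed

lemma staralg_hyp: "staralg (hyp N G)"
  by (simp add: hyp_def Let_def staralg_extend[OF staralg_hyp_alg])

lemma hyp_simps:
  "star_hom (hyp N G) B f = star_hom A B f" "star_hom C (hyp N G) f' = star_hom C A f'"
  "carrier (hyp N G) = carrier A"
  "tensor (hyp N G) (hyp N G) = tensor A A" "pure_tensor (hyp N G) (hyp N G) = pure_tensor A A"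
  "generates (hyp N G) X = generates A X"
  by (simp_all add: hyp_def Let_def)

lemma fam_hyp: "hyp_family N G (hyp N G) a"
  using hyp_family.fam_image[OF fam_hyp_alg staralg_hyp, of "\<lambda>x. x"] star_hom_id[OF staralg_hyp]
  by (simp add: hyp_simps)

lemma fam_counit: "hyp_family N G complex_alg (\<lambda>i j g. if i = j then 1 else 0)"
  using fam_diagonal[OF G.is_group staralg_complex, of "\<lambda>_. 1" N] unfolding complex_alg_simps by simp

lemma pre_hopf_hyp: "pre_hopf (hyp N G)"
proof -
  interpret f: hyp_family N G A a by (rule fam_hyp_alg)
  show ?thesis
    unfolding pre_hopf_def
    using staralg_hyp hyp_ext(1)[OF f.fam_tensor] hyp_ext(1)[OF fam_counit] hyp_ext(1)[OF f.fam_opposite]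
    by (simp add: hyp_def Let_def)
qed

lemma hyp_gen_hopf:
  assumes "i \<in> {1..N}" "j \<in> {1..N}" "g \<in> carrier G"
  shows "comult (hyp N G) (a i j g) = (\<Oplus>\<^bsub>tensor A A\<^esub>k\<in>{1..N}. pure_tensor A A (a i k g) (a k j g))"
    "counit (hyp N G) (a i j g) = (if i = j then 1 else 0)"
    "antipode (hyp N G) (a i j g) = a j i (inv\<^bsub>G\<^esub> g)"
proof -
  interpret f: hyp_family N G A a by (rule fam_hyp_alg)
  show "comult (hyp N G) (a i j g) = (\<Oplus>\<^bsub>tensor A A\<^esub>k\<in>{1..N}. pure_tensor A A (a i k g) (a k j g))"
    "counit (hyp N G) (a i j g) = (if i = j then 1 else 0)"
    "antipode (hyp N G) (a i j g) = a j i (inv\<^bsub>G\<^esub> g)"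
    using hyp_ext(2)[OF f.fam_tensor assms] hyp_ext(2)[OF fam_counit assms] hyp_ext(2)[OF f.fam_opposite assms]
    by (simp_all add: hyp_def Let_def)
qed

end

text \<open>Setting shared by O(H_N^+(\<Gamma>)), O(H_N^+(\<Gamma>, \<Lambda>)) and
  O(H_N^+(\<Gamma>/\<Lambda>)): a generating family on which the Hopf structure has the standard
  form.\<close>

locale hopf_hyp = pre_hopf_alg H + fam: hyp_family N G H a
  for H :: "('b, 'y) hopf_star_alg_scheme" (structure) and N :: nat and G :: "('g, 'x) monoid_scheme" and a +
  assumes comult_fam: "i \<in> {1..N} \<Longrightarrow> j \<in> {1..N} \<Longrightarrow> g \<in> carrier G \<Longrightarrow>
      \<Delta> (a i j g) = (\<Oplus>\<^bsub>tensor H H\<^esub>k\<in>{1..N}. pure_tensor H H (a i k g) (a k j g))"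
    and counit_fam: "i \<in> {1..N} \<Longrightarrow> j \<in> {1..N} \<Longrightarrow> g \<in> carrier G \<Longrightarrow> \<epsilon> (a i j g) = (if i = j then 1 else 0)"
    and antipode_fam: "i \<in> {1..N} \<Longrightarrow> j \<in> {1..N} \<Longrightarrow> g \<in> carrier G \<Longrightarrow> S (a i j g) = a j i (inv\<^bsub>G\<^esub> g)"
    and generates_fam: "generates H {a i j g | i j g. i \<in> {1..N} \<and> j \<in> {1..N} \<and> g \<in> carrier G}"
begin

text \<open>Corepresentation matrices are indexed from 0, the generators from 1.\<close>

lemma finsum_shift:
  assumes "staralg V" "\<And>k. k \<in> {1..N} \<Longrightarrow> f k \<in> carrier V"
  shows "(\<Oplus>\<^bsub>V\<^esub>k\<in>{..<N}. f (Suc k)) = (\<Oplus>\<^bsub>V\<^esub>k\<in>{1..N}. f k)"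
proof -
  interpret V: staralg V by fact
  have e: "{1..N} = Suc ` {..<N}" by (auto simp: image_Suc_lessThan atLeastAtMost_iff One_nat_def)
  show ?thesis unfolding e by (rule V.finsum_reindex[symmetric]) (use assms(2) e in auto)
qed

text \<open>Unitarity comes from a_ik(g) a_jk(g)^* = \<delta>_ij a_ik(e), whose sum over k is
  \<delta>_ij, and from the transposed identity.\<close>

lemma unitary_corep_fam:
  assumes g: "g \<in> carrier G"
  shows "unitary_corep H N (\<lambda>i j. a (Suc i) (Suc j) g)"
proof -
  have ix: "Suc i \<in> {1..N}" if "i < N" for i using that by (simp add: atLeastAtMost_iff)
  show ?thesis
    unfolding unitary_corep_def
  proof (intro allI impI conjI)
    fix i j assume ij: "i < N" "j < N"
    note I = ix[OF ij(1)] ix[OF ij(2)]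
    show "a (Suc i) (Suc j) g \<in> carrier H" using I g by simp
    show "\<Delta> (a (Suc i) (Suc j) g) = (\<Oplus>\<^bsub>tensor H H\<^esub>k\<in>{..<N}. pure_tensor H H (a (Suc i) (Suc k) g) (a (Suc k) (Suc j) g))"
      unfolding comult_fam[OF I g] by (rule finsum_shift[OF HH.staralg_tensor, symmetric]) (use I g in \<open>simp add: HH.pure_closed\<close>)
    show "\<epsilon> (a (Suc i) (Suc j) g) = (if i = j then 1 else 0)" using I g by (simp add: counit_fam)
    have "(\<Oplus>k\<in>{..<N}. a (Suc i) (Suc k) g \<otimes> star H (a (Suc j) (Suc k) g)) = (\<Oplus>k\<in>{1..N}. a (Suc i) k g \<otimes> star H (a (Suc j) k g))"
      by (rule finsum_shift[OF alg]) (use I g in simp)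
    also have "\<dots> = (\<Oplus>k\<in>{1..N}. if i = j then a (Suc i) k \<one>\<^bsub>G\<^esub> else \<zero>)"
      by (rule H.finsum_cong') (use I g in \<open>auto simp: fam.fam_star fam.fam_col\<close>)
    also have "\<dots> = (if i = j then (\<Oplus>k\<in>{1..N}. a (Suc i) k \<one>\<^bsub>G\<^esub>) else \<zero>)"
      by (rule H.finsum_if_zero) (use I in auto)
    finally show "(\<Oplus>k\<in>{..<N}. a (Suc i) (Suc k) g \<otimes> star H (a (Suc j) (Suc k) g)) = (if i = j then \<one> else \<zero>)"
      using I by (simp add: fam.fam_rsum)
    have "(\<Oplus>k\<in>{..<N}. star H (a (Suc k) (Suc i) g) \<otimes> a (Suc k) (Suc j) g) = (\<Oplus>k\<in>{1..N}. star H (a k (Suc i) g) \<otimes> a k (Suc j) g)"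
      by (rule finsum_shift[OF alg]) (use I g in simp)
    also have "\<dots> = (\<Oplus>k\<in>{1..N}. if i = j then a k (Suc i) \<one>\<^bsub>G\<^esub> else \<zero>)"
      by (rule H.finsum_cong') (use I g in \<open>auto simp: fam.fam_star fam.fam_row\<close>)
    also have "\<dots> = (if i = j then (\<Oplus>k\<in>{1..N}. a k (Suc i) \<one>\<^bsub>G\<^esub>) else \<zero>)"
      by (rule H.finsum_if_zero) (use I in auto)
    finally show "(\<Oplus>k\<in>{..<N}. star H (a (Suc k) (Suc i) g) \<otimes> a (Suc k) (Suc j) g) = (if i = j then \<one> else \<zero>)"
      using I by (simp add: fam.fam_csum)
  qed
qed

lemma fam_coeff:
  assumes "x \<in> {a i j g | i j g. i \<in> {1..N} \<and> j \<in> {1..N} \<and> g \<in> carrier G}"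
  shows "corep_coeff x"
proof -
  from assms obtain i j g where ij: "i \<in> {1..N}" "j \<in> {1..N}" and g: "g \<in> carrier G" and x: "x = a i j g" by blast
  have s: "S (a (Suc i) (Suc j) g) = star H (a (Suc j) (Suc i) g)" if "i < N" "j < N" for i j
    using that g by (simp add: antipode_fam fam.fam_star atLeastAtMost_iff)
  have "i - 1 < N" "j - 1 < N" "x = a (Suc (i - 1)) (Suc (j - 1)) g"
    using ij by (auto simp: atLeastAtMost_iff x)
  with unitary_corep_fam[OF g] s show ?thesis unfolding corep_coeff_def by blast
qed

lemma cqg: "cqg_algebra H"
  by (rule cqg_algebraI[OF generates_fam fam_coeff])

lemma hopf: "hopf_star_algebra H"
  by (rule hopf_star_algebraI[OF generates_fam fam_coeff])

lemma counit_rs: "i \<in> {1..N} \<Longrightarrow> g \<in> carrier G \<Longrightarrow> \<epsilon> (fam.rs i g) = 1"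
proof -
  assume i: "i \<in> {1..N}" and g: "g \<in> carrier G"
  interpret C: staralg complex_alg by (rule staralg_complex)
  have "\<epsilon> (fam.rs i g) = (\<Oplus>\<^bsub>complex_alg\<^esub>k\<in>{1..N}. \<epsilon> (a i k g))"
    unfolding fam.rs_def by (rule lin_hom_finsum[OF alg staralg_complex star_hom_lin[OF counit]]) (use i g in auto)
  also have "\<dots> = (\<Oplus>\<^bsub>complex_alg\<^esub>k\<in>{1..N}. if i = k then (\<lambda>_. 1) k else \<zero>\<^bsub>complex_alg\<^esub>)"
    by (rule C.finsum_cong') (use i g in \<open>auto simp: counit_fam\<close>)
  also have "\<dots> = 1" by (rule C.finsum_singleton) (use i in auto)
  finally show ?thesis .
qed

lemma antipode_rs: "i \<in> {1..N} \<Longrightarrow> g \<in> carrier G \<Longrightarrow> S (fam.rs i g) = fam.cs i (inv\<^bsub>G\<^esub> g)"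
proof -
  assume i: "i \<in> {1..N}" and g: "g \<in> carrier G"
  have "S (fam.rs i g) = (\<Oplus>k\<in>{1..N}. S (a i k g))"
    unfolding fam.rs_def
    using lin_hom_finsum[OF alg staralg_opposite[OF alg] star_hom_lin[OF antipode], of "{1..N}" "\<lambda>k. a i k g"] i g by auto
  also have "\<dots> = fam.cs i (inv\<^bsub>G\<^esub> g)"
    unfolding fam.cs_def by (rule H.finsum_cong') (use i g in \<open>auto simp: antipode_fam\<close>)
  finally show ?thesis .
qed

lemma comult_rs:
  assumes i: "i \<in> {1..N}" and g: "g \<in> carrier G"
  shows "\<Delta> (fam.rs i g) = (\<Oplus>\<^bsub>tensor H H\<^esub>k\<in>{1..N}. pure_tensor H H (a i k g) (fam.rs k g))"
proof -
  have "\<Delta> (fam.rs i g) = (\<Oplus>\<^bsub>tensor H H\<^esub>j\<in>{1..N}. \<Delta> (a i j g))"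
    unfolding fam.rs_def by (rule lin_hom_finsum[OF alg HH.staralg_tensor star_hom_lin[OF comult]]) (use i g in auto)
  also have "\<dots> = (\<Oplus>\<^bsub>tensor H H\<^esub>j\<in>{1..N}. \<Oplus>\<^bsub>tensor H H\<^esub>k\<in>{1..N}. pure_tensor H H (a i k g) (a k j g))"
    by (rule T.finsum_cong') (use i g in \<open>auto simp: comult_fam HH.pure_closed\<close>)
  also have "\<dots> = (\<Oplus>\<^bsub>tensor H H\<^esub>k\<in>{1..N}. \<Oplus>\<^bsub>tensor H H\<^esub>j\<in>{1..N}. pure_tensor H H (a i k g) (a k j g))"
    by (rule T.finsum_swap) (use i g in \<open>auto simp: HH.pure_closed\<close>)
  also have "\<dots> = (\<Oplus>\<^bsub>tensor H H\<^esub>k\<in>{1..N}. pure_tensor H H (a i k g) (fam.rs k g))"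
  proof (rule T.finsum_cong')
    fix k assume k: "k \<in> {1..N}"
    show "(\<Oplus>\<^bsub>tensor H H\<^esub>j\<in>{1..N}. pure_tensor H H (a i k g) (a k j g)) = pure_tensor H H (a i k g) (fam.rs k g)"
      unfolding fam.rs_def
      by (rule HH.pure_finsum_r[symmetric]) (use i k g in auto)
  qed (use i g in \<open>auto simp: HH.pure_closed\<close>)
  finally show ?thesis .
qed

text \<open>In \<Delta>(r_i) = \<Sum>_k a_ik(g) \<otimes> r_k the second leg is now independent of
  k, and the first legs add up to r_i.\<close>

lemma comult_rs_eq:
  assumes i: "i \<in> {1..N}" and g: "g \<in> carrier G" and eq: "\<And>k. k \<in> {1..N} \<Longrightarrow> fam.rs k g = fam.rs i g"
  shows "\<Delta> (fam.rs i g) = pure_tensor H H (fam.rs i g) (fam.rs i g)"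
proof -
  have "\<Delta> (fam.rs i g) = (\<Oplus>\<^bsub>tensor H H\<^esub>k\<in>{1..N}. pure_tensor H H (a i k g) (fam.rs i g))"
    unfolding comult_rs[OF i g]
  proof (rule T.finsum_cong')
    fix k assume k: "k \<in> {1..N}"
    show "pure_tensor H H (a i k g) (fam.rs k g) = pure_tensor H H (a i k g) (fam.rs i g)"
      by (simp only: eq[OF k])
  qed (use i g in \<open>auto simp: HH.pure_closed\<close>)
  also have "\<dots> = pure_tensor H H (\<Oplus>k\<in>{1..N}. a i k g) (fam.rs i g)"
    by (rule HH.pure_finsum_l[symmetric]) (use i g in auto)
  finally show ?thesis by (simp add: fam.rs_def)
qed

end

sublocale hyp_presentation \<subseteq> hyp: hopf_hyp "hyp N G" N G "hyp_gen N G"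
  by (intro hopf_hyp.intro pre_hopf_alg.intro hopf_hyp_axioms.intro pre_hopf_hyp fam_hyp)
    (simp_all add: hyp_gen_hopf hyp_simps hyp_alg_generates finsum_def finprod_def)

section \<open>The exact sequence\<close>

lemma lin_span_opposite [simp]: "lin_span (opposite A) = lin_span A"
  by (intro ext) (simp add: lin_span_def submodule_def submodule_axioms_def subgroup_def m_inv_def)

lemma generates_opposite [simp]: "generates (opposite A) G \<longleftrightarrow> generates A G"
proof -
  have 1: "x \<in> gen_alg A G" if "x \<in> gen_alg (opposite A) G" for x
    using that by induct (auto intro: gen_alg.intros)
  have 2: "x \<in> gen_alg (opposite A) G" if "x \<in> gen_alg A G" for x
    using that
  proof induct
    case one
    show ?case using gen_alg.one[of "opposite A" G] by simp
  next
    case (add x y)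
    then show ?case using gen_alg.add[of x "opposite A" G y] by simp
  next
    case (mult x y)
    then show ?case using gen_alg.mult[of y "opposite A" G x] by simp
  next
    case (smult x c)
    then show ?case using gen_alg.smult[of x "opposite A" G c] by simp
  qed (rule gen_alg.gen)
  show ?thesis using 1 2 by (auto simp: generates_def)
qed

section \<open>One-sided ideals generated by a subspace\<close>

lemma span_left_mult:
  assumes A: "staralg A" and I: "I \<subseteq> carrier A" and b: "b \<in> carrier A"
    and y: "y \<in> lin_span A {a \<otimes>\<^bsub>A\<^esub> x | a x. a \<in> carrier A \<and> x \<in> I}"
  shows "b \<otimes>\<^bsub>A\<^esub> y \<in> lin_span A {a \<otimes>\<^bsub>A\<^esub> x | a x. a \<in> carrier A \<and> x \<in> I}"
proof -
  interpret staralg A by (rule A)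
  let ?S = "{a \<otimes>\<^bsub>A\<^esub> x | a x. a \<in> carrier A \<and> x \<in> I}"
  have Ic: "x \<in> carrier A" if "x \<in> I" for x using I that by auto
  have S: "?S \<subseteq> carrier A" using Ic by auto
  from A S y show ?thesis
  proof (induct rule: lin_span_induct)
    case (base y)
    then obtain a x where y: "y = a \<otimes>\<^bsub>A\<^esub> x" "a \<in> carrier A" "x \<in> I" by blast
    then have "b \<otimes>\<^bsub>A\<^esub> y = (b \<otimes>\<^bsub>A\<^esub> a) \<otimes>\<^bsub>A\<^esub> x" using b Ic by (simp add: m_assoc)
    moreover have "b \<otimes>\<^bsub>A\<^esub> a \<in> carrier A" using b y by simp
    ultimately show ?case using y(3) by (intro lin_span_base) blast
  qed (use b lin_span_closed[OF A S] in \<open>simp_all add: r_distr smult_mult_r\<close>)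
qed

text \<open>Applied to the algebra and to its opposite, this gives \<open>IA = AI\<close>.\<close>

lemma span_right_mult_subset:
  assumes A: "staralg A" and gen: "generates A G" and I: "I \<subseteq> carrier A" and D: "D \<subseteq> I" "I \<subseteq> lin_span A D"
    and comm: "\<And>d x. d \<in> D \<Longrightarrow> x \<in> G \<Longrightarrow> d \<otimes>\<^bsub>A\<^esub> x \<in> lin_span A {a \<otimes>\<^bsub>A\<^esub> x | a x. a \<in> carrier A \<and> x \<in> I}"
  shows "lin_span A {x \<otimes>\<^bsub>A\<^esub> a | x a. x \<in> I \<and> a \<in> carrier A} \<subseteq> lin_span A {a \<otimes>\<^bsub>A\<^esub> x | a x. a \<in> carrier A \<and> x \<in> I}"
proof -
  interpret staralg A by (rule A)
  let ?S = "{a \<otimes>\<^bsub>A\<^esub> x | a x. a \<in> carrier A \<and> x \<in> I}"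
  let ?M = "lin_span A ?S"
  have Ic: "x \<in> carrier A" if "x \<in> I" for x using I that by auto
  have S: "?S \<subseteq> carrier A" using Ic by auto
  have Dc: "D \<subseteq> carrier A" using D I by auto
  note cl = lin_span_closed[OF A S]
  note l = span_left_mult[OF A I]
  have span: "x \<otimes>\<^bsub>A\<^esub> b \<in> ?M" if x: "x \<in> I" and b: "b \<in> carrier A" and d: "\<And>d. d \<in> D \<Longrightarrow> d \<otimes>\<^bsub>A\<^esub> b \<in> ?M" for x b
    using A Dc subsetD[OF D(2) x]
    by (induct rule: lin_span_induct) (simp_all add: d b cl l_distr smult_mult_l)
  have r: "y \<otimes>\<^bsub>A\<^esub> b \<in> ?M" if y: "y \<in> ?M" and b: "b \<in> carrier A" and d: "\<And>d. d \<in> D \<Longrightarrow> d \<otimes>\<^bsub>A\<^esub> b \<in> ?M" for y b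
    using A S y
  proof (induct rule: lin_span_induct)
    case (base y)
    then obtain a x where y: "y = a \<otimes>\<^bsub>A\<^esub> x" "a \<in> carrier A" "x \<in> I" by blast
    then have "y \<otimes>\<^bsub>A\<^esub> b = a \<otimes>\<^bsub>A\<^esub> (x \<otimes>\<^bsub>A\<^esub> b)" using b Ic by (simp add: m_assoc)
    then show ?case using l[OF y(2) span[OF y(3) b d]] by simp
  qed (use b cl in \<open>simp_all add: l_distr smult_mult_l\<close>)
  have dM: "d \<in> ?M" if "d \<in> D" for d
  proof -
    have "d = \<one>\<^bsub>A\<^esub> \<otimes>\<^bsub>A\<^esub> d" "d \<in> I" using that Dc D by auto
    then show ?thesis by (intro lin_span_base) blast
  qed
  \<comment> \<open>The property carried through the generation of b is that D b lies in M. By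
    \<open>r\<close> it implies that M b lies in M, which settles products: d x is in M, hence so is
    (d x) y.\<close>
  have all: "\<forall>d\<in>D. d \<otimes>\<^bsub>A\<^esub> b \<in> ?M" if "b \<in> carrier A" for b
    using A gen that
  proof (induct rule: generates_induct)
    case (gen x)
    then show ?case using comm by blast
  next
    case one
    then show ?case using dM Dc by auto
  next
    case (mult x y)
    show ?case
    proof
      fix d assume d: "d \<in> D"
      then have "d \<otimes>\<^bsub>A\<^esub> (x \<otimes>\<^bsub>A\<^esub> y) = (d \<otimes>\<^bsub>A\<^esub> x) \<otimes>\<^bsub>A\<^esub> y" using mult Dc by (simp add: m_assoc subset_iff)
      moreover have "(d \<otimes>\<^bsub>A\<^esub> x) \<otimes>\<^bsub>A\<^esub> y \<in> ?M" using r mult d by blast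
      ultimately show "d \<otimes>\<^bsub>A\<^esub> (x \<otimes>\<^bsub>A\<^esub> y) \<in> ?M" by simp
    qed
  qed (use Dc in \<open>auto simp: r_distr smult_mult_r subset_iff intro!: cl\<close>)
  show ?thesis
    by (rule lin_span_minimal[OF lin_span_submodule[OF A S]]) (use all span in blast)
qed

text \<open>Left multiplication preserves AI and right multiplication preserves IA, while the star
  sends the products spanning AI into IA. Equality of the two spans turns this into a two-sided
  *-ideal.\<close>

lemma star_ideal_span_products:
  assumes A: "staralg A" and I: "I \<subseteq> carrier A" and star: "\<And>x. x \<in> I \<Longrightarrow> star A x \<in> I"
    and eq: "lin_span A {x \<otimes>\<^bsub>A\<^esub> a | x a. x \<in> I \<and> a \<in> carrier A} = lin_span A {a \<otimes>\<^bsub>A\<^esub> x | a x. a \<in> carrier A \<and> x \<in> I}"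
  shows "star_ideal (lin_span A {a \<otimes>\<^bsub>A\<^esub> x | a x. a \<in> carrier A \<and> x \<in> I}) A"
proof -
  interpret staralg A by (rule A)
  let ?S = "{a \<otimes>\<^bsub>A\<^esub> x | a x. a \<in> carrier A \<and> x \<in> I}" and ?S' = "{x \<otimes>\<^bsub>A\<^esub> a | x a. x \<in> I \<and> a \<in> carrier A}"
  have Ic: "x \<in> carrier A" if "x \<in> I" for x using I that by auto
  have S: "?S \<subseteq> carrier A" and S': "?S' \<subseteq> carrier A" using Ic by auto
  note cl = lin_span_closed[OF A S]
  show ?thesis
  proof (rule star_idealI[OF A lin_span_submodule[OF A S]])
    fix y b assume b: "b \<in> carrier A" and y: "y \<in> lin_span A ?S"
    show "b \<otimes>\<^bsub>A\<^esub> y \<in> lin_span A ?S" by (rule span_left_mult[OF A I b y])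
    show "y \<otimes>\<^bsub>A\<^esub> b \<in> lin_span A ?S"
      using A S' y[folded eq]
    proof (induct rule: lin_span_induct)
      case (base y)
      then obtain a x where y: "y = x \<otimes>\<^bsub>A\<^esub> a" "a \<in> carrier A" "x \<in> I" by blast
      then have "y \<otimes>\<^bsub>A\<^esub> b = x \<otimes>\<^bsub>A\<^esub> (a \<otimes>\<^bsub>A\<^esub> b)" using b Ic by (simp add: m_assoc)
      moreover have "a \<otimes>\<^bsub>A\<^esub> b \<in> carrier A" using b y by simp
      ultimately have "y \<otimes>\<^bsub>A\<^esub> b \<in> lin_span A ?S'" using y(3) by (intro lin_span_base) blast
      then show ?case unfolding eq .
    qed (use b cl in \<open>simp_all add: l_distr smult_mult_l\<close>)
  next
    fix y assume y: "y \<in> lin_span A ?S"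
    show "star A y \<in> lin_span A ?S"
      using A S y
    proof (induct rule: lin_span_induct)
      case (base y)
      then obtain a x where y: "y = a \<otimes>\<^bsub>A\<^esub> x" "a \<in> carrier A" "x \<in> I" by blast
      then have "star A y = star A x \<otimes>\<^bsub>A\<^esub> star A a" using Ic by (simp add: star_mult)
      then have "star A y \<in> lin_span A ?S'" using y star star_closed by (intro lin_span_base) blast
      then show ?case unfolding eq .
    qed (use cl in \<open>simp_all add: star_add star_smult\<close>)
  qed
qed

lemma hopf_hyp_hom:
  assumes H: "hopf_hyp H N G a" and K: "hopf_hyp K N G' a'" and f: "star_hom H K f"
    and \<phi>: "\<And>g. g \<in> carrier G \<Longrightarrow> \<phi> g \<in> carrier G'" "\<And>g. g \<in> carrier G \<Longrightarrow> \<phi> (inv\<^bsub>G\<^esub> g) = inv\<^bsub>G'\<^esub> \<phi> g"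
    and fa: "\<And>i j g. i \<in> {1..N} \<Longrightarrow> j \<in> {1..N} \<Longrightarrow> g \<in> carrier G \<Longrightarrow> f (a i j g) = a' i j (\<phi> g)"
  shows "hopf_star_hom H K f"
proof -
  interpret H: hopf_hyp H N G a by (rule H)
  interpret K: hopf_hyp K N G' a' by (rule K)
  note fl = star_hom_lin[OF f]
  show ?thesis
  proof (rule hopf_star_hom_on_generators[OF H.pre_hopf K.pre_hopf f H.generates_fam])
    fix x assume "x \<in> {a i j g |i j g. i \<in> {1..N} \<and> j \<in> {1..N} \<and> g \<in> carrier G}"
    then obtain i j g where ij: "i \<in> {1..N}" "j \<in> {1..N}" and g: "g \<in> carrier G" and x: "x = a i j g" by blast
    have "tensor_map K K f f (comult H x) = (\<Oplus>\<^bsub>tensor K K\<^esub>k\<in>{1..N}. pure_tensor K K (f (a i k g)) (f (a k j g)))"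
      unfolding x H.comult_fam[OF ij g]
      by (rule tensor_map_sum[OF H.alg H.alg K.alg K.alg fl fl]) (use ij g in auto)
    also have "\<dots> = (\<Oplus>\<^bsub>tensor K K\<^esub>k\<in>{1..N}. pure_tensor K K (a' i k (\<phi> g)) (a' k j (\<phi> g)))"
      by (rule K.T.finsum_cong') (use ij g \<phi> in \<open>auto simp: K.HH.pure_closed fa\<close>)
    also have "\<dots> = comult K (f x)" using ij g \<phi> by (simp add: x fa K.comult_fam)
    finally show "comult K (f x) = tensor_map K K f f (comult H x)" by simp
    show "counit K (f x) = counit H x" using ij g \<phi> by (simp add: x fa K.counit_fam H.counit_fam)
    show "antipode K (f x) = f (antipode H x)" using ij g \<phi> by (simp add: x fa K.antipode_fam H.antipode_fam)
  qed
qed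

text \<open>Two representatives of a coset L g differ by a left factor from \<open>L\<close>, so by
  \<open>inv\<close> the chosen representative does not matter.\<close>

lemma (in hyp_family) fam_descend:
  assumes L: "L \<lhd> G" and inv: "\<And>i j l g. i \<in> {1..N} \<Longrightarrow> j \<in> {1..N} \<Longrightarrow> l \<in> L \<Longrightarrow> g \<in> carrier G \<Longrightarrow> a i j (l \<otimes>\<^bsub>G\<^esub> g) = a i j g"
  obtains b where "hyp_family N (G Mod L) B b"
    "\<And>i j g. i \<in> {1..N} \<Longrightarrow> j \<in> {1..N} \<Longrightarrow> g \<in> carrier G \<Longrightarrow> b i j (L #>\<^bsub>G\<^esub> g) = a i j g"
proof -
  interpret L: normal L G by (rule L)
  define b where "b i j C = a i j (SOME g. g \<in> carrier G \<and> C = L #>\<^bsub>G\<^esub> g)" for i j C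
  have b: "b i j (L #>\<^bsub>G\<^esub> g) = a i j g" if ij: "i \<in> {1..N}" "j \<in> {1..N}" and g: "g \<in> carrier G" for i j g
  proof -
    define h where "h = (SOME h. h \<in> carrier G \<and> L #>\<^bsub>G\<^esub> g = L #>\<^bsub>G\<^esub> h)"
    have h: "h \<in> carrier G \<and> L #>\<^bsub>G\<^esub> g = L #>\<^bsub>G\<^esub> h" unfolding h_def by (rule someI[of _ g]) (use g in simp)
    then have "h \<in> L #>\<^bsub>G\<^esub> g" using G.rcos_self[of h L] L.is_subgroup by simp
    then obtain l where "l \<in> L" "h = l \<otimes>\<^bsub>G\<^esub> g" by (auto simp: r_coset_def)
    then have "a i j h = a i j g" using inv ij g by simp
    then show ?thesis by (simp add: b_def h_def)
  qed
  have C: "thesis" if "C \<in> carrier (G Mod L)" "\<And>g. g \<in> carrier G \<Longrightarrow> C = L #>\<^bsub>G\<^esub> g \<Longrightarrow> thesis" for C thesis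
    using that by (auto simp: FactGroup_def RCOSETS_def)
  have m: "(L #>\<^bsub>G\<^esub> g) \<otimes>\<^bsub>G Mod L\<^esub> (L #>\<^bsub>G\<^esub> h) = L #>\<^bsub>G\<^esub> (g \<otimes>\<^bsub>G\<^esub> h)" if "g \<in> carrier G" "h \<in> carrier G" for g h
    using that by (simp add: FactGroup_def L.rcos_sum)
  have i: "inv\<^bsub>G Mod L\<^esub> (L #>\<^bsub>G\<^esub> g) = L #>\<^bsub>G\<^esub> (inv\<^bsub>G\<^esub> g)" if g: "g \<in> carrier G" for g
    using that L.inv_FactGroup[of "L #>\<^bsub>G\<^esub> g"] L.rcos_inv[OF g] G.rcosetsI[OF L.subset g] by (simp add: FactGroup_def)
  have o: "b i j \<one>\<^bsub>G Mod L\<^esub> = a i j \<one>\<^bsub>G\<^esub>" if "i \<in> {1..N}" "j \<in> {1..N}" for i j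
    using b[OF that G.one_closed] L.subset by (simp add: FactGroup_def G.coset_mult_one)
  have "hyp_family N (G Mod L) B b"
  proof (intro hyp_family.intro hyp_family_axioms.intro L.factorgroup_is_group B.staralg_axioms)
    show "b i j g \<in> carrier B" if "i \<in> {1..N}" "j \<in> {1..N}" "g \<in> carrier (G Mod L)" for i j g
      using that by (auto elim!: C simp: b)
    show "star B (b i j g) = b i j (inv\<^bsub>G Mod L\<^esub> g)" if "i \<in> {1..N}" "j \<in> {1..N}" "g \<in> carrier (G Mod L)" for i j g
      by (rule C[OF that(3)]) (use that(1,2) in \<open>simp add: b i fam_star\<close>)
    show "b i j g \<otimes>\<^bsub>B\<^esub> b i k h = (if j = k then b i j (g \<otimes>\<^bsub>G Mod L\<^esub> h) else \<zero>\<^bsub>B\<^esub>)"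
      if "i \<in> {1..N}" "j \<in> {1..N}" "k \<in> {1..N}" "g \<in> carrier (G Mod L)" "h \<in> carrier (G Mod L)" for i j k g h
      by (rule C[OF that(4)], rule C[OF that(5)]) (use that(1,2,3) in \<open>simp add: b m L.rcos_sum fam_row\<close>)
    show "b j i g \<otimes>\<^bsub>B\<^esub> b k i h = (if j = k then b j i (g \<otimes>\<^bsub>G Mod L\<^esub> h) else \<zero>\<^bsub>B\<^esub>)"
      if "i \<in> {1..N}" "j \<in> {1..N}" "k \<in> {1..N}" "g \<in> carrier (G Mod L)" "h \<in> carrier (G Mod L)" for i j k g h
      by (rule C[OF that(4)], rule C[OF that(5)]) (use that(1,2,3) in \<open>simp add: b m L.rcos_sum fam_col\<close>)
    show "(\<Oplus>\<^bsub>B\<^esub>k\<in>{1..N}. b i k \<one>\<^bsub>G Mod L\<^esub>) = \<one>\<^bsub>B\<^esub>" if i: "i \<in> {1..N}" for i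
    proof -
      have "(\<Oplus>\<^bsub>B\<^esub>k\<in>{1..N}. b i k \<one>\<^bsub>G Mod L\<^esub>) = (\<Oplus>\<^bsub>B\<^esub>k\<in>{1..N}. a i k \<one>\<^bsub>G\<^esub>)"
        by (rule B.finsum_cong') (use i in \<open>auto simp: o[unfolded one_FactGroup]\<close>)
      then show ?thesis using i by (simp add: fam_rsum)
    qed
    show "(\<Oplus>\<^bsub>B\<^esub>k\<in>{1..N}. b k i \<one>\<^bsub>G Mod L\<^esub>) = \<one>\<^bsub>B\<^esub>" if i: "i \<in> {1..N}" for i
    proof -
      have "(\<Oplus>\<^bsub>B\<^esub>k\<in>{1..N}. b k i \<one>\<^bsub>G Mod L\<^esub>) = (\<Oplus>\<^bsub>B\<^esub>k\<in>{1..N}. a k i \<one>\<^bsub>G\<^esub>)"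
        by (rule B.finsum_cong') (use i in \<open>auto simp: o[unfolded one_FactGroup]\<close>)
      then show ?thesis using i by (simp add: fam_csum)
    qed
  qed
  then show thesis using b that by blast
qed

section \<open>The exact sequence for a Hopf *-algebra satisfying the row sum relations\<close>

locale hopf_hyp_rel = hopf_hyp H N G a + L: normal L G
  for H :: "('b, 'y) hopf_star_alg_scheme" (structure) and N :: nat and G :: "('g, 'x) monoid_scheme" and a and L +
  assumes rows: "i \<in> {1..N} \<Longrightarrow> j \<in> {1..N} \<Longrightarrow> l \<in> L \<Longrightarrow> fam.rs i l = fam.rs j l"
    and N: "N \<ge> 1"
begin

lemma one_ix [simp]: "1 \<in> {1..N}"
  using N by (simp add: atLeastAtMost_iff)

abbreviation "K \<equiv> G\<lparr>carrier := L\<rparr>"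

lemma Lc [simp]: "l \<in> L \<Longrightarrow> l \<in> carrier G"
  using L.subset by auto

sublocale K: group_algebra K
  using fam.G.subgroup_imp_group[OF L.is_subgroup] by (simp add: group_algebra_def)

lemma inv_K: "l \<in> L \<Longrightarrow> inv\<^bsub>K\<^esub> l = inv\<^bsub>G\<^esub> l"
  using fam.G.m_inv_consistent[OF L.is_subgroup] .

text \<open>Row 1 is an arbitrary choice, available because N is at least 1 and immaterial by
  \<open>rows\<close>.\<close>

definition "r l = fam.rs 1 l"

lemma r_closed [simp]: "l \<in> L \<Longrightarrow> r l \<in> carrier H"
  by (simp add: r_def)

lemma r_mult: "l \<in> L \<Longrightarrow> m \<in> L \<Longrightarrow> r l \<otimes> r m = r (l \<otimes>\<^bsub>G\<^esub> m)"
  by (simp add: r_def fam.rs_mult)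

lemma r_one: "r \<one>\<^bsub>G\<^esub> = \<one>"
  by (simp add: r_def fam.rs_one)

lemma r_star: "l \<in> L \<Longrightarrow> star H (r l) = r (inv\<^bsub>G\<^esub> l)"
  by (simp add: r_def fam.rs_star)

text \<open>The row sum is first moved to row i, where row orthogonality applies.\<close>

lemma r_fam: "l \<in> L \<Longrightarrow> i \<in> {1..N} \<Longrightarrow> j \<in> {1..N} \<Longrightarrow> g \<in> carrier G \<Longrightarrow> r l \<otimes> a i j g = a i j (l \<otimes>\<^bsub>G\<^esub> g)"
  unfolding r_def by (subst rows[of 1 i l]) (simp_all add: fam.rs_fam)

lemma fam_r: "l \<in> L \<Longrightarrow> i \<in> {1..N} \<Longrightarrow> j \<in> {1..N} \<Longrightarrow> g \<in> carrier G \<Longrightarrow> a i j g \<otimes> r l = a i j (g \<otimes>\<^bsub>G\<^esub> l)"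
  unfolding r_def by (subst rows[of 1 i l]) (simp_all add: fam.fam_rs)

lemma r_comult: "l \<in> L \<Longrightarrow> \<Delta> (r l) = pure_tensor H H (r l) (r l)"
  unfolding r_def by (rule comult_rs_eq[OF one_ix Lc rows[OF _ one_ix]])

lemma r_counit: "l \<in> L \<Longrightarrow> \<epsilon> (r l) = 1"
  unfolding r_def by (rule counit_rs) auto

lemma r_antipode: "l \<in> L \<Longrightarrow> S (r l) = r (inv\<^bsub>G\<^esub> l)"
proof -
  assume l: "l \<in> L"
  have "S (r l) = fam.cs 1 (inv\<^bsub>G\<^esub> l)" using l by (simp add: r_def antipode_rs)
  also have "\<dots> = r (inv\<^bsub>G\<^esub> l)" unfolding r_def by (rule fam.cs_eq_rs[OF one_ix one_ix _ rows[OF _ one_ix]]) (use l in simp_all)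
  finally show ?thesis .
qed

definition "\<iota> = lin_ext H r"

lemma \<iota>_hom: "star_hom K.GA.MA H \<iota>"
  unfolding \<iota>_def by (rule K.GA.lin_ext_star_hom[OF alg]) (simp_all add: r_mult r_one r_star inv_K)

lemma \<iota>_elt: "l \<in> L \<Longrightarrow> \<iota> (group_elt l) = r l"
  unfolding \<iota>_def by (rule K.lin_ext_group_elt[OF alg]) auto

lemma \<iota>_hopf: "hopf_star_hom (dual_group K) H \<iota>"
proof (rule hopf_star_hom_on_generators[OF K.pre_hopf_dual_group pre_hopf _ K.dual_group_generates])
  show "star_hom (dual_group K) H \<iota>" using \<iota>_hom by (simp add: K.dual_group_simps)
  fix x assume "x \<in> group_elt ` carrier K"
  then obtain l where l: "l \<in> L" and x: "x = group_elt l" by auto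
  have lK: "l \<in> carrier K" using l by simp
  have "tensor_map H H \<iota> \<iota> (comult (dual_group K) x) = pure_tensor H H (r l) (r l)"
    unfolding x K.dual_group_elt(1)[OF lK]
    by (subst tensor_map_pure[OF K.GA.staralg_MA K.GA.staralg_MA alg alg star_hom_lin[OF \<iota>_hom] star_hom_lin[OF \<iota>_hom]])
      (use l in \<open>simp_all add: K.group_elt_closed \<iota>_elt\<close>)
  then show "comult H (\<iota> x) = tensor_map H H \<iota> \<iota> (comult (dual_group K) x)"
    using l by (simp add: x \<iota>_elt r_comult)
  show "counit H (\<iota> x) = counit (dual_group K) x" using l lK by (simp add: x \<iota>_elt r_counit K.dual_group_elt)
  show "antipode H (\<iota> x) = \<iota> (antipode (dual_group K) x)"
    unfolding x K.dual_group_elt(3)[OF lK] inv_K[OF l] using l by (simp add: \<iota>_elt r_antipode)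
qed

definition "I = \<iota> ` {b \<in> carrier (dual_group K). counit (dual_group K) b = 0}"
text \<open>The images of the elements \<lambda> - 1, which span the augmentation ideal of a group
  algebra.\<close>

definition "D = {r l \<ominus> \<one> | l. l \<in> L}"

lemma I_subset: "I \<subseteq> carrier H"
  unfolding I_def using star_homD(1)[OF \<iota>_hom] by (auto simp: K.dual_group_simps)

lemma D_subset: "D \<subseteq> carrier H"
  unfolding D_def by auto

lemma dual_counit_hom: "star_hom K.GA.MA complex_alg (counit (dual_group K))"
  using K.pre_hopf_dual_group by (simp add: pre_hopf_def K.dual_group_simps)

lemma I_star: "x \<in> I \<Longrightarrow> star H x \<in> I"
proof -
  interpret KA: staralg K.GA.MA by (rule K.GA.staralg_MA)
  assume "x \<in> I"
  then obtain b where b: "x = \<iota> b" "b \<in> carrier K.GA.MA" "counit (dual_group K) b = 0" by (auto simp: I_def K.dual_group_simps)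
  then have "star H x = \<iota> (star K.GA.MA b)" "counit (dual_group K) (star K.GA.MA b) = 0"
    using star_homD(6)[OF \<iota>_hom] star_homD(6)[OF dual_counit_hom] by auto
  then show ?thesis using b by (auto simp: I_def K.dual_group_simps)
qed

lemma D_I: "D \<subseteq> I"
proof
  interpret KA: staralg K.GA.MA by (rule K.GA.staralg_MA)
  fix x assume "x \<in> D"
  then obtain l where l: "l \<in> L" and x: "x = r l \<ominus> \<one>" by (auto simp: D_def)
  let ?b = "group_elt l \<ominus>\<^bsub>K.GA.MA\<^esub> \<one>\<^bsub>K.GA.MA\<^esub>"
  have c: "group_elt l \<in> carrier K.GA.MA" using l by (simp add: K.group_elt_closed)
  have "\<iota> ?b = x" using l c
    by (simp add: lin_hom_minus[OF K.GA.staralg_MA alg star_hom_lin[OF \<iota>_hom]] star_homD(4)[OF \<iota>_hom] \<iota>_elt x)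
  moreover have "counit (dual_group K) ?b = counit (dual_group K) (group_elt l) \<ominus>\<^bsub>complex_alg\<^esub> counit (dual_group K) \<one>\<^bsub>K.GA.MA\<^esub>"
    using c by (intro lin_hom_minus[OF K.GA.staralg_MA staralg_complex star_hom_lin[OF dual_counit_hom]]) auto
  then have "counit (dual_group K) ?b = 0"
    using l staralg.minus_eq_smult[OF staralg_complex] star_homD(4)[OF dual_counit_hom]
    by (simp add: K.dual_group_elt)
  ultimately show "x \<in> I" using c by (auto simp: I_def K.dual_group_simps intro!: image_eqI[of _ _ ?b])
qed

lemma I_D: "I \<subseteq> lin_span H D"
proof -
  interpret KA: staralg K.GA.MA by (rule K.GA.staralg_MA)
  note cl = lin_span_closed[OF alg D_subset]
  note \<iota>D = star_homD[OF \<iota>_hom] lin_hom_zero[OF K.GA.staralg_MA alg star_hom_lin[OF \<iota>_hom]]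
  note eD = star_homD[OF dual_counit_hom] lin_hom_zero[OF K.GA.staralg_MA staralg_complex star_hom_lin[OF dual_counit_hom]]
  \<comment> \<open>Subtracting the counit makes the claim meaningful for every p, so that it can be
    proved term by term; partial sums of an element of the augmentation ideal need not lie in that
    ideal.\<close>
  have "\<iota> p \<ominus> counit (dual_group K) p \<odot> \<one> \<in> lin_span H D" if "p \<in> carrier K.GA.MA" for p
    using that
  proof (induct rule: K.GA.MA_induct)
    case zero
    then show ?case using \<iota>D(7) eD(7) cl(1) by (simp add: K.GA.MA_zero H.minus_eq)
  next
    case (add l c p)
    have l: "l \<in> L" using add by simp
    have s: "Poly_Mapping.single l c = c \<odot>\<^bsub>K.GA.MA\<^esub> group_elt l" by (simp add: group_elt_def K.GA.MA_smult_single)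
    have gc: "group_elt l \<in> carrier K.GA.MA" using l by (simp add: K.group_elt_closed)
    have i: "\<iota> (Poly_Mapping.single l c + p) = c \<odot> r l \<oplus> \<iota> p"
      using \<iota>D(2)[of "Poly_Mapping.single l c" p] add l gc by (simp add: s \<iota>D(5) \<iota>_elt K.GA.MA_add)
    have e: "counit (dual_group K) (Poly_Mapping.single l c + p) = c + counit (dual_group K) p"
      using eD(2)[of "Poly_Mapping.single l c" p] add l gc by (simp add: s eD(5) K.dual_group_elt K.GA.MA_add)
    have "c \<odot> (r l \<ominus> \<one>) \<oplus> (\<iota> p \<ominus> counit (dual_group K) p \<odot> \<one>) \<in> lin_span H D"
      using cl(3)[OF lin_span_base[of "r l \<ominus> \<one>" D]] cl(2) add l by (auto simp: D_def)
    moreover have "c \<odot> (r l \<ominus> \<one>) \<oplus> (\<iota> p \<ominus> counit (dual_group K) p \<odot> \<one>) =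
        \<iota> (Poly_Mapping.single l c + p) \<ominus> counit (dual_group K) (Poly_Mapping.single l c + p) \<odot> \<one>"
      unfolding i e using l \<iota>D(1)[OF add(2)]
      by (simp add: H.minus_eq_smult H.smult_r_distr H.smult_smult H.smult_l_distr H.a_ac)
    ultimately show ?case by simp
  qed
  note * = this
  show ?thesis
  proof
    fix x assume "x \<in> I"
    then obtain b where b: "x = \<iota> b" "b \<in> carrier K.GA.MA" "counit (dual_group K) b = 0" by (auto simp: I_def K.dual_group_simps)
    then show "x \<in> lin_span H D" using *[OF b(2)] \<iota>D(1)[OF b(2)] by (simp add: H.minus_eq)
  qed
qed

definition "IA = lin_span H {x \<otimes> b | x b. x \<in> I \<and> b \<in> carrier H}"
definition "AI = lin_span H {b \<otimes> x | b x. b \<in> carrier H \<and> x \<in> I}"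

lemma D_fam:
  assumes l: "l \<in> L" and ij: "i \<in> {1..N}" "j \<in> {1..N}" and g: "g \<in> carrier G"
  shows "(r l \<ominus> \<one>) \<otimes> a i j g = a i j (l \<otimes>\<^bsub>G\<^esub> g) \<ominus> a i j g"
    "a i j g \<otimes> (r l \<ominus> \<one>) = a i j (g \<otimes>\<^bsub>G\<^esub> l) \<ominus> a i j g"
  using assms by (simp_all add: H.minus_eq_smult H.l_distr H.r_distr H.smult_mult_l H.smult_mult_r r_fam fam_r)

lemma IA_eq_AI: "IA = AI"
proof
  let ?G = "{a i j g | i j g. i \<in> {1..N} \<and> j \<in> {1..N} \<and> g \<in> carrier G}"
  show "IA \<subseteq> AI"
    unfolding IA_def AI_def
  proof (rule span_right_mult_subset[OF alg generates_fam I_subset D_I I_D])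
    fix d x assume "d \<in> D" and "x \<in> ?G"
    then obtain l i j g where l: "l \<in> L" "d = r l \<ominus> \<one>" and x: "x = a i j g" "i \<in> {1..N}" "j \<in> {1..N}" "g \<in> carrier G"
      unfolding D_def by blast
    \<comment> \<open>Conjugation chosen so that g l' = l g. Then (r(l) - 1) a_ij(g) = a_ij(lg) -
      a_ij(g) = a_ij(g) (r(l') - 1), and l' is in \<open>L\<close> by normality.\<close>
    let ?l = "inv\<^bsub>G\<^esub> g \<otimes>\<^bsub>G\<^esub> l \<otimes>\<^bsub>G\<^esub> g"
    have l': "?l \<in> L" using l x L.inv_op_closed1 by simp
    have "g \<otimes>\<^bsub>G\<^esub> ?l = l \<otimes>\<^bsub>G\<^esub> g" using l x by (simp add: fam.G.m_assoc[symmetric])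
    then have "d \<otimes> x = a i j g \<otimes> (r ?l \<ominus> \<one>)" using l l' x by (simp add: D_fam)
    moreover have "r ?l \<ominus> \<one> \<in> I" using l' D_I unfolding D_def by blast
    moreover have "a i j g \<in> carrier H" using x by simp
    ultimately show "d \<otimes> x \<in> lin_span H {b \<otimes> x | b x. b \<in> carrier H \<and> x \<in> I}" by (intro lin_span_base) blast
  qed
  have "lin_span (opposite H) {x \<otimes>\<^bsub>opposite H\<^esub> b | x b. x \<in> I \<and> b \<in> carrier (opposite H)} \<subseteq>
    lin_span (opposite H) {b \<otimes>\<^bsub>opposite H\<^esub> x | b x. b \<in> carrier (opposite H) \<and> x \<in> I}"
  proof (rule span_right_mult_subset[OF staralg_opposite[OF alg] _ _ D_I])
    show "generates (opposite H) ?G" using generates_fam by simp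
    show "I \<subseteq> carrier (opposite H)" "I \<subseteq> lin_span (opposite H) D" using I_subset I_D by simp_all
    fix d x assume "d \<in> D" and "x \<in> ?G"
    then obtain l i j g where l: "l \<in> L" "d = r l \<ominus> \<one>" and x: "x = a i j g" "i \<in> {1..N}" "j \<in> {1..N}" "g \<in> carrier G"
      unfolding D_def by blast
    \<comment> \<open>In the opposite algebra the roles of left and right change, so the conjugation
      goes the other way: l' g = g l.\<close>
    let ?l = "g \<otimes>\<^bsub>G\<^esub> l \<otimes>\<^bsub>G\<^esub> inv\<^bsub>G\<^esub> g"
    have l': "?l \<in> L" using l x L.inv_op_closed2 by simp
    have "?l \<otimes>\<^bsub>G\<^esub> g = g \<otimes>\<^bsub>G\<^esub> l" using l x by (simp add: fam.G.m_assoc)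
    then have "x \<otimes> d = (r ?l \<ominus> \<one>) \<otimes> a i j g" using l l' x by (simp add: D_fam)
    moreover have "r ?l \<ominus> \<one> \<in> I" using l' D_I unfolding D_def by blast
    moreover have "a i j g \<in> carrier H" using x by simp
    ultimately have "x \<otimes> d \<in> lin_span H {x \<otimes> b | b x. b \<in> carrier H \<and> x \<in> I}" by (intro lin_span_base) blast
    then show "d \<otimes>\<^bsub>opposite H\<^esub> x \<in> lin_span (opposite H) {b \<otimes>\<^bsub>opposite H\<^esub> x | b x. b \<in> carrier (opposite H) \<and> x \<in> I}" by simp
  qed
  moreover have "{b \<otimes> x | x b. x \<in> I \<and> b \<in> carrier H} = {b \<otimes> x | b x. b \<in> carrier H \<and> x \<in> I}"
    "{x \<otimes> b | b x. b \<in> carrier H \<and> x \<in> I} = {x \<otimes> b | x b. x \<in> I \<and> b \<in> carrier H}" by blast+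
  ultimately show "AI \<subseteq> IA" unfolding IA_def AI_def by simp
qed

lemma star_ideal_AI: "star_ideal AI H"
  unfolding AI_def by (rule star_ideal_span_products[OF alg I_subset I_star IA_eq_AI[unfolded IA_def AI_def]])

lemma D_AI: "D \<subseteq> AI"
proof
  fix d assume "d \<in> D"
  then have "d \<in> I" "d = \<one> \<otimes> d" using D_I D_subset by auto
  then show "d \<in> AI" unfolding AI_def by (intro lin_span_base) blast
qed

text \<open>Shows that \<open>AI\<close>, given as a span of products, is the *-ideal generated by
  \<open>D\<close>, as \<open>hopf_star_idealI\<close> requires. It also reduces the vanishing of p
  on \<open>AI\<close> to p(r(l)) = 1.\<close>

lemma AI_minimal:
  assumes M: "star_ideal M H" and "D \<subseteq> M"
  shows "AI \<subseteq> M"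
proof -
  have "lin_span H D \<subseteq> M" by (rule lin_span_minimal[OF star_ideal_submodule[OF alg M] assms(2)])
  then have "I \<subseteq> M" using I_D by auto
  then have "{b \<otimes> x | b x. b \<in> carrier H \<and> x \<in> I} \<subseteq> M" using star_ideal_closed(7)[OF alg M] by auto
  then show ?thesis unfolding AI_def by (rule lin_span_minimal[OF star_ideal_submodule[OF alg M]])
qed

lemma hopf_star_ideal_AI: "hopf_star_ideal AI H"
proof (rule hopf_star_idealI[OF star_ideal_AI AI_minimal D_subset])
  note clK = star_ideal_closed[OF HH.staralg_tensor star_ideal_coideal_set[OF star_ideal_AI]]
  fix d assume dD: "d \<in> D"
  then obtain l where l: "l \<in> L" and d: "d = r l \<ominus> \<one>" by (auto simp: D_def)
  have li: "inv\<^bsub>G\<^esub> l \<in> L" using l by simp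
  have dc: "d \<in> carrier H" using l d by simp
  have rd: "r l = d \<oplus> \<one>" using l by (simp add: d H.minus_eq H.a_assoc H.l_neg)
  note b = bilinD[OF HH.bilin_pure]
  \<comment> \<open>With r(l) = d + 1 this expands to r \<otimes> r - 1 \<otimes> 1 = d \<otimes> r
    + 1 \<otimes> d, and each summand has a leg in \<open>AI\<close>.\<close>
  have "pure_tensor H H (r l) (r l) = pure_tensor H H d (r l) \<oplus>\<^bsub>tensor H H\<^esub> (pure_tensor H H \<one> d \<oplus>\<^bsub>tensor H H\<^esub> pure_tensor H H \<one> \<one>)"
    unfolding b(3)[OF H.one_closed dc H.one_closed, symmetric] rd[symmetric]
    unfolding b(2)[OF dc H.one_closed r_closed[OF l], symmetric] rd[symmetric] ..
  then have "\<Delta> (r l) \<ominus>\<^bsub>tensor H H\<^esub> \<one>\<^bsub>tensor H H\<^esub> = pure_tensor H H d (r l) \<oplus>\<^bsub>tensor H H\<^esub> pure_tensor H H \<one> d"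
    using l dc by (simp add: r_comult HH.tensor_one T.minus_eq T.a_assoc T.r_neg HH.pure_closed)
  moreover have "\<Delta> d = \<Delta> (r l) \<ominus>\<^bsub>tensor H H\<^esub> \<one>\<^bsub>tensor H H\<^esub>"
    using l lin_hom_minus[OF alg HH.staralg_tensor star_hom_lin[OF comult], of "r l" \<one>] star_homD(4)[OF comult] by (simp add: d)
  moreover have "d \<in> AI" using dD D_AI by auto
  ultimately show "\<Delta> d \<in> coideal_set AI" using l by (simp add: clK coideal_base)
  have "\<epsilon> d = \<epsilon> (r l) + \<epsilon> ((-1) \<odot> \<one>)" using l by (simp add: d H.minus_eq_smult \<epsilon>_simps)
  then show "\<epsilon> d = 0" using l by (simp add: \<epsilon>_simps r_counit)
  have "S d = r (inv\<^bsub>G\<^esub> l) \<ominus> \<one>" using l li by (simp add: d H.minus_eq_smult S_simps r_antipode)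
  then show "S d \<in> AI" using D_AI li unfolding D_def by blast
qed

sublocale Q: hopf_quotient H AI
  by unfold_locales (rule hopf_star_ideal_AI)

lemma quot_fam:
  assumes "l \<in> L" "i \<in> {1..N}" "j \<in> {1..N}" "g \<in> carrier G"
  shows "Q.Q.q (a i j (l \<otimes>\<^bsub>G\<^esub> g)) = Q.Q.q (a i j g)"
proof -
  have "r l \<ominus> \<one> \<in> AI" using D_AI assms(1) unfolding D_def by blast
  then have "(r l \<ominus> \<one>) \<otimes> a i j g \<in> AI"
    by (rule star_ideal_closed(6)[OF alg star_ideal_AI]) (use assms in simp)
  then show ?thesis using assms by (simp add: D_fam Q.Q.quot_eq_iff)
qed

text \<open>The assumption \<open>univ\<close> is the universal property of the third algebra, for
  targets of the type of H/AI. It is applied to that quotient and yields the inverse of the induced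
  map.\<close>

lemma exact:
  assumes K: "hopf_hyp K' N (G Mod L) b" and univ: "\<And>C c. hyp_family N (G Mod L) C c \<Longrightarrow>
      \<exists>f. star_hom K' (C :: 'b set star_alg) f \<and> (\<forall>i\<in>{1..N}. \<forall>j\<in>{1..N}. \<forall>g\<in>carrier (G Mod L). f (b i j g) = c i j g)"
    and inj: "inj_on \<iota> (carrier (dual_group K))"
    and p: "star_hom H K' p" and pa: "\<And>i j g. i \<in> {1..N} \<Longrightarrow> j \<in> {1..N} \<Longrightarrow> g \<in> carrier G \<Longrightarrow> p (a i j g) = b i j (L #>\<^bsub>G\<^esub> g)"
  shows "exact_sequence (dual_group K) \<iota> H p K'"
proof -
  interpret K': hopf_hyp K' N "G Mod L" b by (rule K)
  have hom: "(\<lambda>g. L #>\<^bsub>G\<^esub> g) \<in> hom G (G Mod L)" by (rule L.r_coset_hom_Mod)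
  then interpret h: group_hom G "G Mod L" "\<lambda>g. L #>\<^bsub>G\<^esub> g" by unfold_locales
  have ph: "hopf_star_hom H K' p"
    by (rule hopf_hyp_hom[OF hopf_hyp_axioms K p, of "\<lambda>g. L #>\<^bsub>G\<^esub> g"]) (simp_all add: pa)
  have pr: "p (r l) = \<one>\<^bsub>K'\<^esub>" if l: "l \<in> L" for l
  proof -
    have e: "L #>\<^bsub>G\<^esub> l = \<one>\<^bsub>G Mod L\<^esub>" using l by (simp add: FactGroup_def fam.G.coset_join2 L.is_subgroup)
    have "p (r l) = (\<Oplus>\<^bsub>K'\<^esub>k\<in>{1..N}. p (a 1 k l))"
      unfolding r_def fam.rs_def by (rule lin_hom_finsum[OF alg K'.alg star_hom_lin[OF p]]) (use l in auto)
    also have "\<dots> = (\<Oplus>\<^bsub>K'\<^esub>k\<in>{1..N}. b 1 k \<one>\<^bsub>G Mod L\<^esub>)"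
      by (rule K'.H.finsum_cong') (use l K'.fam.fam_closed[OF _ _ K'.fam.G.one_closed] in \<open>auto simp: pa e\<close>)
    also have "\<dots> = \<one>\<^bsub>K'\<^esub>" by (rule K'.fam.fam_rsum) simp
    finally show ?thesis .
  qed
  have kills: "p x = \<zero>\<^bsub>K'\<^esub>" if "x \<in> AI" for x
  proof -
    have "D \<subseteq> {x \<in> carrier H. p x = \<zero>\<^bsub>K'\<^esub>}"
      using D_subset by (auto simp: D_def lin_hom_minus[OF alg K'.alg star_hom_lin[OF p]] pr star_homD(4)[OF p]
        K'.H.minus_eq K'.H.r_neg)
    from AI_minimal[OF star_ideal_kernel[OF alg K'.alg p] this] that show ?thesis by auto
  qed
  define \<theta> where "\<theta> X = the_elem (p ` X)" for X
  have \<theta>h: "hopf_star_hom Q.Q K' \<theta>"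
    unfolding \<theta>_def[abs_def] by (rule Q.quot_lift_hopf[OF K'.pre_hopf ph kills])
  have \<theta>q: "\<theta> (Q.Q.q x) = p x" if "x \<in> carrier H" for x
    unfolding \<theta>_def by (rule Q.Q.quot_lift[OF K'.alg star_hom_lin[OF p] kills that])
  have fq: "hyp_family N G (star_quot H AI) (\<lambda>i j g. Q.Q.q (a i j g))"
    by (rule fam.fam_image[OF Q.Q.staralg_quot Q.Q.star_hom_quot])
  obtain c where c: "hyp_family N (G Mod L) (star_quot H AI) c"
    "\<And>i j g. i \<in> {1..N} \<Longrightarrow> j \<in> {1..N} \<Longrightarrow> g \<in> carrier G \<Longrightarrow> c i j (L #>\<^bsub>G\<^esub> g) = Q.Q.q (a i j g)"
    using hyp_family.fam_descend[OF fq L.normal_axioms quot_fam] by blast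
  from univ[OF c(1)] obtain \<psi> where \<psi>: "star_hom K' (star_quot H AI) \<psi>"
    "\<forall>i\<in>{1..N}. \<forall>j\<in>{1..N}. \<forall>g\<in>carrier (G Mod L). \<psi> (b i j g) = c i j g" by blast
  \<comment> \<open>The coset of x can be recovered from p(x), which makes \<theta> injective. For
    this, \<psi> only has to be a *-homomorphism.\<close>
  have \<psi>p: "\<psi> (p x) = Q.Q.q x" if "x \<in> carrier H" for x
  proof (rule star_hom_eq_on_generators[OF alg generates_fam star_hom_comp[OF p \<psi>(1)] Q.Q.star_hom_quot _ that])
    fix x assume "x \<in> {a i j g | i j g. i \<in> {1..N} \<and> j \<in> {1..N} \<and> g \<in> carrier G}"
    then obtain i j g where "i \<in> {1..N}" "j \<in> {1..N}" "g \<in> carrier G" "x = a i j g" by blast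
    then show "\<psi> (p x) = Q.Q.q x" using \<psi>(2) by (simp add: pa c)
  qed
  have surj: "p ` carrier H = carrier K'"
  proof (rule surj_on_generators[OF alg K'.alg p K'.generates_fam])
    show "{b i j g |i j g. i \<in> {1..N} \<and> j \<in> {1..N} \<and> g \<in> carrier (G Mod L)} \<subseteq> p ` carrier H"
    proof
      fix y assume "y \<in> {b i j g |i j g. i \<in> {1..N} \<and> j \<in> {1..N} \<and> g \<in> carrier (G Mod L)}"
      then obtain i j C where y: "y = b i j C" "i \<in> {1..N}" "j \<in> {1..N}" "C \<in> carrier (G Mod L)" by blast
      then obtain g where g: "g \<in> carrier G" "C = L #>\<^bsub>G\<^esub> g" by (auto simp: FactGroup_def RCOSETS_def)
      show "y \<in> p ` carrier H" by (rule image_eqI[of _ _ "a i j g"]) (use y g pa in auto)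
    qed
  qed
  have "bij_betw \<theta> (carrier Q.Q) (carrier K')"
    unfolding bij_betw_def Q.carrier_Q
  proof
    show "inj_on \<theta> (Q.Q.q ` carrier H)"
    proof (rule inj_onI)
      fix X Y assume "X \<in> Q.Q.q ` carrier H" "Y \<in> Q.Q.q ` carrier H" and e: "\<theta> X = \<theta> Y"
      then obtain x y where x: "X = Q.Q.q x" "x \<in> carrier H" and y: "Y = Q.Q.q y" "y \<in> carrier H" by blast
      then have "p x = p y" using e \<theta>q by simp
      then have "Q.Q.q x = Q.Q.q y" using \<psi>p x(2) y(2) by metis
      then show "X = Y" using x y by simp
    qed
    show "\<theta> ` Q.Q.q ` carrier H = carrier K'" using surj \<theta>q by (simp add: image_image)
  qed
  then have "hopf_star_iso Q.Q K' \<theta>" using \<theta>h by (simp add: hopf_star_iso_def)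
  moreover have "p x = \<theta> (Q.Q.q x)" if "x \<in> carrier H" for x using \<theta>q[OF that] by simp
  ultimately have "\<exists>\<theta>. hopf_star_iso Q.Q K' \<theta> \<and> (\<forall>x\<in>carrier H. p x = \<theta> (Q.Q.q x))" by blast
  then show ?thesis
    unfolding exact_sequence_def Let_def I_def[symmetric] IA_def[symmetric] AI_def[symmetric]
    using K.hopf_dual_group cqg K'.hopf \<iota>_hopf inj ph IA_eq_AI hopf_star_ideal_AI by blast
qed

end

section \<open>The quotient by the row sum relations\<close>

locale rel_presentation = hyp_presentation N G + L: subgroup L G
  for N :: nat and G :: "('g, 'x) monoid_scheme" and L +
  assumes N: "N \<ge> 1"
begin

abbreviation "H \<equiv> hyp N G"

definition "row_rels = {hyp.fam.rs i g \<ominus>\<^bsub>H\<^esub> hyp.fam.rs j g | i j g. i \<in> {1..N} \<and> j \<in> {1..N} \<and> g \<in> L}"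
text \<open>Every Hopf *-ideal containing the relations contains \<open>J\<close>, so
  \<open>J\<close> equals \<open>rel_hyp_ideal\<close> as soon as it is itself a Hopf
  *-ideal.\<close>

definition "J = star_ideal_gen H row_rels"

lemma row_relsI: "i \<in> {1..N} \<Longrightarrow> j \<in> {1..N} \<Longrightarrow> g \<in> L \<Longrightarrow> hyp.fam.rs i g \<ominus>\<^bsub>H\<^esub> hyp.fam.rs j g \<in> row_rels"
  unfolding row_rels_def mem_Collect_eq by (intro exI conjI) (rule refl)

lemma row_relsE:
  assumes "x \<in> row_rels"
  obtains i j g where "x = hyp.fam.rs i g \<ominus>\<^bsub>H\<^esub> hyp.fam.rs j g" "i \<in> {1..N}" "j \<in> {1..N}" "g \<in> L"
  using assms unfolding row_rels_def mem_Collect_eq by (elim exE conjE)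

lemma one_ix: "1 \<in> {1..N}"
  using N by (simp add: atLeastAtMost_iff)

lemma row_rels_subset: "row_rels \<subseteq> carrier H"
proof
  fix x assume "x \<in> row_rels"
  then obtain i j g where "x = hyp.fam.rs i g \<ominus>\<^bsub>H\<^esub> hyp.fam.rs j g" "i \<in> {1..N}" "j \<in> {1..N}" "g \<in> L"
    by (rule row_relsE)
  moreover from this(4) have "g \<in> carrier G" by (rule subsetD[OF L.subset])
  ultimately show "x \<in> carrier H" by (simp only: hyp.H.minus_closed hyp.fam.rs_closed)
qed

lemma star_ideal_J: "star_ideal J H"
  unfolding J_def by (rule star_ideal_gen_ideal[OF hyp.alg row_rels_subset])

lemma row_rels_J: "row_rels \<subseteq> J"
  unfolding J_def by (rule subsetI) (rule star_ideal_gen_base)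

lemma J_minimal: "star_ideal M H \<Longrightarrow> row_rels \<subseteq> M \<Longrightarrow> J \<subseteq> M"
  unfolding J_def by (rule star_ideal_gen_minimal)

lemma rs_diff_J: "i \<in> {1..N} \<Longrightarrow> j \<in> {1..N} \<Longrightarrow> g \<in> L \<Longrightarrow> hyp.fam.rs i g \<ominus>\<^bsub>H\<^esub> hyp.fam.rs j g \<in> J"
  by (rule subsetD[OF row_rels_J row_relsI])

lemma rs_hom:
  assumes B: "staralg B" and f: "star_hom H B f" and i: "i \<in> {1..N}" and g: "g \<in> carrier G"
  shows "f (hyp.fam.rs i g) = (\<Oplus>\<^bsub>B\<^esub>k\<in>{1..N}. f (a i k g))"
  unfolding hyp.fam.rs_def by (rule lin_hom_finsum[OF hyp.alg B star_hom_lin[OF f]]) (use i g in auto)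

text \<open>A homomorphism that identifies the row sums for \<Lambda> has all generators of
  \<open>J\<close> in its kernel.\<close>

lemma kills_J:
  assumes B: "staralg B" and f: "star_hom H B f"
    and eq: "\<And>i j g. i \<in> {1..N} \<Longrightarrow> j \<in> {1..N} \<Longrightarrow> g \<in> L \<Longrightarrow> f (hyp.fam.rs i g) = f (hyp.fam.rs j g)"
    and x: "x \<in> J"
  shows "f x = \<zero>\<^bsub>B\<^esub>"
proof -
  interpret B: staralg B by (rule B)
  have z: "f (hyp.fam.rs i g \<ominus>\<^bsub>H\<^esub> hyp.fam.rs j g) = \<zero>\<^bsub>B\<^esub>" if ij: "i \<in> {1..N}" "j \<in> {1..N}" and g: "g \<in> L" for i j g
  proof -
    have c: "hyp.fam.rs i g \<in> carrier H" "hyp.fam.rs j g \<in> carrier H" using ij g L.subset by auto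
    have "f (hyp.fam.rs i g \<ominus>\<^bsub>H\<^esub> hyp.fam.rs j g) = f (hyp.fam.rs i g) \<ominus>\<^bsub>B\<^esub> f (hyp.fam.rs j g)"
      by (rule lin_hom_minus[OF hyp.alg B star_hom_lin[OF f] c])
    then show ?thesis unfolding eq[OF ij g] using star_homD(1)[OF f c(2)] by (simp add: B.minus_eq B.r_neg)
  qed
  have "row_rels \<subseteq> {x \<in> carrier H. f x = \<zero>\<^bsub>B\<^esub>}"
  proof
    fix x assume x: "x \<in> row_rels"
    then have "f x = \<zero>\<^bsub>B\<^esub>" by (rule row_relsE) (simp only: z)
    then show "x \<in> {x \<in> carrier H. f x = \<zero>\<^bsub>B\<^esub>}" using subsetD[OF row_rels_subset x] by simp
  qed
  from J_minimal[OF star_ideal_kernel[OF hyp.alg B f] this] x show ?thesis by auto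
qed

text \<open>In \<Delta>(r_i) = \<Sum>_k a_ik(g) \<otimes> r_k each r_k may be replaced by r_1 modulo
  H \<otimes> J; the sum then collapses to r_i \<otimes> r_1.\<close>

lemma comult_rs_mod_J:
  assumes i: "i \<in> {1..N}" and g: "g \<in> L"
  obtains t where "t \<in> hyp.coideal_set J"
    "comult H (hyp.fam.rs i g) = t \<oplus>\<^bsub>tensor H H\<^esub> pure_tensor H H (hyp.fam.rs i g) (hyp.fam.rs 1 g)"
proof -
  let ?p = "pure_tensor H H" and ?T = "tensor H H" and ?r = "\<lambda>i. hyp.fam.rs i g"
  note K = hyp.star_ideal_coideal_set[OF star_ideal_J]
  have gG: "g \<in> carrier G" using g L.subset by auto
  have rc: "?r k \<in> carrier H" if "k \<in> {1..N}" for k using that gG by simp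
  have ac: "a i k g \<in> carrier H" if "k \<in> {1..N}" for k using i that gG by simp
  note rd = hyp.H.minus_closed[OF rc rc[OF one_ix]]
  let ?t = "\<Oplus>\<^bsub>?T\<^esub>k\<in>{1..N}. ?p (a i k g) (?r k \<ominus>\<^bsub>H\<^esub> ?r 1)"
  have "?t \<in> hyp.coideal_set J"
    by (rule star_ideal_finsum[OF hyp.HH.staralg_tensor K])
      (use ac rs_diff_J[OF _ one_ix g] in \<open>auto intro!: hyp.coideal_base(2)\<close>)
  moreover have "comult H (?r i) = ?t \<oplus>\<^bsub>?T\<^esub> ?p (?r i) (?r 1)"
  proof -
    have "comult H (?r i) = (\<Oplus>\<^bsub>?T\<^esub>k\<in>{1..N}. ?p (a i k g) (?r k))" by (rule hyp.comult_rs[OF i gG])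
    also have "\<dots> = (\<Oplus>\<^bsub>?T\<^esub>k\<in>{1..N}. ?p (a i k g) (?r k \<ominus>\<^bsub>H\<^esub> ?r 1) \<oplus>\<^bsub>?T\<^esub> ?p (a i k g) (?r 1))"
    proof (rule hyp.T.finsum_cong')
      fix k assume k: "k \<in> {1..N}"
      have "?r k = (?r k \<ominus>\<^bsub>H\<^esub> ?r 1) \<oplus>\<^bsub>H\<^esub> ?r 1"
        using rc[OF k] rc[OF one_ix] by (simp add: hyp.H.minus_eq hyp.H.a_assoc hyp.H.l_neg)
      then show "?p (a i k g) (?r k) = ?p (a i k g) (?r k \<ominus>\<^bsub>H\<^esub> ?r 1) \<oplus>\<^bsub>?T\<^esub> ?p (a i k g) (?r 1)"
        using bilinD(3)[OF hyp.HH.bilin_pure ac[OF k] rd[OF k] rc[OF one_ix]] by simp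
    qed (use ac rc rd one_ix in \<open>auto simp: hyp.HH.pure_closed\<close>)
    also have "\<dots> = ?t \<oplus>\<^bsub>?T\<^esub> (\<Oplus>\<^bsub>?T\<^esub>k\<in>{1..N}. ?p (a i k g) (?r 1))"
      by (rule hyp.T.finsum_addf) (use ac rc rd one_ix in \<open>auto simp: hyp.HH.pure_closed\<close>)
    also have "(\<Oplus>\<^bsub>?T\<^esub>k\<in>{1..N}. ?p (a i k g) (?r 1)) = ?p (?r i) (?r 1)"
      unfolding hyp.fam.rs_def[of i]
      by (rule hyp.HH.pure_finsum_l[symmetric]) (use ac rc[OF one_ix] in auto)
    finally show ?thesis .
  qed
  ultimately show thesis by (rule that)
qed

lemma hopf_star_ideal_J: "hopf_star_ideal J H"
proof (rule hyp.hopf_star_idealI[OF star_ideal_J J_minimal row_rels_subset])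
  let ?p = "pure_tensor H H" and ?T = "tensor H H"
  note K = hyp.star_ideal_coideal_set[OF star_ideal_J]
  note clK = star_ideal_closed[OF hyp.HH.staralg_tensor K]
  fix x assume x: "x \<in> row_rels"
  then obtain i j g where ij: "i \<in> {1..N}" "j \<in> {1..N}" and g: "g \<in> L"
    and x: "x = hyp.fam.rs i g \<ominus>\<^bsub>H\<^esub> hyp.fam.rs j g" by (rule row_relsE)
  have gG: "g \<in> carrier G" using g L.subset by auto
  let ?r = "\<lambda>i. hyp.fam.rs i g"
  have rc: "?r k \<in> carrier H" if "k \<in> {1..N}" for k using that gG by simp
  note rcs = rc[OF ij(1)] rc[OF ij(2)] rc[OF one_ix]
  obtain s where s: "s \<in> hyp.coideal_set J" "comult H (?r i) = s \<oplus>\<^bsub>?T\<^esub> ?p (?r i) (?r 1)"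
    by (rule comult_rs_mod_J[OF ij(1) g])
  obtain t where t: "t \<in> hyp.coideal_set J" "comult H (?r j) = t \<oplus>\<^bsub>?T\<^esub> ?p (?r j) (?r 1)"
    by (rule comult_rs_mod_J[OF ij(2) g])
  have st: "s \<in> carrier ?T" "t \<in> carrier ?T" using s(1) t(1) clK(1) by auto
  have pc: "?p (?r i) (?r 1) \<in> carrier ?T" "?p (?r j) (?r 1) \<in> carrier ?T" using rcs by (auto simp: hyp.HH.pure_closed)
  \<comment> \<open>Both row sums were compared with the same r_1, so modulo the coideal set
    \<Delta>(r_i - r_j) is (r_i - r_j) \<otimes> r_1, an element of J \<otimes> H.\<close>
  have "comult H x = comult H (?r i) \<ominus>\<^bsub>?T\<^esub> comult H (?r j)"
    unfolding x by (rule lin_hom_minus[OF hyp.alg hyp.HH.staralg_tensor star_hom_lin[OF hyp.comult] rcs(1,2)])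
  also have "\<dots> = (s \<ominus>\<^bsub>?T\<^esub> t) \<oplus>\<^bsub>?T\<^esub> (?p (?r i) (?r 1) \<ominus>\<^bsub>?T\<^esub> ?p (?r j) (?r 1))"
    unfolding s(2) t(2) using st pc by (simp add: hyp.T.minus_eq hyp.T.minus_add hyp.T.a_ac)
  also have "?p (?r i) (?r 1) \<ominus>\<^bsub>?T\<^esub> ?p (?r j) (?r 1) = ?p x (?r 1)"
    unfolding x by (rule lin_hom_minus[OF hyp.alg hyp.HH.staralg_tensor hyp.HH.pure_lin_l[OF rcs(3)] rcs(1,2), symmetric])
  finally have e: "comult H x = (s \<ominus>\<^bsub>?T\<^esub> t) \<oplus>\<^bsub>?T\<^esub> ?p x (?r 1)" .
  have xJ: "x \<in> J" unfolding x by (rule rs_diff_J[OF ij g])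
  show "comult H x \<in> hyp.coideal_set J"
    unfolding e by (intro clK(3) clK(4) s(1) t(1) hyp.coideal_base(1) xJ rcs(3))
  have "counit H x = counit H (?r i) + counit H ((-1) \<odot>\<^bsub>H\<^esub> ?r j)"
    unfolding x using rcs by (simp add: hyp.H.minus_eq_smult hyp.\<epsilon>_simps)
  then show "counit H x = 0" using rcs ij gG by (simp add: hyp.\<epsilon>_simps hyp.counit_rs)
  \<comment> \<open>S x is a difference of column sums at g^-1. Modulo \<open>J\<close> the row sums
    agree, hence by \<open>cs_eq_rs\<close> so do the column sums. The quotient is taken only as a
    *-algebra, because the Hopf property of \<open>J\<close> is what is being proved.\<close>
  interpret q: star_quotient H J
    using hyp.alg star_ideal_J by (simp add: star_quotient_def star_quotient_axioms_def)
  interpret f: hyp_family N G "star_quot H J" "\<lambda>i j g. q.q (a i j g)"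
    by (rule hyp.fam.fam_image[OF q.staralg_quot q.star_hom_quot])
  let ?h = "inv\<^bsub>G\<^esub> g"
  have h: "?h \<in> L" "?h \<in> carrier G" using g gG by auto
  have qr: "f.rs k ?h = q.q (hyp.fam.rs k ?h)" if "k \<in> {1..N}" for k
    unfolding f.rs_def by (rule rs_hom[OF q.staralg_quot q.star_hom_quot that h(2), symmetric])
  have rows: "f.rs k ?h = f.rs 1 ?h" if k: "k \<in> {1..N}" for k
    unfolding qr[OF k] qr[OF one_ix] using rs_diff_J[OF k one_ix h(1)] k one_ix h
    by (simp add: q.quot_eq_iff)
  have qc: "f.cs k ?h = q.q (hyp.fam.cs k ?h)" if k: "k \<in> {1..N}" for k
    unfolding f.cs_def hyp.fam.cs_def
    by (rule lin_hom_finsum[OF hyp.alg q.staralg_quot star_hom_lin[OF q.star_hom_quot], symmetric]) (use k h in auto)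
  have "f.cs i ?h = f.cs j ?h"
    by (rule trans[OF f.cs_eq_rs[OF ij(1) one_ix h(2) rows] f.cs_eq_rs[OF ij(2) one_ix h(2) rows, symmetric]])
  then have "q.q (hyp.fam.cs i ?h) = q.q (hyp.fam.cs j ?h)"
    unfolding qc[OF ij(1)] qc[OF ij(2)] .
  then have "hyp.fam.cs i ?h \<ominus>\<^bsub>H\<^esub> hyp.fam.cs j ?h \<in> J"
    using q.quot_eq_iff ij h by simp
  moreover have "antipode H x = hyp.fam.cs i ?h \<ominus>\<^bsub>H\<^esub> hyp.fam.cs j ?h"
    unfolding x using rcs ij gG h
    by (simp add: hyp.H.minus_eq_smult hyp.S_simps hyp.antipode_rs)
  ultimately show "antipode H x \<in> J" by simp
qed

lemma rel_hyp_ideal_eq: "rel_hyp_ideal N G L = J"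
proof
  have S: "{(\<Oplus>\<^bsub>H\<^esub>k\<in>{1..N}. a i k g) \<ominus>\<^bsub>H\<^esub> (\<Oplus>\<^bsub>H\<^esub>k\<in>{1..N}. a j k g) | i j g. i \<in> {1..N} \<and> j \<in> {1..N} \<and> g \<in> L} = row_rels"
    by (simp add: row_rels_def hyp.fam.rs_def)
  show "rel_hyp_ideal N G L \<subseteq> J"
    unfolding rel_hyp_ideal_def hopf_star_ideal_gen_def S using hopf_star_ideal_J row_rels_J by blast
  show "J \<subseteq> rel_hyp_ideal N G L"
    unfolding rel_hyp_ideal_def hopf_star_ideal_gen_def S using J_minimal by (auto simp: hopf_star_ideal_def)
qed

sublocale R: hopf_quotient H J
  by unfold_locales (rule hopf_star_ideal_J)

lemma rel_hyp_eq: "rel_hyp N G L = R.Q"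
  by (simp add: rel_hyp_def rel_hyp_ideal_eq)

abbreviation "ra \<equiv> rel_hyp_gen N G L"

lemma ra_eq: "ra i j g = R.Q.q (a i j g)"
  by (simp add: rel_hyp_gen_def rel_hyp_ideal_eq)

lemma q_hom: "star_hom H R.Q R.Q.q"
  using R.hopf_star_hom_quot by (simp add: hopf_star_hom_def)

lemma hopf_hyp_R: "hopf_hyp R.Q N G ra"
proof -
  interpret Q: pre_hopf_alg R.Q using R.pre_hopf_quot by (simp add: pre_hopf_alg_def)
  have ra: "ra = (\<lambda>i j g. R.Q.q (a i j g))" by (intro ext) (rule ra_eq)
  have fam: "hyp_family N G R.Q ra"
    unfolding ra by (rule hyp.fam.fam_image[OF Q.alg q_hom])
  note qh = R.hopf_star_hom_quot[unfolded hopf_star_hom_def]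
  show ?thesis
  proof (intro hopf_hyp.intro hopf_hyp_axioms.intro Q.pre_hopf_alg_axioms fam)
    fix i j g assume ij: "i \<in> {1..N}" "j \<in> {1..N}" and g: "g \<in> carrier G"
    have "comult R.Q (ra i j g) = tensor_map R.Q R.Q R.Q.q R.Q.q (comult H (a i j g))"
      unfolding ra using qh ij g by simp
    also have "\<dots> = (\<Oplus>\<^bsub>tensor R.Q R.Q\<^esub>k\<in>{1..N}. pure_tensor R.Q R.Q (ra i k g) (ra k j g))"
      unfolding hyp.comult_fam[OF ij g] ra
      by (rule tensor_map_sum[OF hyp.alg hyp.alg Q.alg Q.alg star_hom_lin[OF q_hom] star_hom_lin[OF q_hom]])
        (use ij g in auto)
    finally show "comult R.Q (ra i j g) = (\<Oplus>\<^bsub>tensor R.Q R.Q\<^esub>k\<in>{1..N}. pure_tensor R.Q R.Q (ra i k g) (ra k j g))" .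
    show "counit R.Q (ra i j g) = (if i = j then 1 else 0)"
      unfolding ra using qh ij g by (simp add: hyp.counit_fam)
    show "antipode R.Q (ra i j g) = ra j i (inv\<^bsub>G\<^esub> g)"
      unfolding ra using qh ij g by (simp add: hyp.antipode_fam)
  next
    have "generates R.Q (R.Q.q ` {a i j g | i j g. i \<in> {1..N} \<and> j \<in> {1..N} \<and> g \<in> carrier G})"
      by (rule generates_image[OF hyp.alg Q.alg hyp.generates_fam q_hom]) (simp add: R.carrier_Q)
    moreover have "R.Q.q ` {a i j g | i j g. i \<in> {1..N} \<and> j \<in> {1..N} \<and> g \<in> carrier G} =
        {ra i j g | i j g. i \<in> {1..N} \<and> j \<in> {1..N} \<and> g \<in> carrier G}"
      unfolding ra by blast
    ultimately show "generates R.Q {ra i j g | i j g. i \<in> {1..N} \<and> j \<in> {1..N} \<and> g \<in> carrier G}" by simp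
  qed
qed

sublocale rel: hopf_hyp R.Q N G ra
  by (rule hopf_hyp_R)

lemma rel_rs: "i \<in> {1..N} \<Longrightarrow> g \<in> carrier G \<Longrightarrow> rel.fam.rs i g = R.Q.q (hyp.fam.rs i g)"
  unfolding rel.fam.rs_def ra_eq by (rule rs_hom[OF rel.alg q_hom, symmetric])

lemma rel_rows:
  assumes "i \<in> {1..N}" "j \<in> {1..N}" "l \<in> L"
  shows "rel.fam.rs i l = rel.fam.rs j l"
proof -
  have "l \<in> carrier G" using assms L.subset by auto
  then show ?thesis using assms rs_diff_J[OF assms] by (simp add: rel_rs R.Q.quot_eq_iff)
qed

text \<open>Universal property of O(H_N^+(\<Gamma>, \<Lambda>)). Both the surjection onto
  O(H_N^+(\<Gamma>/\<Lambda>)) and the map to the group algebra of \<Gamma> that proves injectivity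
  of \<iota> come from it.\<close>

lemma rel_lift:
  assumes b: "hyp_family N G B b"
    and rows: "\<And>i j g. i \<in> {1..N} \<Longrightarrow> j \<in> {1..N} \<Longrightarrow> g \<in> L \<Longrightarrow> (\<Oplus>\<^bsub>B\<^esub>k\<in>{1..N}. b i k g) = (\<Oplus>\<^bsub>B\<^esub>k\<in>{1..N}. b j k g)"
  obtains f where "star_hom R.Q B f"
    "\<And>i j g. i \<in> {1..N} \<Longrightarrow> j \<in> {1..N} \<Longrightarrow> g \<in> carrier G \<Longrightarrow> f (ra i j g) = b i j g"
proof -
  interpret b: hyp_family N G B b by (rule b)
  let ?f = "presented_ext B (\<lambda>(i, j, g). b i j g)"
  have f: "star_hom H B ?f" using hyp_ext(1)[OF b] by (simp add: hyp_simps)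
  have rs: "?f (hyp.fam.rs i g) = (\<Oplus>\<^bsub>B\<^esub>k\<in>{1..N}. b i k g)" if i: "i \<in> {1..N}" and g: "g \<in> carrier G" for i g
    unfolding rs_hom[OF b.B.staralg_axioms f i g]
    by (rule b.B.finsum_cong') (use i g in \<open>auto simp: hyp_ext(2)[OF b]\<close>)
  have k: "?f x = \<zero>\<^bsub>B\<^esub>" if x: "x \<in> J" for x
  proof (rule kills_J[OF b.B.staralg_axioms f _ x])
    fix i j g assume ij: "i \<in> {1..N}" "j \<in> {1..N}" and g: "g \<in> L"
    have gG: "g \<in> carrier G" using g L.subset by auto
    show "?f (hyp.fam.rs i g) = ?f (hyp.fam.rs j g)"
      unfolding rs[OF ij(1) gG] rs[OF ij(2) gG] by (rule rows[OF ij g])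
  qed
  show thesis
  proof (rule that)
    show "star_hom R.Q B (\<lambda>X. the_elem (?f ` X))"
      using R.Q.quot_lift_hom[OF b.B.staralg_axioms f k] by (simp add: hopf_quot_def)
    show "the_elem (?f ` ra i j g) = b i j g" if "i \<in> {1..N}" "j \<in> {1..N}" "g \<in> carrier G" for i j g
      unfolding ra_eq using that
      by (subst R.Q.quot_lift[OF b.B.staralg_axioms star_hom_lin[OF f] k]) (simp_all add: hyp_ext(2)[OF b])
  qed
qed

end

theorem proposition5p2:
  fixes \<Gamma> :: "('g, 'x) monoid_scheme" and \<Lambda> :: "'g set" and N :: nat
  assumes "N \<ge> 1" and "group \<Gamma>" and "subgroup \<Lambda> \<Gamma>" and "\<Lambda> \<lhd> \<Gamma>"
  shows "\<exists>\<iota> \<pi>.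
    exact_sequence (dual_group (\<Gamma>\<lparr>carrier := \<Lambda>\<rparr>)) \<iota> (rel_hyp N \<Gamma> \<Lambda>) \<pi> (hyp N (\<Gamma> Mod \<Lambda>)) \<and>
    (\<forall>l\<in>\<Lambda>. \<forall>i\<in>{1..N}.
       \<iota> (group_elt l) = (\<Oplus>\<^bsub>rel_hyp N \<Gamma> \<Lambda>\<^esub>k\<in>{1..N}. rel_hyp_gen N \<Gamma> \<Lambda> i k l)) \<and>
    (\<forall>i\<in>{1..N}. \<forall>j\<in>{1..N}. \<forall>g\<in>carrier \<Gamma>.
       \<pi> (rel_hyp_gen N \<Gamma> \<Lambda> i j g) = hyp_gen N (\<Gamma> Mod \<Lambda>) i j (\<Lambda> #>\<^bsub>\<Gamma>\<^esub> g))"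
proof -
  interpret X: rel_presentation N \<Gamma> \<Lambda>
    using assms by (simp add: rel_presentation_def rel_presentation_axioms_def hyp_presentation_def)
  interpret normal \<Lambda> \<Gamma> by (rule assms(4))
  interpret E: hopf_hyp_rel X.R.Q N \<Gamma> "rel_hyp_gen N \<Gamma> \<Lambda>" \<Lambda>
    by (intro hopf_hyp_rel.intro hopf_hyp_rel_axioms.intro X.hopf_hyp_R assms X.rel_rows)
  interpret \<Gamma>: group_algebra \<Gamma> using assms(2) by (simp add: group_algebra_def)
  interpret Y: hyp_presentation N "\<Gamma> Mod \<Lambda>"
    by (simp add: hyp_presentation_def factorgroup_is_group)
  let ?K = "hyp N (\<Gamma> Mod \<Lambda>)"
  have hom: "\<Lambda> #>\<^bsub>\<Gamma>\<^esub> g \<in> carrier (\<Gamma> Mod \<Lambda>)"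
    "\<Lambda> #>\<^bsub>\<Gamma>\<^esub> (g \<otimes>\<^bsub>\<Gamma>\<^esub> h) = (\<Lambda> #>\<^bsub>\<Gamma>\<^esub> g) \<otimes>\<^bsub>\<Gamma> Mod \<Lambda>\<^esub> (\<Lambda> #>\<^bsub>\<Gamma>\<^esub> h)"
    if "g \<in> carrier \<Gamma>" "h \<in> carrier \<Gamma>" for g h
    using r_coset_hom_Mod that by (auto simp: hom_def)
  have famK: "hyp_family N \<Gamma> ?K (\<lambda>i j g. hyp_gen N (\<Gamma> Mod \<Lambda>) i j (\<Lambda> #>\<^bsub>\<Gamma>\<^esub> g))"
    by (rule Y.hyp.fam.fam_pullback[OF assms(2)]) (rule hom; assumption)+
  \<comment> \<open>Elements of \<Lambda> become trivial in \<Gamma>/\<Lambda>, so every row sum is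
    1 and the row sum relations hold in the target.\<close>
  have Kone: "(\<Oplus>\<^bsub>?K\<^esub>k\<in>{1..N}. hyp_gen N (\<Gamma> Mod \<Lambda>) i k (\<Lambda> #>\<^bsub>\<Gamma>\<^esub> g)) = \<one>\<^bsub>?K\<^esub>" if "i \<in> {1..N}" "g \<in> \<Lambda>" for i g
  proof -
    have "\<Lambda> #>\<^bsub>\<Gamma>\<^esub> g = \<one>\<^bsub>\<Gamma> Mod \<Lambda>\<^esub>"
      using that(2) X.L.subset by (simp add: FactGroup_def X.G.coset_join2 assms(3) subset_iff)
    then show ?thesis using Y.hyp.fam.fam_rsum[OF that(1)] by simp
  qed
  obtain p where p: "star_hom X.R.Q ?K p"
    "\<And>i j g. i \<in> {1..N} \<Longrightarrow> j \<in> {1..N} \<Longrightarrow> g \<in> carrier \<Gamma> \<Longrightarrow>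
      p (rel_hyp_gen N \<Gamma> \<Lambda> i j g) = hyp_gen N (\<Gamma> Mod \<Lambda>) i j (\<Lambda> #>\<^bsub>\<Gamma>\<^esub> g)"
    by (rule X.rel_lift[OF famK]) (simp_all add: Kone)
  have inj: "inj_on E.\<iota> (carrier (dual_group (\<Gamma>\<lparr>carrier := \<Lambda>\<rparr>)))"
  proof -
    interpret C: staralg \<Gamma>.GA.MA by (rule \<Gamma>.GA.staralg_MA)
    have d: "hyp_family N \<Gamma> \<Gamma>.GA.MA (\<lambda>i j g. if i = j then group_elt g else \<zero>\<^bsub>\<Gamma>.GA.MA\<^esub>)"
      by (rule fam_diagonal[OF assms(2) \<Gamma>.GA.staralg_MA])
        (simp_all add: \<Gamma>.group_elt_closed \<Gamma>.group_elt_star \<Gamma>.group_elt_mult \<Gamma>.group_elt_one)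
    have s: "(\<Oplus>\<^bsub>\<Gamma>.GA.MA\<^esub>k\<in>{1..N}. if i = k then group_elt g else \<zero>\<^bsub>\<Gamma>.GA.MA\<^esub>) = group_elt g"
      if "i \<in> {1..N}" "g \<in> \<Lambda>" for i g
      using C.finsum_singleton[of i "{1..N}" "\<lambda>_. group_elt g"] that by (simp add: \<Gamma>.group_elt_closed)
    obtain f where f: "star_hom X.R.Q \<Gamma>.GA.MA f"
      "\<And>i j g. i \<in> {1..N} \<Longrightarrow> j \<in> {1..N} \<Longrightarrow> g \<in> carrier \<Gamma> \<Longrightarrow>
        f (rel_hyp_gen N \<Gamma> \<Lambda> i j g) = (if i = j then group_elt g else \<zero>\<^bsub>\<Gamma>.GA.MA\<^esub>)"
      by (rule X.rel_lift[OF d]) (simp_all add: s)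
    have fr: "f (E.r l) = group_elt l" if l: "l \<in> \<Lambda>" for l
    proof -
      have "f (E.r l) = (\<Oplus>\<^bsub>\<Gamma>.GA.MA\<^esub>k\<in>{1..N}. f (rel_hyp_gen N \<Gamma> \<Lambda> 1 k l))"
        unfolding E.r_def X.rel.fam.rs_def
        by (rule lin_hom_finsum[OF X.rel.alg \<Gamma>.GA.staralg_MA star_hom_lin[OF f(1)]]) (use l in auto)
      also have "\<dots> = (\<Oplus>\<^bsub>\<Gamma>.GA.MA\<^esub>k\<in>{1..N}. if 1 = k then group_elt l else \<zero>\<^bsub>\<Gamma>.GA.MA\<^esub>)"
        by (rule C.finsum_cong') (use l in \<open>auto simp: f(2) \<Gamma>.group_elt_closed\<close>)
      also have "\<dots> = group_elt l" by (rule s) (use l in auto)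
      finally show ?thesis .
    qed
    \<comment> \<open>Elements of C[\<Lambda>] are finitely supported functions of the same type as
      those of C[\<Gamma>], so f after \<iota> is literally the identity and f is a left
      inverse.\<close>
    have "f (E.\<iota> b) = b" if "b \<in> carrier E.K.GA.MA" for b
      using that
    proof (induct rule: E.K.GA.MA_induct)
      case zero
      then show ?case
        using lin_hom_zero[OF E.K.GA.staralg_MA \<Gamma>.GA.staralg_MA lin_hom_comp[OF star_hom_lin[OF E.\<iota>_hom] star_hom_lin[OF f(1)]]]
        by (simp add: E.K.GA.MA_zero \<Gamma>.GA.MA_zero)
    next
      case (add l c b)
      have l: "l \<in> \<Lambda>" using add by simp
      have s: "Poly_Mapping.single l c = c \<odot>\<^bsub>E.K.GA.MA\<^esub> group_elt l" "Poly_Mapping.single l c = c \<odot>\<^bsub>\<Gamma>.GA.MA\<^esub> group_elt l"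
        by (simp_all add: group_elt_def E.K.GA.MA_smult_single \<Gamma>.GA.MA_smult_single)
      have gc: "group_elt l \<in> carrier E.K.GA.MA" using l by (simp add: E.K.group_elt_closed)
      note cD = lin_homD[OF lin_hom_comp[OF star_hom_lin[OF E.\<iota>_hom] star_hom_lin[OF f(1)]]]
      have "f (E.\<iota> (Poly_Mapping.single l c + b)) = f (E.\<iota> (c \<odot>\<^bsub>E.K.GA.MA\<^esub> group_elt l \<oplus>\<^bsub>E.K.GA.MA\<^esub> b))"
        by (simp add: s(1) E.K.GA.MA_add)
      also have "\<dots> = c \<odot>\<^bsub>\<Gamma>.GA.MA\<^esub> f (E.\<iota> (group_elt l)) \<oplus>\<^bsub>\<Gamma>.GA.MA\<^esub> f (E.\<iota> b)"
        using gc add(2) by (simp add: cD E.K.GA.MA_closed_smult)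
      also have "\<dots> = Poly_Mapping.single l c + b"
        using l add(3) by (simp add: E.\<iota>_elt fr s(2) \<Gamma>.GA.MA_add)
      finally show ?case .
    qed
    then show ?thesis by (intro inj_on_inverseI[of _ f]) (simp add: E.K.dual_group_simps)
  qed
  have univ: "\<exists>f. star_hom ?K C f \<and> (\<forall>i\<in>{1..N}. \<forall>j\<in>{1..N}. \<forall>g\<in>carrier (\<Gamma> Mod \<Lambda>). f (hyp_gen N (\<Gamma> Mod \<Lambda>) i j g) = c i j g)"
    if "hyp_family N (\<Gamma> Mod \<Lambda>) C c" for C :: "'g hyp_elt set set star_alg" and c
    using Y.hyp_ext[OF that] by (intro exI[of _ "presented_ext C (\<lambda>(i, j, g). c i j g)"]) (simp add: Y.hyp_simps)
  have ex: "exact_sequence (dual_group (\<Gamma>\<lparr>carrier := \<Lambda>\<rparr>)) E.\<iota> X.R.Q p ?K"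
    by (rule E.exact[OF Y.hyp.hopf_hyp_axioms univ inj p])
  \<comment> \<open>\<iota> was built from row 1; the row sum relations give the same value for
    every row i.\<close>
  have "E.\<iota> (group_elt l) = (\<Oplus>\<^bsub>X.R.Q\<^esub>k\<in>{1..N}. rel_hyp_gen N \<Gamma> \<Lambda> i k l)" if "l \<in> \<Lambda>" "i \<in> {1..N}" for l i
    using E.rows[OF X.one_ix that(2,1)] that by (simp add: E.\<iota>_elt E.r_def X.rel.fam.rs_def)
  with ex p(2) show ?thesis unfolding X.rel_hyp_eq by blast
qed

end
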